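(* Let $p=\lfloor\frac{n-4-3l}{l+1}\rfloor$. Then the poset $(\mathcal{U}_{n,l}^{4},\preceq)$ has exactly $p+1$ minimal elements, namely $U_{n,l}^{4,0},U_{n,l}^{4,1},\dots,U_{n,l}^{4,p}$.
   Context: For a graph $G$ on $n$ vertices with Laplacian matrix $L(G)=D(G)-A(G)$, write $\det(\lambda I_n-L(G))=\sum_{k=0}^n(-1)^k c_k(G)\lambda^{n-k}$. For graphs $G,H$ of order $n$, $G\preceq H$ means $c_k(G)\le c_k(H)$ for all $0\le k\le n$, and $G\prec H$ means $G\preceq H$ and $c_k(G)<c_k(H)$ for some $k$. A minimal element of a set of graphs (up to isomorphism) is a graph $G$ in it with no $H$ in the set satisfying $H\prec G$. A leaf is a vertex of degree $1$. $\mathcal{U}_{n,l}^g$ is the set of connected unicyclic graphs with $n$ vertices, exactly $l$ leaves and girth $g$. The balanced starlike tree $BST_{m,l}$ is the tree of order $m$ with $l$ leaves obtained by identifying one end of each of $l$ paths, each of order $\lfloor\frac{m-1}{l}\rfloor+1$ or $\lceil\frac{m-1}{l}\rceil+1$, into a single vertex (its center). $U_{n,l}^{g,q}$ ($q\ge0$) is obtained from the cycle $C_g$ and a path $w_0w_1\cdots w_q$ by identifying $w_0$ with a cycle vertex and $w_q$ with the center of $BST_{n-q-g+1,l}$ (for $q=0$ the center is identified with the cycle vertex).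
   Formalization: The statement is proved for l ≥ 2 and p ≥ 0; it fails otherwise: for l = 1, n = 9 there is only one graph but p + 1 = 2, for l = 0, n > 4 the set is empty, and for l = 2, n = 7 one has p + 1 = 0 although the set is nonempty. *)

theory Defs
  imports "Graph_Theory.Graph_Theory" "Jordan_Normal_Form.Char_Poly" "HOL-Library.Extended_Nat"
begin

text \<open>
  A finite simple graph is a \<^locale>\<open>pair_graph\<close>: a finite vertex set with a symmetric and
  irreflexive set of arcs, an edge \<open>uv\<close> being the two arcs \<open>(u, v)\<close> and \<open>(v, u)\<close>.
  Graphs of order \<open>n\<close> are taken on the vertex set \<open>{..<n}\<close>, which is also the index set
  of their \<open>n \<times> n\<close> matrices; statements up to isomorphism are made with isomorphism
  classes of such graphs.
\<close>

subsection \<open>Laplacian coefficients\<close>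

definition order_of :: "nat pair_pre_digraph \<Rightarrow> nat" where
  "order_of G = card (pverts G)"

text \<open>In a symmetric digraph the number of outgoing arcs is the number of neighbours.\<close>

definition degree_mat :: "nat pair_pre_digraph \<Rightarrow> int mat" where
  "degree_mat G = mat (order_of G) (order_of G)
     (\<lambda>(i, j). if i = j then int (out_degree (with_proj G) i) else 0)"

definition adjacency_mat :: "nat pair_pre_digraph \<Rightarrow> int mat" where
  "adjacency_mat G = mat (order_of G) (order_of G)
     (\<lambda>(i, j). if (i, j) \<in> parcs G then 1 else 0)"

definition laplacian :: "nat pair_pre_digraph \<Rightarrow> int mat" where
  "laplacian G = degree_mat G - adjacency_mat G"

text \<open>
  \<open>char_poly A\<close> is \<open>det (\<lambda> I - A)\<close>, so \<open>(-1)^k c_k\<close> is its coefficient at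
  \<open>\<lambda>^(n - k)\<close>; only \<open>k \<le> n\<close> is meaningful.
\<close>

definition lap_coeff :: "nat pair_pre_digraph \<Rightarrow> nat \<Rightarrow> int" where
  "lap_coeff G k = (- 1) ^ k * coeff (char_poly (laplacian G)) (order_of G - k)"

definition lap_le :: "nat pair_pre_digraph \<Rightarrow> nat pair_pre_digraph \<Rightarrow> bool" where
  "lap_le G H \<longleftrightarrow> order_of G = order_of H \<and> (\<forall>k \<le> order_of G. lap_coeff G k \<le> lap_coeff H k)"

definition lap_less :: "nat pair_pre_digraph \<Rightarrow> nat pair_pre_digraph \<Rightarrow> bool" where
  "lap_less G H \<longleftrightarrow> lap_le G H \<and> (\<exists>k \<le> order_of G. lap_coeff G k < lap_coeff H k)"

definition minimal_elements :: "nat pair_pre_digraph set \<Rightarrow> nat pair_pre_digraph set" where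
  "minimal_elements S = {G \<in> S. \<not> (\<exists>H \<in> S. lap_less H G)}"

definition iso_rel :: "nat pair_pre_digraph set \<Rightarrow> nat pair_pre_digraph rel" where
  "iso_rel S = {(G, H). G \<in> S \<and> H \<in> S \<and> digraph_iso (with_proj G) (with_proj H)}"

subsection \<open>Unicyclic graphs\<close>

text \<open>
  A directed cycle of length 2 runs forth and back along one edge, so the cycles of the
  undirected graph are those of length at least 3.
\<close>

definition graph_cycles :: "nat pair_pre_digraph \<Rightarrow> (nat \<times> nat) awalk set" where
  "graph_cycles G = {p. pre_digraph.cycle (with_proj G) p \<and> 3 \<le> length p}"

text \<open>
  Closed walks that differ in starting point or orientation are the same cycle; the cycle is
  identified by the set of its edges, that is, the set of its arcs and their reversals.
\<close>

definition unicyclic :: "nat pair_pre_digraph \<Rightarrow> bool" where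
  "unicyclic G \<longleftrightarrow> (\<exists>!C. \<exists>p \<in> graph_cycles G. C = set p \<union> (set p)\<inverse>)"

definition girth :: "nat pair_pre_digraph \<Rightarrow> enat" where
  "girth G = (INF p \<in> graph_cycles G. enat (length p))"

definition leaves :: "nat pair_pre_digraph \<Rightarrow> nat set" where
  "leaves G = {v \<in> pverts G. out_degree (with_proj G) v = 1}"

definition unicyclic_graphs :: "nat \<Rightarrow> nat \<Rightarrow> nat \<Rightarrow> nat pair_pre_digraph set" where
  "unicyclic_graphs n l g =
     {G. pair_graph G \<and> pverts G = {..<n} \<and> Digraph_Component.connected (with_proj G)
       \<and> unicyclic G \<and> card (leaves G) = l \<and> girth G = enat g}"

subsection \<open>The graphs $U_{n,l}^{g,q}$\<close>

text \<open>The edges of \<open>C_g\<close> on the vertices \<open>0, \<dots>, g - 1\<close>, each in one direction.\<close>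

definition cycle_edges :: "nat \<Rightarrow> nat rel" where
  "cycle_edges g = {(i, Suc i mod g) |i. i < g}"

text \<open>
  The edges of \<open>BST_{m,l}\<close> on the vertices \<open>0, \<dots>, m - 1\<close>, directed away from the center \<open>0\<close>.
  Apart from the center, the \<open>l\<close> paths are \<open>i, i + l, i + 2l, \<dots>\<close> for \<open>i = 1, \<dots>, l\<close>, the
  residue classes modulo \<open>l\<close> in \<open>{1..m - 1}\<close>; so each path has, center included, order
  \<open>\<lfloor>(m-1)/l\<rfloor> + 1\<close> or \<open>\<lceil>(m-1)/l\<rceil> + 1\<close>.
\<close>

definition BST_edges :: "nat \<Rightarrow> nat \<Rightarrow> nat rel" where
  "BST_edges m l = {(if j \<le> l then 0 else j - l, j) |j. 1 \<le> j \<and> j < m}"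

text \<open>
  The path vertex \<open>w_0\<close> is the cycle vertex \<open>0\<close>; the vertices \<open>w_1, \<dots>, w_q\<close> are
  \<open>g, \<dots>, g + q - 1\<close>.
\<close>

definition U_path_vertex :: "nat \<Rightarrow> nat \<Rightarrow> nat" where
  "U_path_vertex g i = (if i = 0 then 0 else g + i - 1)"

text \<open>
  The vertices of \<open>BST_{n-q-g+1,l}\<close>: the center is \<open>w_q\<close>, the other \<open>n - q - g\<close> vertices are
  \<open>g + q, \<dots>, n - 1\<close>.
\<close>

definition U_BST_vertex :: "nat \<Rightarrow> nat \<Rightarrow> nat \<Rightarrow> nat" where
  "U_BST_vertex g q j = (if j = 0 then U_path_vertex g q else g + q + j - 1)"

definition U_edges :: "nat \<Rightarrow> nat \<Rightarrow> nat \<Rightarrow> nat \<Rightarrow> nat rel" where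
  "U_edges n l g q =
     cycle_edges g
     \<union> {(U_path_vertex g i, U_path_vertex g (Suc i)) |i. i < q}
     \<union> map_prod (U_BST_vertex g q) (U_BST_vertex g q) ` BST_edges (n - q - g + 1) l"

definition U_graph :: "nat \<Rightarrow> nat \<Rightarrow> nat \<Rightarrow> nat \<Rightarrow> nat pair_pre_digraph" where
  "U_graph n l g q = \<lparr> pverts = {..<n}, parcs = U_edges n l g q \<union> (U_edges n l g q)\<inverse> \<rparr>"

end

theory Submission
  imports Defs "HOL-Combinatorics.Permutations"
begin

text \<open>
  The Laplacian coefficients are the coefficients of \<open>det (\<lambda> I + L)\<close>. For a rooted graph \<open>G\<close> write
  this determinant as \<open>\<lambda> P + S\<close>, where \<open>P\<close> is the minor obtained by deleting the root; hanging
  graphs on a common vertex then multiplies the \<open>P\<close> and acts on \<open>S\<close> as a derivation. A connected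
  unicyclic graph of girth 4 is a square with four rooted trees. If two of the trees are
  nontrivial, moving one of them onto the root of the other changes the polynomial by an explicit
  product with nonnegative coefficients, so in a minimal graph a single tree hangs on the square.

  Now let \<open>v\<close> carry a pendant path with \<open>b\<close> vertices, a neighbour \<open>w\<close> with remaining branches \<open>ws\<close>,
  and further branches \<open>os\<close>. Moving \<open>os\<close> from \<open>v\<close> to \<open>w\<close> keeps the number of leaves and lowers the
  polynomial by \<open>S os * (S ws * P_b - P ws * S_b)\<close>, where \<open>P_b\<close>, \<open>S_b\<close> belong to the path. The second
  factor is nonnegative as soon as \<open>ws\<close> contains a leaf at depth at least \<open>b\<close>. Choosing \<open>v\<close> with
  \<open>b\<close> as small as possible, this one move shows that a minimal graph has one branching vertex,
  that the lengths of its pendant paths differ by at most 1, and, when \<open>w\<close> lies on the way to the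
  square, that the pendant paths are longer by at least 3 than the path to the square. These are
  the graphs \<open>U_{n,l}^{4,q}\<close> with \<open>q \<le> p\<close>. In that range passing from \<open>q\<close> to \<open>q + 1\<close> makes the
  coefficient of \<open>\<lambda>^2\<close> smaller and that of \<open>\<lambda>^(n - 2 - 2 q)\<close> larger, so no two of them are comparable.
\<close>

subsection \<open>Determinants indexed by finite sets\<close>

text \<open>At \<lambda> = 0 the minor P of a rooted piece counts its spanning trees, and S begins
  with \<lambda> times this number times the number of vertices besides the root. So the lowest
  coefficient of S ws * P_b - P ws * S_b compares two sizes. If \<open>w\<close> is the first of q
  vertices on the way to the square, it has (q - 1) + 3 = q + 2 vertices behind it. Hence legs with
  at most q + 2 vertices can be improved, and the surviving ones have at least q + 3. With l such
  legs, the path and the square this needs n \<ge> 4 + 3 l + q (l + 1), which is q \<le> p. Beyond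
  the threshold the lowest coefficient is negative while the leading one stays positive.

  One graph has many rooted descriptions, and a move is available only at the root. Graphs are
  therefore tied to forms by a relation that is stable under reordering the branches and moving the
  root.

  Incomparability alone does not make the p + 1 graphs minimal: a graph outside the list might lie
  below one of them. Since the coefficients are nonnegative integers, every graph lies above a
  minimal one, and that one is on the list.\<close>

definition ldet :: "'a set \<Rightarrow> ('a \<Rightarrow> 'a \<Rightarrow> 'b::comm_ring_1) \<Rightarrow> 'b" where
  "ldet S M = (\<Sum>p | p permutes S. of_int (sign p) * (\<Prod>i\<in>S. M i (p i)))"

lemma ldet_cong:
  assumes "\<And>i j. i \<in> S \<Longrightarrow> j \<in> S \<Longrightarrow> M i j = M' i j"
  shows "ldet S M = ldet S M'"
  unfolding ldet_def using assms
  by (intro sum.cong refl arg_cong2[where f = "(*)"] prod.cong) (auto simp: permutes_in_image)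

text \<open>Only permutations that map \<open>A\<close> into itself contribute. Each is the
  composition of a permutation of \<open>A\<close> and one of \<open>B\<close>, and sign and product
  split accordingly.\<close>

lemma ldet_block:
  assumes fin: "finite A" "finite B" and disj: "A \<inter> B = {}"
    and zero: "\<And>i j. i \<in> A \<Longrightarrow> j \<in> B \<Longrightarrow> M i j = 0"
  shows "ldet (A \<union> B) M = ldet A M * ldet B M"
proof -
  define f where "f S p = of_int (sign p) * (\<Prod>i\<in>S. M i (p i))" for S p
  define Q where "Q = {p. p permutes A \<union> B \<and> p ` A \<subseteq> A}"
  have split: "f (A \<union> B) (p \<circ> q) = f A p * f B q" if p: "p permutes A" and q: "q permutes B" for p q
  proof -
    have "(\<Prod>i\<in>A. M i ((p \<circ> q) i)) = (\<Prod>i\<in>A. M i (p i))"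
      using disj permutes_not_in[OF q] by (intro prod.cong) (auto simp: disjoint_iff)
    moreover have "(\<Prod>i\<in>B. M i ((p \<circ> q) i)) = (\<Prod>i\<in>B. M i (q i))"
    proof (intro prod.cong refl)
      fix i assume "i \<in> B"
      then have "q i \<in> B" by (simp only: permutes_in_image[OF q])
      then have "q i \<notin> A" using disj by blast
      then show "M i ((p \<circ> q) i) = M i (q i)" by (simp only: o_apply permutes_not_in[OF p \<open>q i \<notin> A\<close>])
    qed
    moreover have "sign (p \<circ> q) = sign p * sign q"
      using p q fin by (intro sign_compose) (auto intro: permutes_imp_permutation)
    ultimately show ?thesis
      using fin disj by (simp add: f_def prod.union_disjoint)
  qed
  have "ldet (A \<union> B) M = sum (f (A \<union> B)) {p. p permutes A \<union> B}"
    by (simp add: ldet_def f_def)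
  also have "\<dots> = sum (f (A \<union> B)) Q"
  proof (intro sum.mono_neutral_right ballI)
    show "finite {p. p permutes A \<union> B}" using fin by (simp add: finite_permutations)
    show "Q \<subseteq> {p. p permutes A \<union> B}" by (auto simp: Q_def)
    fix p assume "p \<in> {p. p permutes A \<union> B} - Q"
    then obtain i where p: "p permutes A \<union> B" and i: "i \<in> A" "p i \<notin> A" by (auto simp: Q_def)
    then have "p i \<in> B" using permutes_in_image[OF p, of i] by auto
    then have "(\<Prod>i\<in>A \<union> B. M i (p i)) = 0"
      using fin i zero by (intro prod_zero) auto
    then show "f (A \<union> B) p = 0" by (simp add: f_def)
  qed
  also have "\<dots> = sum (\<lambda>(p, q). f A p * f B q) ({p. p permutes A} \<times> {q. q permutes B})"
  proof (rule sum.reindex_bij_witness[where i = "\<lambda>(p, q). p \<circ> q"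
        and j = "\<lambda>r. (restrict_id r A, restrict_id r B)"])
    fix r assume "r \<in> Q"
    then have r: "r permutes A \<union> B" and sub: "r ` A \<subseteq> A" by (auto simp: Q_def)
    have inj: "inj r" using r by (rule permutes_inj)
    \<comment> \<open>An injection of the finite set \<open>A\<close> into itself is onto, so the
      complement \<open>B\<close> is preserved as well.\<close>
    have rA: "r ` A = A" using sub fin inj by (simp add: endo_inj_surj inj_on_def inj_def)
    have "r ` (A \<union> B) = A \<union> B" using r by (rule permutes_image)
    moreover have "B = (A \<union> B) - A" using disj by auto
    ultimately have rB: "r ` B = B" using rA image_set_diff[OF inj, of "A \<union> B" A] by metis
    have "inj_on r A" "inj_on r B" using inj by (auto intro: inj_on_subset)
    then have pA: "restrict_id r A permutes A" and pB: "restrict_id r B permutes B"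
      using rA rB by (simp_all add: bij_betw_def permutes_restrict_id)
    show "(restrict_id r A, restrict_id r B) \<in> {p. p permutes A} \<times> {q. q permutes B}"
      using pA pB by simp
    show eq: "(case (restrict_id r A, restrict_id r B) of (p, q) \<Rightarrow> p \<circ> q) = r"
    proof (unfold prod.case, rule ext)
      fix i
      have "r i \<in> B" "i \<notin> A" if "i \<in> B" using that rB disj by auto
      then show "(restrict_id r A \<circ> restrict_id r B) i = r i"
        using disj permutes_not_in[OF r, of i] by (auto simp: restrict_id_def)
    qed
    show "(case (restrict_id r A, restrict_id r B) of (p, q) \<Rightarrow> f A p * f B q) = f (A \<union> B) r"
      using split[OF pA pB] eq by simp
  next
    fix pq assume "pq \<in> {p. p permutes A} \<times> {q. q permutes B}"
    then obtain p q where pq: "pq = (p, q)" and p: "p permutes A" and q: "q permutes B" by auto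
    have 1: "p (q i) = p i" if "i \<in> A" for i
    proof -
      have "i \<notin> B" using that disj by blast
      then show ?thesis by (simp only: permutes_not_in[OF q \<open>i \<notin> B\<close>])
    qed
    have 2: "p (q i) = q i" if "i \<in> B" for i
    proof -
      have "q i \<in> B" using that by (simp only: permutes_in_image[OF q])
      then have "q i \<notin> A" using disj by blast
      then show ?thesis by (rule permutes_not_in[OF p])
    qed
    have "p \<circ> q permutes A \<union> B"
      using p q by (intro permutes_compose) (auto intro: permutes_subset)
    moreover have "(p \<circ> q) ` A \<subseteq> A"
      using 1 permutes_in_image[OF p] by auto
    ultimately show "(case pq of (p, q) \<Rightarrow> p \<circ> q) \<in> Q"
      by (simp add: Q_def pq)
    have "restrict_id (p \<circ> q) A = p"
      using 1 permutes_not_in[OF p] by (intro ext) (simp add: restrict_id_def)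
    moreover have "restrict_id (p \<circ> q) B = q"
      using 2 permutes_not_in[OF q] by (intro ext) (simp add: restrict_id_def)
    ultimately show "(restrict_id (case pq of (p, q) \<Rightarrow> p \<circ> q) A, restrict_id (case pq of (p, q) \<Rightarrow> p \<circ> q) B) = pq"
      by (simp add: pq)
  qed
  also have "\<dots> = ldet A M * ldet B M"
    by (simp add: ldet_def f_def sum_product sum.cartesian_product)
  finally show ?thesis .
qed

lemma ldet_row_add:
  assumes fin: "finite S" and r: "r \<in> S"
    and row: "\<And>j. j \<in> S \<Longrightarrow> M r j = M1 r j + M2 r j"
    and eq: "\<And>i j. i \<in> S - {r} \<Longrightarrow> j \<in> S \<Longrightarrow> M1 i j = M i j \<and> M2 i j = M i j"
  shows "ldet S M = ldet S M1 + ldet S M2"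
proof -
  have "(\<Prod>i\<in>S. M i (p i)) = (\<Prod>i\<in>S. M1 i (p i)) + (\<Prod>i\<in>S. M2 i (p i))" if p: "p permutes S" for p
  proof -
    have "(\<Prod>i\<in>S - {r}. M1 i (p i)) = (\<Prod>i\<in>S - {r}. M i (p i))"
      "(\<Prod>i\<in>S - {r}. M2 i (p i)) = (\<Prod>i\<in>S - {r}. M i (p i))"
      using eq permutes_in_image[OF p] by (auto intro!: prod.cong)
    then show ?thesis
      using row[of "p r"] permutes_in_image[OF p] r
      by (simp add: prod.remove[OF fin r] algebra_simps)
  qed
  then show ?thesis
    by (simp add: ldet_def sum.distrib[symmetric] algebra_simps)
qed

text \<open>Row \<open>r\<close> is the sum of a part supported on \<open>A\<close> and a part
  supported on \<open>B\<close>. In each summand the matrix is block triangular, with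
  \<open>r\<close> in the block that supports its row. This is the derivation rule for gluing graphs
  at a vertex.\<close>

lemma ldet_cut_vertex:
  assumes fin: "finite A" "finite B" and AB: "A \<inter> B = {r}"
    and zero: "\<And>i j. i \<in> A - {r} \<Longrightarrow> j \<in> B - {r} \<Longrightarrow> M i j = 0 \<and> M j i = 0"
    and M1: "\<And>i j. i \<in> A \<Longrightarrow> j \<in> A \<Longrightarrow> (i, j) \<noteq> (r, r) \<Longrightarrow> M1 i j = M i j"
    and M2: "\<And>i j. i \<in> B \<Longrightarrow> j \<in> B \<Longrightarrow> (i, j) \<noteq> (r, r) \<Longrightarrow> M2 i j = M i j"
    and diag: "M r r = M1 r r + M2 r r"
  shows "ldet (A \<union> B) M = ldet A M1 * ldet (B - {r}) M2 + ldet (A - {r}) M1 * ldet B M2"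
proof -
  have r: "r \<in> A" "r \<in> B" using AB by auto
  define N1 where "N1 i j = (if i = r then if j \<in> A then M1 r j else 0 else M i j)" for i j
  define N2 where "N2 i j = (if i = r then if j \<in> B then M2 r j else 0 else M i j)" for i j
  have "ldet (A \<union> B) M = ldet (A \<union> B) N1 + ldet (A \<union> B) N2"
  proof (rule ldet_row_add[where r = r])
    fix j assume "j \<in> A \<union> B"
    then show "M r j = N1 r j + N2 r j"
      using r AB diag M1[of r j] M2[of r j] by (cases "j = r") (auto simp: N1_def N2_def)
  qed (use fin r in \<open>auto simp: N1_def N2_def\<close>)
  moreover have "ldet (A \<union> B) N1 = ldet A M1 * ldet (B - {r}) M2"
  proof -
    have "A \<union> B = A \<union> (B - {r})" using r by auto
    moreover have "ldet (A \<union> (B - {r})) N1 = ldet A N1 * ldet (B - {r}) N1"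
      using fin AB zero by (intro ldet_block) (auto simp: N1_def)
    moreover have "ldet A N1 = ldet A M1" "ldet (B - {r}) N1 = ldet (B - {r}) M2"
      using M1 M2 by (auto intro!: ldet_cong simp: N1_def)
    ultimately show ?thesis by simp
  qed
  moreover have "ldet (A \<union> B) N2 = ldet (A - {r}) M1 * ldet B M2"
  proof -
    have "A \<union> B = B \<union> (A - {r})" using r by auto
    moreover have "ldet (B \<union> (A - {r})) N2 = ldet B N2 * ldet (A - {r}) N2"
      using fin AB zero by (intro ldet_block) (auto simp: N2_def)
    moreover have "ldet B N2 = ldet B M2" "ldet (A - {r}) N2 = ldet (A - {r}) M1"
      using M1 M2 by (auto intro!: ldet_cong simp: N2_def)
    ultimately show ?thesis by simp
  qed
  ultimately show ?thesis by simp
qed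

lemma ldet_empty [simp]: "ldet {} M = 1"
  by (simp add: ldet_def)

text \<open>Every permutation of \<open>insert a S\<close> is uniquely \<open>transpose a b\<close>
  after a permutation of \<open>S\<close>, with \<open>b\<close> the image of \<open>a\<close>.
  Iterating this evaluates determinants over small explicit sets.\<close>

lemma ldet_insert:
  assumes S: "finite S" "a \<notin> S"
  shows "ldet (insert a S) M =
    (\<Sum>b\<in>insert a S. \<Sum>q | q permutes S. of_int (sign (transpose a b \<circ> q)) *
        (M a b * (\<Prod>i\<in>S. M i (transpose a b (q i)))))"
proof -
  have "of_int (sign (transpose a b \<circ> q)) * (\<Prod>i\<in>insert a S. M i ((transpose a b \<circ> q) i)) =
    of_int (sign (transpose a b \<circ> q)) * (M a b * (\<Prod>i\<in>S. M i (transpose a b (q i))))"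
    if "q permutes S" for b q
  proof -
    have "q a = a" using that S by (simp add: permutes_not_in)
    then show ?thesis using S by simp
  qed
  then show ?thesis
    unfolding ldet_def sum_over_permutations_insert[OF S]
    by (intro sum.cong refl) (simp only: mem_Collect_eq)
qed

lemma ldet_single [simp]: "ldet {a} M = M a a"
  by (simp add: ldet_insert)

lemma ldet_pair: "a \<noteq> b \<Longrightarrow> ldet {a, b} M = M a a * M b b - M a b * M b a"
  by (simp add: ldet_insert sum_over_permutations_insert sign_compose sign_swap_id permutation_compose permutation_swap_id)

text \<open>This is the minor of a square without its root: three vertices in a row remain, so only
  the identity and the two adjacent transpositions contribute.\<close>

lemma ldet_three_path:
  assumes dist: "distinct [a, b, c]" and M: "M a c = 0" "M c a = 0"
  shows "ldet {a, b, c} M = M a a * M b b * M c c - M a b * M b a * M c c - M a a * M b c * M c b"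
proof -
  have ne: "a \<noteq> b" "a \<noteq> c" "b \<noteq> c" "b \<noteq> a" "c \<noteq> a" "c \<noteq> b"
    using dist by auto
  show ?thesis
    by (simp add: ne ldet_insert sum_over_permutations_insert sign_compose sign_swap_id
          permutation_compose permutation_swap_id transpose_apply_other,
        simp add: M algebra_simps)
qed

text \<open>Contraction scales each row by a minor of its own, hence the four weights
  \<open>p\<close>, \<open>q\<close>, \<open>s\<close>, \<open>t\<close>. The two products of
  disjoint transpositions cancel against the two 4-cycles; the terms with a single transposition
  factor.\<close>

lemma ldet_four_cycle:
  assumes dist: "distinct [a, b, c, d]"
    and M: "M a c = 0" "M c a = 0" "M b d = 0" "M d b = 0"
      "M a b = - p" "M a d = - p" "M b a = - q" "M b c = - q"
      "M c b = - s" "M c d = - s" "M d a = - t" "M d c = - t"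
  shows "ldet {a, b, c, d} M =
    (M a a * M c c) * (M b b * M d d) - (p * M c c + s * M a a) * (q * M d d + t * M b b)"
proof -
  have ne: "a \<noteq> b" "a \<noteq> c" "a \<noteq> d" "b \<noteq> c" "b \<noteq> d" "c \<noteq> d"
    "b \<noteq> a" "c \<noteq> a" "d \<noteq> a" "c \<noteq> b" "d \<noteq> b" "d \<noteq> c"
    using dist by auto
  show ?thesis
    by (simp add: ne ldet_insert sum_over_permutations_insert sign_compose sign_swap_id
          permutation_compose permutation_swap_id transpose_apply_other,
        simp only: M mult_zero_left mult_zero_right minus_zero diff_zero diff_0 add_0_left add_0_right,
        simp add: algebra_simps)
qed

lemma ldet_row_scale:
  assumes fin: "finite S" and r: "r \<in> S"
    and row: "\<And>j. j \<in> S \<Longrightarrow> M r j = k * M1 r j"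
    and eq: "\<And>i j. i \<in> S - {r} \<Longrightarrow> j \<in> S \<Longrightarrow> M1 i j = M i j"
  shows "ldet S M = k * ldet S M1"
proof -
  have "(\<Prod>i\<in>S. M i (p i)) = k * (\<Prod>i\<in>S. M1 i (p i))" if p: "p permutes S" for p
  proof -
    have "(\<Prod>i\<in>S - {r}. M1 i (p i)) = (\<Prod>i\<in>S - {r}. M i (p i))"
      using eq permutes_in_image[OF p] by (auto intro!: prod.cong)
    then show ?thesis
      using row[of "p r"] permutes_in_image[OF p] r
      by (simp add: prod.remove[OF fin r] algebra_simps)
  qed
  then show ?thesis
    by (simp add: ldet_def sum_distrib_left algebra_simps)
qed

text \<open>
  If \<open>A\<close> meets the rest of the graph only in the cut vertex \<open>a\<close>, it may be contracted to \<open>a\<close>: row \<open>a\<close>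
  is scaled by the minor \<open>p\<close> and its diagonal entry corrected by the determinant \<open>s\<close> of \<open>A\<close>.
\<close>

lemma ldet_contract:
  assumes fin: "finite T" "finite A" and TA: "T \<inter> A = {a}"
    and zero: "\<And>i j. i \<in> T - {a} \<Longrightarrow> j \<in> A - {a} \<Longrightarrow> M i j = 0 \<and> M j i = 0"
    and N: "\<And>i j. i \<in> A \<Longrightarrow> j \<in> A \<Longrightarrow> (i, j) \<noteq> (a, a) \<Longrightarrow> M i j = N i j"
    and s: "ldet A N = s" and p: "ldet (A - {a}) N = p"
  shows "ldet (T \<union> A) M =
    ldet T (\<lambda>i j. if i = a then if j = a then p * (M a a - N a a) + s else p * M a j else M i j)"
    (is "_ = ldet T ?M'")
proof -
  have a: "a \<in> T" "a \<in> A" using TA by auto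
  define M1 where "M1 i j = (if (i, j) = (a, a) then M a a - N a a else M i j)" for i j
  define R1 where "R1 i j = (if i = a then p * M1 a j else M i j)" for i j
  define R2 where "R2 i j = (if i = a then if j = a then s else 0 else M i j)" for i j
  have "ldet (T \<union> A) M = ldet T M1 * ldet (A - {a}) N + ldet (T - {a}) M1 * ldet A N"
    using fin TA zero N by (intro ldet_cut_vertex) (auto simp: M1_def)
  also have "ldet T M1 * ldet (A - {a}) N = ldet T R1"
    using ldet_row_scale[of T a R1 p M1] fin a p by (simp add: R1_def M1_def mult.commute)
  also have "ldet (T - {a}) M1 * ldet A N = ldet T R2"
  proof -
    have "T = {a} \<union> (T - {a})" using a by auto
    moreover have "ldet ({a} \<union> (T - {a})) R2 = ldet {a} R2 * ldet (T - {a}) R2"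
      using fin by (intro ldet_block) (auto simp: R2_def)
    moreover have "ldet (T - {a}) R2 = ldet (T - {a}) M1"
      by (intro ldet_cong) (auto simp: R2_def M1_def)
    ultimately show ?thesis using s by (simp add: R2_def mult.commute)
  qed
  also have "ldet T R1 + ldet T R2 = ldet T ?M'"
    using fin a by (intro ldet_row_add[symmetric, where r = a]) (auto simp: R1_def R2_def M1_def)
  finally show ?thesis .
qed

subsection \<open>Rooted trees with cycles and their polynomials\<close>

definition nonneg_poly :: "int poly \<Rightarrow> bool" where
  "nonneg_poly p \<longleftrightarrow> (\<forall>k. 0 \<le> coeff p k)"

text \<open>A strict decrease in the coefficient order amounts to a difference that is
  \<open>pos_poly\<close>.\<close>

definition pos_poly :: "int poly \<Rightarrow> bool" where
  "pos_poly p \<longleftrightarrow> nonneg_poly p \<and> p \<noteq> 0"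

lemma nonneg_poly_0 [simp]: "nonneg_poly 0" and nonneg_poly_1 [simp]: "nonneg_poly 1"
  by (auto simp: nonneg_poly_def)

lemma nonneg_poly_add: "nonneg_poly p \<Longrightarrow> nonneg_poly q \<Longrightarrow> nonneg_poly (p + q)"
  by (simp add: nonneg_poly_def)

lemma nonneg_poly_mult: "nonneg_poly p \<Longrightarrow> nonneg_poly q \<Longrightarrow> nonneg_poly (p * q)"
  by (simp add: nonneg_poly_def coeff_mult sum_nonneg)

lemma nonneg_poly_pCons: "nonneg_poly (pCons a p) \<longleftrightarrow> 0 \<le> a \<and> nonneg_poly p"
  by (auto simp: nonneg_poly_def coeff_pCons split: nat.splits) 

lemma pos_poly_nonneg_poly: "pos_poly p \<Longrightarrow> nonneg_poly p"
  by (simp add: pos_poly_def)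

lemma pos_poly_1 [simp]: "pos_poly 1"
  by (simp add: pos_poly_def)

lemma nonneg_poly_add_eq_0: "nonneg_poly p \<Longrightarrow> nonneg_poly q \<Longrightarrow> p + q = 0 \<Longrightarrow> p = 0"
  unfolding nonneg_poly_def poly_eq_iff by (metis add_nonneg_eq_0_iff coeff_0 coeff_add)

lemma pos_poly_add_nonneg_poly: "pos_poly p \<Longrightarrow> nonneg_poly q \<Longrightarrow> pos_poly (p + q)"
  using nonneg_poly_add_eq_0 nonneg_poly_add by (auto simp: pos_poly_def)

lemma nonneg_poly_add_pos_poly: "nonneg_poly p \<Longrightarrow> pos_poly q \<Longrightarrow> pos_poly (p + q)"
  using pos_poly_add_nonneg_poly[of q p] by (simp add: add.commute)

lemma pos_poly_mult: "pos_poly p \<Longrightarrow> pos_poly q \<Longrightarrow> pos_poly (p * q)"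
  by (simp add: pos_poly_def nonneg_poly_mult)

lemma pos_poly_numeral [simp]: "pos_poly (numeral k)"
  by (simp add: pos_poly_def numeral_poly nonneg_poly_pCons)

text \<open>The variable is kept opaque, since the simplifier rewrites \<open>[:0, 1:] * p\<close> to \<open>pCons 0 p\<close>.\<close>

definition lam :: "int poly" where "lam = [:0, 1:]"

lemma pos_poly_lam [simp]: "pos_poly lam"
  by (simp add: pos_poly_def lam_def nonneg_poly_pCons)

text \<open>
  A list of branches, called a form, describes the graph hanging on its root: \<open>Br us\<close> is a child of
  the root carrying the branches \<open>us\<close>, and \<open>Cy xs ys zs\<close> stands for three further vertices that
  form a square with the root and carry the branches \<open>xs\<close>, \<open>ys\<close>, \<open>zs\<close>.
\<close>

datatype branch = Br "branch list" | Cy "branch list" "branch list" "branch list"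

text \<open>Nested recursion is traded for induction on the first branch and the remaining list,
  which matches the recursion of the polynomials and of the graphs.\<close>

lemma form_induct [case_names Nil Br Cy]:
  assumes "P []"
    and Br: "\<And>us ts. P us \<Longrightarrow> P ts \<Longrightarrow> P (Br us # ts)"
    and Cy: "\<And>xs ys zs ts. P xs \<Longrightarrow> P ys \<Longrightarrow> P zs \<Longrightarrow> P ts \<Longrightarrow> P (Cy xs ys zs # ts)"
  shows "P ts"
proof -
  have list: "P ts" if "\<And>t us. t \<in> set ts \<Longrightarrow> P us \<Longrightarrow> P (t # us)" for ts
    using that by (induction ts) (auto simp: assms(1))
  have "P (t # us)" if "P us" for t us
    using that
  proof (induction t arbitrary: us)
    case (Br x)
    then show ?case using assms(2) list[of x] by blast
  next
    case (Cy x y z)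
    then show ?case using assms(3) list[of x] list[of y] list[of z] by blast
  qed
  then show ?thesis using list by blast
qed

text \<open>
  The two polynomials of a branch are computed together, as primitive recursion allows only one
  function on branches.
\<close>

definition join_pair :: "int poly \<times> int poly \<Rightarrow> int poly \<times> int poly \<Rightarrow> int poly \<times> int poly" where
  "join_pair t u = (fst t * fst u, snd t * fst u + fst t * snd u)"

text \<open>With \<open>(P, S)\<close> belonging to the child, its edge to the root adds 1 to its
  diagonal entry, so the minor is \<open>(lam + 1) * P + S\<close>. The whole determinant is
  \<open>lam + 1\<close> times this minor, minus \<open>P\<close>; subtracting \<open>lam\<close>
  times the minor leaves \<open>lam * P + S\<close>.\<close>

definition br_pair :: "int poly \<times> int poly \<Rightarrow> int poly \<times> int poly" where
  "br_pair u = ((lam + 1) * fst u + snd u, lam * fst u + snd u)"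

text \<open>The determinant of a form whose root has two further edges, those of the square.\<close>

definition cy_diag :: "int poly \<times> int poly \<Rightarrow> int poly" where
  "cy_diag u = (lam + 2) * fst u + snd u"

text \<open>The first component is the determinant of three contracted corners in a row. The second
  is the determinant of the whole square minus \<open>lam\<close> times the first; the factor 2 is
  the degree of the bare root.\<close>

definition cy_pair ::
  "int poly \<times> int poly \<Rightarrow> int poly \<times> int poly \<Rightarrow> int poly \<times> int poly \<Rightarrow> int poly \<times> int poly" where
  "cy_pair u v w =
    (let a = cy_diag u * cy_diag v * cy_diag w - fst u * fst v * cy_diag w - cy_diag u * fst v * fst w
     in (a, 2 * a - cy_diag v * (fst u * cy_diag w + fst w * cy_diag u)))"

primrec branch_pair :: "branch \<Rightarrow> int poly \<times> int poly" where
  "branch_pair (Br us) = br_pair (foldr join_pair (map branch_pair us) (1, 0))"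
| "branch_pair (Cy xs ys zs) =
    cy_pair (foldr join_pair (map branch_pair xs) (1, 0))
      (foldr join_pair (map branch_pair ys) (1, 0))
      (foldr join_pair (map branch_pair zs) (1, 0))"

definition form_pair :: "branch list \<Rightarrow> int poly \<times> int poly" where
  "form_pair ts = foldr join_pair (map branch_pair ts) (1, 0)"

text \<open>
  For a form with matrix \<open>M = \<lambda> I + L\<close>, \<open>root_minor\<close> is the determinant of \<open>M\<close> without the root, and
  \<open>form_poly = lam * root_minor + root_link\<close> is the determinant of \<open>M\<close>. The values at a branch \<open>t\<close> are
  those of the form \<open>[t]\<close>.
\<close>

definition "branch_minor t = fst (branch_pair t)"
definition "branch_link t = snd (branch_pair t)"
definition "root_minor ts = fst (form_pair ts)"
definition "root_link ts = snd (form_pair ts)"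
definition "cycle_diag ts = (lam + 2) * root_minor ts + root_link ts"
definition "form_poly ts = lam * root_minor ts + root_link ts"

lemma root_minor_Nil [simp]: "root_minor [] = 1" and root_link_Nil [simp]: "root_link [] = 0"
  and root_minor_Cons: "root_minor (t # ts) = branch_minor t * root_minor ts"
  and root_link_Cons: "root_link (t # ts) = branch_link t * root_minor ts + branch_minor t * root_link ts"
  by (simp_all add: root_minor_def root_link_def branch_minor_def branch_link_def form_pair_def join_pair_def)

lemma branch_minor_Br: "branch_minor (Br us) = (lam + 1) * root_minor us + root_link us"
  and branch_link_Br: "branch_link (Br us) = lam * root_minor us + root_link us"
  by (simp_all add: root_minor_def root_link_def branch_minor_def branch_link_def form_pair_def br_pair_def)

lemma branch_minor_Cy: "branch_minor (Cy xs ys zs) = cycle_diag xs * cycle_diag ys * cycle_diag zs - root_minor xs * root_minor ys * cycle_diag zs - cycle_diag xs * root_minor ys * root_minor zs"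
  and branch_link_Cy: "branch_link (Cy xs ys zs) = 2 * branch_minor (Cy xs ys zs) - cycle_diag ys * (root_minor xs * cycle_diag zs + root_minor zs * cycle_diag xs)"
  by (simp_all add: root_minor_def root_link_def branch_minor_def branch_link_def form_pair_def cy_pair_def cy_diag_def cycle_diag_def Let_def)

lemma root_minor_append: "root_minor (xs @ ys) = root_minor xs * root_minor ys"
  by (induction xs) (simp_all add: root_minor_Cons)

lemma root_link_append: "root_link (xs @ ys) = root_link xs * root_minor ys + root_minor xs * root_link ys"
  by (induction xs) (simp_all add: root_minor_Cons root_link_Cons root_minor_append algebra_simps)

lemma pos_poly_linear:
  assumes "pos_poly p" "nonneg_poly s"
  shows "pos_poly (lam * p + s)" "pos_poly ((lam + 1) * p + s)" "pos_poly ((lam + 2) * p + s)"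
  using assms by (simp_all add: pos_poly_add_nonneg_poly pos_poly_mult pos_poly_nonneg_poly)

text \<open>The minus signs in \<open>cy_pair\<close> hide positivity. Writing
  \<open>d = t + 2 * p\<close>, where \<open>t\<close> is the determinant of the hanging form,
  cancels all of them.\<close>

lemma cy_expand:
  fixes tx ty tz px py pz :: "'a::comm_ring_1"
  defines "dx \<equiv> tx + 2 * px" and "dy \<equiv> ty + 2 * py" and "dz \<equiv> tz + 2 * pz"
  defines "a \<equiv> dx * dy * dz - px * py * dz - dx * py * pz"
  shows "a = dx * ty * dz + (py * (tx + px) * dz + py * dx * (tz + pz))"
    and "2 * a - dy * (px * dz + pz * dx) =
      ty * (dz * (tx + px) + dx * (tz + pz)) + 2 * py * (dz * tx + dx * tz)"
  unfolding assms by (simp_all add: algebra_simps)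

lemma Cy_pos:
  assumes "pos_poly (root_minor xs)" "pos_poly (root_minor ys)" "pos_poly (root_minor zs)" "nonneg_poly (root_link xs)" "nonneg_poly (root_link ys)" "nonneg_poly (root_link zs)"
  shows "pos_poly (branch_minor (Cy xs ys zs))" and "pos_poly (branch_link (Cy xs ys zs))"
proof -
  define tx where "tx = lam * root_minor xs + root_link xs"
  define ty where "ty = lam * root_minor ys + root_link ys"
  define tz where "tz = lam * root_minor zs + root_link zs"
  have t: "pos_poly tx" "pos_poly ty" "pos_poly tz"
    using assms unfolding tx_def ty_def tz_def by (simp_all add: pos_poly_linear)
  have cycle_diag: "pos_poly (cycle_diag xs)" "pos_poly (cycle_diag ys)" "pos_poly (cycle_diag zs)"
    using assms unfolding cycle_diag_def by (simp_all add: pos_poly_linear)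
  have d: "cycle_diag xs = tx + 2 * root_minor xs" "cycle_diag ys = ty + 2 * root_minor ys" "cycle_diag zs = tz + 2 * root_minor zs"
    by (simp_all add: cycle_diag_def tx_def ty_def tz_def algebra_simps)
  have "branch_minor (Cy xs ys zs) =
      cycle_diag xs * ty * cycle_diag zs + (root_minor ys * (tx + root_minor xs) * cycle_diag zs + root_minor ys * cycle_diag xs * (tz + root_minor zs))"
    unfolding branch_minor_Cy d by (rule cy_expand)
  then show "pos_poly (branch_minor (Cy xs ys zs))"
    using assms cycle_diag t by (simp add: pos_poly_add_nonneg_poly pos_poly_mult pos_poly_nonneg_poly)
  have "branch_link (Cy xs ys zs) =
      ty * (cycle_diag zs * (tx + root_minor xs) + cycle_diag xs * (tz + root_minor zs)) + 2 * root_minor ys * (cycle_diag zs * tx + cycle_diag xs * tz)"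
    unfolding branch_link_Cy branch_minor_Cy d by (rule cy_expand)
  then show "pos_poly (branch_link (Cy xs ys zs))"
    using assms cycle_diag t by (simp add: pos_poly_add_nonneg_poly pos_poly_mult pos_poly_nonneg_poly)
qed

lemma Cons_pos:
  assumes "pos_poly (branch_minor t)" "pos_poly (branch_link t)" "pos_poly (root_minor ts)" "nonneg_poly (root_link ts)"
  shows "pos_poly (root_minor (t # ts)) \<and> nonneg_poly (root_link (t # ts)) \<and> pos_poly (root_link (t # ts))"
  using assms by (simp add: root_minor_Cons root_link_Cons pos_poly_add_nonneg_poly pos_poly_mult nonneg_poly_mult pos_poly_nonneg_poly)

lemma root_minor_root_link_pos: "pos_poly (root_minor ts) \<and> nonneg_poly (root_link ts) \<and> (ts \<noteq> [] \<longrightarrow> pos_poly (root_link ts))"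
proof (induction ts rule: form_induct)
  case (Br us ts)
  then show ?case
    using Cons_pos[of "Br us" ts] by (simp add: branch_minor_Br branch_link_Br pos_poly_linear)
next
  case (Cy xs ys zs ts)
  then show ?case using Cons_pos[of "Cy xs ys zs" ts] by (simp add: Cy_pos)
qed simp

lemma root_minor_pos: "pos_poly (root_minor ts)" and root_link_nonneg_poly: "nonneg_poly (root_link ts)" and root_link_pos: "ts \<noteq> [] \<Longrightarrow> pos_poly (root_link ts)"
  using root_minor_root_link_pos by auto

text \<open>\<open>ray b\<close> is the pendant path with \<open>b\<close> vertices besides the root, so that \<open>Br (ray b)\<close> has \<open>b + 1\<close>.\<close>

primrec ray :: "nat \<Rightarrow> branch list" where
  "ray 0 = []"
| "ray (Suc b) = [Br (ray b)]"

lemma root_minor_ray_Suc: "root_minor (ray (Suc b)) = (lam + 1) * root_minor (ray b) + root_link (ray b)"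
  and root_link_ray_Suc: "root_link (ray (Suc b)) = lam * root_minor (ray b) + root_link (ray b)"
  by (simp_all add: root_minor_Cons root_link_Cons branch_minor_Br branch_link_Br)

text \<open>The comparison of the quotients \<open>root_link / root_minor\<close> for
  \<open>ws\<close> and for a pendant path, cleared of denominators.\<close>

definition slide_gain :: "branch list \<Rightarrow> nat \<Rightarrow> int poly" where
  "slide_gain ws b = root_link ws * root_minor (ray b) - root_minor ws * root_link (ray b)"

text \<open>Without \<open>os\<close> both forms describe the same graph, rooted at either end of
  one edge. Hanging \<open>os\<close> multiplies the common determinant by
  \<open>root_minor os\<close> and adds \<open>root_link os\<close> times the minor at the chosen
  end, so only the difference of the two minors survives.\<close>

lemma form_poly_slide:
  "form_poly (ray b @ Br ws # os) - form_poly (ray (Suc b) @ ws @ os) = root_link os * slide_gain ws b"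
  unfolding form_poly_def root_minor_append root_link_append root_minor_Cons root_link_Cons root_minor_ray_Suc root_link_ray_Suc branch_minor_Br branch_link_Br slide_gain_def
  by (simp add: algebra_simps power2_eq_square)

text \<open>A first edge common to the path and to one branch drops out of the gain; the remaining
  branches add a term with nonnegative coefficients.\<close>

lemma slide_gain_Suc: "slide_gain (xs @ Br us # ys) (Suc b) =
    root_minor (xs @ ys) * slide_gain us b + branch_minor (Br us) * root_link (xs @ ys) * root_minor (ray (Suc b))"
  unfolding root_minor_append root_link_append root_minor_Cons root_link_Cons root_minor_ray_Suc root_link_ray_Suc branch_minor_Br branch_link_Br slide_gain_def
  by (simp add: algebra_simps power2_eq_square)

lemma slide_gain_Br_Suc [simp]: "slide_gain [Br us] (Suc b) = slide_gain us b"
  using slide_gain_Suc[of "[]" us "[]" b] by simp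

text \<open>No square is crossed, so the depth is measured along a tree path.\<close>

inductive leaf_depth :: "branch list \<Rightarrow> nat \<Rightarrow> bool" where
  leaf_depth_Nil: "leaf_depth [] 0"
| leaf_depth_Br: "leaf_depth us d \<Longrightarrow> Br us \<in> set ts \<Longrightarrow> leaf_depth ts (Suc d)"

lemma leaf_depth_ray: "leaf_depth (ray b) b"
  by (induction b) (auto intro: leaf_depth.intros)

lemma branch_minor_Br_pos: "pos_poly (branch_minor (Br us))"
  unfolding branch_minor_Br by (simp add: pos_poly_linear root_minor_pos root_link_nonneg_poly)

text \<open>Descending to the leaf strips one edge from \<open>ws\<close> and one from the path,
  until the path is used up and the gain is a \<open>root_link\<close>. Strictness comes from there
  or from a branch left aside; for \<open>ws = ray b\<close> the gain is 0.\<close>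

lemma slide_gain_pos:
  assumes "leaf_depth ws d" "b \<le> d" "ws \<noteq> ray b"
  shows "pos_poly (slide_gain ws b)"
  using assms
proof (induction ws d arbitrary: b rule: leaf_depth.induct)
  case leaf_depth_Nil
  then show ?case by simp
next
  case (leaf_depth_Br us d ts)
  show ?case
  proof (cases b)
    case 0
    then show ?thesis using leaf_depth_Br.prems root_link_pos[of ts] by (simp add: slide_gain_def)
  next
    case (Suc c)
    obtain xs ys where ts: "ts = xs @ Br us # ys"
      using leaf_depth_Br.hyps(2) by (meson split_list)
    have D: "nonneg_poly (slide_gain us c)"
      using leaf_depth_Br.IH[of c] leaf_depth_Br.prems Suc
      by (cases "us = ray c") (auto simp: pos_poly_nonneg_poly slide_gain_def)
    show ?thesis
    proof (cases "xs @ ys = []")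
      case True
      then have "us \<noteq> ray c" using leaf_depth_Br.prems Suc ts by auto
      then show ?thesis
        using leaf_depth_Br.IH[of c] leaf_depth_Br.prems Suc ts True by simp
    next
      case False
      then show ?thesis unfolding ts Suc slide_gain_Suc
        by (intro nonneg_poly_add_pos_poly nonneg_poly_mult pos_poly_mult branch_minor_Br_pos root_link_pos root_minor_pos D pos_poly_nonneg_poly[OF root_minor_pos])
    qed
  qed
qed

text \<open>\<open>cycle_ray q\<close> is a path with \<open>q\<close> vertices whose last vertex, or the root if \<open>q = 0\<close>, lies on the square.\<close>

primrec cycle_ray :: "nat \<Rightarrow> branch" where
  "cycle_ray 0 = Cy [] [] []"
| "cycle_ray (Suc q) = Br [cycle_ray q]"

lemma slide_gain_cycle_ray_Suc [simp]: "slide_gain [cycle_ray (Suc q)] (Suc b) = slide_gain [cycle_ray q] b"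
  by simp

lemma cycle_diag_Nil: "cycle_diag [] = lam + 2"
  by (simp add: cycle_diag_def)

lemma slide_gain_cycle_ray_0: "slide_gain [cycle_ray 0] m =
   (lam + 2) * ((6 * lam + 2 * lam ^ 2) * root_minor (ray m) - (lam ^ 2 + 4 * lam + 2) * root_link (ray m))"
  unfolding slide_gain_def cycle_ray.simps root_minor_Cons root_link_Cons branch_link_Cy branch_minor_Cy cycle_diag_Nil root_minor_Nil root_link_Nil by (simp add: algebra_simps power2_eq_square)

text \<open>Both sides lose one edge at a time until the path ends or the square is reached, whose
  three further vertices are the 3 in the bound. At \<open>m = q + 3\<close> the coefficient of
  \<open>lam\<close> vanishes, but higher ones do not.\<close>

lemma slide_gain_cycle_ray_pos: "m \<le> q + 3 \<Longrightarrow> pos_poly (slide_gain [cycle_ray q] m)"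
proof (induction q arbitrary: m)
  case 0
  then consider "m = 0" | "m = 1" | "m = 2" | "m = 3" by force
  then show ?case
    by cases (simp_all add: slide_gain_cycle_ray_0[unfolded cycle_ray.simps] numeral_eq_Suc root_minor_ray_Suc root_link_ray_Suc
        lam_def pos_poly_def nonneg_poly_pCons numeral_poly one_pCons del: ray.simps(2))
next
  case (Suc q)
  then show ?case
  proof (cases m)
    case 0
    then show ?thesis by (simp add: slide_gain_def root_link_pos)
  next
    case (Suc c)
    then show ?thesis using Suc.IH[of c] Suc.prems by (simp del: cycle_ray.simps(2))
  qed
qed

text \<open>Exchanging the root with the opposite corner is a symmetry of the square carrying
  \<open>xs\<close> and \<open>zs\<close>, so all terms with the link of at most one of
  \<open>ys\<close>, \<open>ts\<close> agree. What is left is the minor without both corners, in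
  which the other two are disconnected.\<close>

lemma form_poly_merge_opposite:
  "form_poly (Cy xs ys zs # ts) - form_poly (Cy xs [] zs # ys @ ts) = root_link ys * root_link ts * cycle_diag xs * cycle_diag zs"
  unfolding form_poly_def root_minor_append root_link_append root_minor_Cons root_link_Cons branch_link_Cy branch_minor_Cy cycle_diag_def root_minor_Nil root_link_Nil by (simp add: algebra_simps power2_eq_square)

text \<open>With nothing on the other two corners, exchanging two adjacent corners is a symmetry.
  Deleting both leaves an edge whose diagonal entries are \<open>lam + 2\<close>, and its
  determinant \<open>(lam + 2) ^ 2 - 1\<close> is the last factor.\<close>

lemma form_poly_merge_adjacent:
  "form_poly (Cy xs [] [] # ts) - form_poly (Cy [] [] [] # xs @ ts) = root_link xs * root_link ts * (lam ^ 2 + 4 * lam + 3)"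
  unfolding form_poly_def root_minor_append root_link_append root_minor_Cons root_link_Cons branch_link_Cy branch_minor_Cy cycle_diag_def root_minor_Nil root_link_Nil by (simp add: algebra_simps power2_eq_square)

subsection \<open>Graphs described by forms\<close>

definition square :: "'a \<Rightarrow> 'a \<Rightarrow> 'a \<Rightarrow> 'a \<Rightarrow> 'a rel" where
  "square a b c d = {(a,b),(b,a),(b,c),(c,b),(c,d),(d,c),(d,a),(a,d)}"

text \<open>A relation, because one graph has several forms, depending on the root and the order of
  the branches. Edges are stored in both directions, as in \<open>parcs\<close>.\<close>

inductive built :: "branch list \<Rightarrow> 'a \<Rightarrow> 'a set \<Rightarrow> 'a rel \<Rightarrow> bool" where
  built_Nil: "built [] r {r} {}"
| built_Br: "built ts r S E \<Longrightarrow> built us w T F \<Longrightarrow> S \<inter> T = {} \<Longrightarrow>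
    built (Br us # ts) r (S \<union> T) (E \<union> F \<union> {(r, w), (w, r)})"
| built_Cy: "built ts r S E \<Longrightarrow> built xs a A EA \<Longrightarrow> built ys b B EB \<Longrightarrow> built zs c C EC \<Longrightarrow>
    S \<inter> A = {} \<Longrightarrow> S \<inter> B = {} \<Longrightarrow> S \<inter> C = {} \<Longrightarrow> A \<inter> B = {} \<Longrightarrow> A \<inter> C = {} \<Longrightarrow> B \<inter> C = {} \<Longrightarrow>
    built (Cy xs ys zs # ts) r (S \<union> A \<union> B \<union> C) (E \<union> EA \<union> EB \<union> EC \<union> square r a b c)"

lemma built_wf:
  assumes "built ts r S E"
  shows built_finite: "finite S" and built_root: "r \<in> S" and built_edges: "E \<subseteq> S \<times> S"
    and built_sym: "sym E" and built_irrefl: "irrefl E"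
proof -
  have "finite S \<and> r \<in> S \<and> E \<subseteq> S \<times> S \<and> sym E \<and> irrefl E"
    using assms
  proof induction
    case (built_Br ts r S E us w T F)
    then have "r \<noteq> w" by blast
    then show ?case using built_Br by (auto simp: sym_def irrefl_def)
  next
    case (built_Cy ts r S E xs a A EA ys b B EB zs c C EC)
    then have "distinct [r, a, b, c]" by auto
    moreover have "square r a b c \<subseteq> (S \<union> A \<union> B \<union> C) \<times> (S \<union> A \<union> B \<union> C)"
      using built_Cy by (auto simp: square_def)
    moreover have "E \<union> EA \<union> EB \<union> EC \<subseteq> (S \<union> A \<union> B \<union> C) \<times> (S \<union> A \<union> B \<union> C)"
      using built_Cy by blast
    moreover have "sym (square r a b c)" by (auto simp: sym_def square_def)
    moreover have "irrefl (square r a b c)" using calculation(1) by (auto simp: irrefl_def square_def)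
    ultimately show ?case using built_Cy by (auto simp: irrefl_def intro!: sym_Un)
  qed (auto simp: sym_def irrefl_def)
  then show "finite S" "r \<in> S" "E \<subseteq> S \<times> S" "sym E" "irrefl E" by auto
qed

definition deg :: "'a rel \<Rightarrow> 'a \<Rightarrow> nat" where
  "deg E i = card (E `` {i})"

text \<open>The matrix \<lambda> I + L, and not \<lambda> I - L, so that all coefficients of its
  determinant are nonnegative.\<close>

definition lap_mat :: "'a rel \<Rightarrow> 'a \<Rightarrow> 'a \<Rightarrow> int poly" where
  "lap_mat E i j = (if i = j then lam + of_nat (deg E i) else if (i, j) \<in> E then -1 else 0)"

lemma lap_mat_eq:
  assumes "\<And>k. i \<noteq> v \<Longrightarrow> (i, k) \<in> G \<longleftrightarrow> (i, k) \<in> F" "(v, j) \<in> G \<longleftrightarrow> (v, j) \<in> F" "(i, j) \<noteq> (v, v)"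
  shows "lap_mat G i j = lap_mat F i j"
proof (cases "i = v")
  case False
  then have "G `` {i} = F `` {i}" using assms(1) by blast
  then show ?thesis using assms(1)[OF False] by (auto simp: lap_mat_def deg_def)
qed (use assms in \<open>auto simp: lap_mat_def\<close>)

text \<open>A hanging form meets the rest in its root alone and can be contracted to that vertex.
  What remains is an edge with two weighted ends or a square with four weighted corners, and
  \<open>branch_pair\<close> records its determinant. The minor is a product, because no edge joins
  \<open>S - {r}\<close> to the new branch.\<close>

lemma built_ldet:
  assumes "built ts r S E"
  shows "ldet S (lap_mat E) = form_poly ts \<and> ldet (S - {r}) (lap_mat E) = root_minor ts"
  using assms
proof induction
  case (built_Nil r)
  then show ?case by (simp add: lap_mat_def deg_def form_poly_def)
next
  case (built_Br ts r S E us w T F)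
  let ?E = "E \<union> F \<union> {(r, w), (w, r)}"
  note wS = built_wf[OF built_Br.hyps(1)] and wT = built_wf[OF built_Br.hyps(2)]
  note ES = wS(3) and FT = wT(3) and ST = built_Br.hyps(3)
  have rw: "r \<noteq> w" "r \<notin> T" "w \<notin> S" using wS wT ST by auto
  have "?E `` {r} = insert w (E `` {r})" "?E `` {w} = insert r (F `` {w})"
    using rw ES FT by auto
  moreover have "w \<notin> E `` {r}" "r \<notin> F `` {w}" "finite (E `` {r})" "finite (F `` {w})"
    using rw ES FT wS wT by (auto intro: finite_subset[of _ S] finite_subset[of _ T])
  ultimately have deg: "deg ?E r = deg E r + 1" "deg ?E w = deg F w + 1"
    by (simp_all add: deg_def)
  have NS: "lap_mat ?E i j = lap_mat E i j" if "i \<in> S" "j \<in> S" "(i, j) \<noteq> (r, r)" for i j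
  proof (rule lap_mat_eq)
    show "(i, k) \<in> ?E \<longleftrightarrow> (i, k) \<in> E" if "i \<noteq> r" for k
      using that \<open>i \<in> S\<close> rw FT ST by blast
    show "(r, j) \<in> ?E \<longleftrightarrow> (r, j) \<in> E" using \<open>j \<in> S\<close> rw FT ST by blast
  qed fact
  have NT: "lap_mat ?E i j = lap_mat F i j" if "i \<in> T" "j \<in> T" "(i, j) \<noteq> (w, w)" for i j
  proof (rule lap_mat_eq)
    show "(i, k) \<in> ?E \<longleftrightarrow> (i, k) \<in> F" if "i \<noteq> w" for k
      using that \<open>i \<in> T\<close> rw ES ST by blast
    show "(w, j) \<in> ?E \<longleftrightarrow> (w, j) \<in> F" using \<open>j \<in> T\<close> rw ES ST by blast
  qed fact
  have X: "lap_mat ?E i j = 0 \<and> lap_mat ?E j i = 0" if "i \<in> S" "j \<in> T" "(i, j) \<noteq> (r, w)" for i j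
  proof -
    have "i \<noteq> j" "(i, j) \<notin> ?E" "(j, i) \<notin> ?E" using that ES FT ST rw by blast+
    then show ?thesis by (simp add: lap_mat_def)
  qed
  have D: "lap_mat ?E r r - lap_mat E r r = 1" "lap_mat ?E w w - lap_mat F w w = 1"
    "lap_mat ?E r w = -1" "lap_mat ?E w r = -1"
    using rw deg by (auto simp: lap_mat_def)
  \<comment> \<open>\<open>M1\<close> arises by contracting \<open>S\<close> to \<open>r\<close>,
    and \<open>M2\<close> by contracting \<open>T\<close> to \<open>w\<close> as well. The factor 1
    is the extra degree caused by the new edge.\<close>
  define M1 where "M1 i j = (if i = r then if j = r then root_minor ts * 1 + form_poly ts
    else root_minor ts * lap_mat ?E r j else lap_mat ?E i j)" for i j
  define M2 where "M2 i j = (if i = w then if j = w then root_minor us * 1 + form_poly us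
    else root_minor us * lap_mat ?E w j else M1 i j)" for i j
  have "ldet (({r} \<union> T) \<union> S) (lap_mat ?E) = ldet ({r} \<union> T) M1"
    unfolding M1_def[abs_def] D(1)[symmetric]
    by (rule ldet_contract) (use built_Br.IH rw wS wT X NS ST in auto)
  also have "\<dots> = ldet ({r, w} \<union> T) M1"
    using wT by (simp add: insert_absorb)
  also have "\<dots> = ldet {r, w} M2"
  proof -
    have "M1 w w - lap_mat F w w = 1" using rw D by (simp add: M1_def)
    moreover have "M1 w j = lap_mat ?E w j" for j using rw by (simp add: M1_def)
    ultimately have M2: "M2 = (\<lambda>i j. if i = w then if j = w then root_minor us * (M1 w w - lap_mat F w w) + form_poly us
      else root_minor us * M1 w j else M1 i j)" by (simp add: M2_def fun_eq_iff)
    show ?thesis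
      unfolding M2 by (rule ldet_contract) (use built_Br.IH rw wT X NT wS ST in \<open>auto simp: M1_def\<close>)
  qed
  also have "\<dots> = form_poly (Br us # ts)"
    using rw D by (simp add: ldet_pair M2_def M1_def form_poly_def root_minor_Cons root_link_Cons branch_minor_Br branch_link_Br algebra_simps)
  finally have 1: "ldet (S \<union> T) (lap_mat ?E) = form_poly (Br us # ts)"
    using wS(2) by (simp add: Un_commute insert_absorb)
  have "ldet ({w} \<union> T) (lap_mat ?E) = ldet {w} (\<lambda>i j. if i = w then if j = w
      then root_minor us * (lap_mat ?E w w - lap_mat F w w) + form_poly us else root_minor us * lap_mat ?E w j else lap_mat ?E i j)"
    by (rule ldet_contract) (use built_Br.IH rw wS wT X NT ST in auto)
  then have 2: "ldet T (lap_mat ?E) = branch_minor (Br us)"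
    using wT(2) D by (simp add: insert_absorb form_poly_def branch_minor_Br algebra_simps)
  have 3: "ldet (S - {r}) (lap_mat ?E) = root_minor ts"
  proof -
    have "ldet (S - {r}) (lap_mat ?E) = ldet (S - {r}) (lap_mat E)"
      by (rule ldet_cong) (use NS in auto)
    then show ?thesis using built_Br.IH by simp
  qed
  have 4: "S \<union> T - {r} = (S - {r}) \<union> T" using rw by auto
  have 5: "ldet ((S - {r}) \<union> T) (lap_mat ?E) = ldet (S - {r}) (lap_mat ?E) * ldet T (lap_mat ?E)"
    using wS wT ST X by (intro ldet_block) auto
  have "ldet (S \<union> T - {r}) (lap_mat ?E) = root_minor (Br us # ts)"
    unfolding 4 5 3 2 root_minor_Cons by (rule mult.commute)
  from 1 this show ?case by (rule conjI)
next
  case (built_Cy ts r S E xs a A EA ys b B EB zs c C EC)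
  let ?E = "E \<union> EA \<union> EB \<union> EC \<union> square r a b c"
  note wS = built_wf[OF built_Cy.hyps(1)] and wA = built_wf[OF built_Cy.hyps(2)]
    and wB = built_wf[OF built_Cy.hyps(3)] and wC = built_wf[OF built_Cy.hyps(4)]
  note sub = wS(3) wA(3) wB(3) wC(3)
  note disj = built_Cy.hyps(5-10)
  have ne: "r \<noteq> a" "r \<noteq> b" "r \<noteq> c" "a \<noteq> b" "a \<noteq> c" "b \<noteq> c"
    using wS wA wB wC disj by auto
  note ne = ne ne[symmetric]
  note roots = wS(2) wA(2) wB(2) wC(2)
  have out: "r \<notin> A" "r \<notin> B" "r \<notin> C" "a \<notin> S" "a \<notin> B" "a \<notin> C"
     "b \<notin> S" "b \<notin> A" "b \<notin> C" "c \<notin> S" "c \<notin> A" "c \<notin> B"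
    using wS wA wB wC disj by auto
  have two: "deg ?E i = deg F i + 2"
    if "?E `` {i} = insert j (insert k (F `` {i}))" "j \<notin> F `` {i}" "k \<notin> F `` {i}" "j \<noteq> k" "F \<subseteq> Z \<times> Z" "finite Z"
    for F Z i j k
  proof -
    have "finite (F `` {i})" using that by (auto intro: finite_subset[of _ Z])
    then show ?thesis using that by (simp add: deg_def)
  qed
  have degr: "deg ?E r = deg E r + 2"
    by (rule two[of _ a c _ S]) (use out ne sub wS in \<open>auto simp: square_def\<close>)
  have dega: "deg ?E a = deg EA a + 2"
    by (rule two[of _ r b _ A]) (use out ne sub wA in \<open>auto simp: square_def\<close>)
  have degb: "deg ?E b = deg EB b + 2"
    by (rule two[of _ a c _ B]) (use out ne sub wB in \<open>auto simp: square_def\<close>)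
  have degc: "deg ?E c = deg EC c + 2"
    by (rule two[of _ r b _ C]) (use out ne sub wC in \<open>auto simp: square_def\<close>)
  let ?L = "lap_mat ?E"
  have nE: "i \<notin> S \<Longrightarrow> (i, k) \<notin> E" "i \<notin> A \<Longrightarrow> (i, k) \<notin> EA" "i \<notin> B \<Longrightarrow> (i, k) \<notin> EB" "i \<notin> C \<Longrightarrow> (i, k) \<notin> EC"
    "k \<notin> S \<Longrightarrow> (i, k) \<notin> E" "k \<notin> A \<Longrightarrow> (i, k) \<notin> EA" "k \<notin> B \<Longrightarrow> (i, k) \<notin> EB" "k \<notin> C \<Longrightarrow> (i, k) \<notin> EC" for i k
    using sub by blast+
  have NS: "?L i j = lap_mat E i j" if "i \<in> S" "j \<in> S" "(i, j) \<noteq> (r, r)" for i j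
  proof (rule lap_mat_eq)
    have i: "i \<notin> A" "i \<noteq> a" "i \<notin> B" "i \<noteq> b" "i \<notin> C" "i \<noteq> c" using \<open>i \<in> S\<close> disj out by auto
    have j: "j \<notin> A" "j \<noteq> a" "j \<notin> B" "j \<noteq> b" "j \<notin> C" "j \<noteq> c" using \<open>j \<in> S\<close> disj out by auto
    show "(i, k) \<in> ?E \<longleftrightarrow> (i, k) \<in> E" if "i \<noteq> r" for k
      using that i by (simp add: nE square_def)
    show "(r, j) \<in> ?E \<longleftrightarrow> (r, j) \<in> E" using j ne out by (simp add: nE square_def)
  qed fact
  have NA: "?L i j = lap_mat EA i j" if "i \<in> A" "j \<in> A" "(i, j) \<noteq> (a, a)" for i j
  proof (rule lap_mat_eq)
    have i: "i \<notin> S" "i \<noteq> r" "i \<notin> B" "i \<noteq> b" "i \<notin> C" "i \<noteq> c" using \<open>i \<in> A\<close> disj out by auto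
    have j: "j \<notin> S" "j \<noteq> r" "j \<notin> B" "j \<noteq> b" "j \<notin> C" "j \<noteq> c" using \<open>j \<in> A\<close> disj out by auto
    show "(i, k) \<in> ?E \<longleftrightarrow> (i, k) \<in> EA" if "i \<noteq> a" for k
      using that i by (simp add: nE square_def)
    show "(a, j) \<in> ?E \<longleftrightarrow> (a, j) \<in> EA" using j ne out by (simp add: nE square_def)
  qed fact
  have NB: "?L i j = lap_mat EB i j" if "i \<in> B" "j \<in> B" "(i, j) \<noteq> (b, b)" for i j
  proof (rule lap_mat_eq)
    have i: "i \<notin> S" "i \<noteq> r" "i \<notin> A" "i \<noteq> a" "i \<notin> C" "i \<noteq> c" using \<open>i \<in> B\<close> disj out by auto
    have j: "j \<notin> S" "j \<noteq> r" "j \<notin> A" "j \<noteq> a" "j \<notin> C" "j \<noteq> c" using \<open>j \<in> B\<close> disj out by auto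
    show "(i, k) \<in> ?E \<longleftrightarrow> (i, k) \<in> EB" if "i \<noteq> b" for k
      using that i by (simp add: nE square_def)
    show "(b, j) \<in> ?E \<longleftrightarrow> (b, j) \<in> EB" using j ne out by (simp add: nE square_def)
  qed fact
  have NC: "?L i j = lap_mat EC i j" if "i \<in> C" "j \<in> C" "(i, j) \<noteq> (c, c)" for i j
  proof (rule lap_mat_eq)
    have i: "i \<notin> S" "i \<noteq> r" "i \<notin> A" "i \<noteq> a" "i \<notin> B" "i \<noteq> b" using \<open>i \<in> C\<close> disj out by auto
    have j: "j \<notin> S" "j \<noteq> r" "j \<notin> A" "j \<noteq> a" "j \<notin> B" "j \<noteq> b" using \<open>j \<in> C\<close> disj out by auto
    show "(i, k) \<in> ?E \<longleftrightarrow> (i, k) \<in> EC" if "i \<noteq> c" for k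
      using that i by (simp add: nE square_def)
    show "(c, j) \<in> ?E \<longleftrightarrow> (c, j) \<in> EC" using j ne out by (simp add: nE square_def)
  qed fact
  have ZS: "?L i j = 0" "?L j i = 0" if "i \<in> A \<union> B \<union> C" "j \<in> S - {r}" for i j
  proof -
    have "j \<noteq> r" "i \<notin> S" "j \<notin> A" "j \<noteq> a" "j \<notin> B" "j \<noteq> b" "j \<notin> C" "j \<noteq> c" "i \<noteq> j"
      using that disj out by auto
    then show "?L i j = 0" "?L j i = 0" by (simp_all add: lap_mat_def nE square_def)
  qed
  have ZA: "?L i j = 0" "?L j i = 0" if "i \<in> S \<union> B \<union> C" "j \<in> A - {a}" for i j
  proof -
    have "j \<noteq> a" "i \<notin> A" "j \<notin> S" "j \<noteq> r" "j \<notin> B" "j \<noteq> b" "j \<notin> C" "j \<noteq> c" "i \<noteq> j"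
      using that disj out by auto
    then show "?L i j = 0" "?L j i = 0" by (simp_all add: lap_mat_def nE square_def)
  qed
  have ZB: "?L i j = 0" "?L j i = 0" if "i \<in> S \<union> A \<union> C" "j \<in> B - {b}" for i j
  proof -
    have "j \<noteq> b" "i \<notin> B" "j \<notin> S" "j \<noteq> r" "j \<notin> A" "j \<noteq> a" "j \<notin> C" "j \<noteq> c" "i \<noteq> j"
      using that disj out by auto
    then show "?L i j = 0" "?L j i = 0" by (simp_all add: lap_mat_def nE square_def)
  qed
  have ZC: "?L i j = 0" "?L j i = 0" if "i \<in> S \<union> A \<union> B" "j \<in> C - {c}" for i j
  proof -
    have "j \<noteq> c" "i \<notin> C" "j \<notin> S" "j \<noteq> r" "j \<notin> A" "j \<noteq> a" "j \<notin> B" "j \<noteq> b" "i \<noteq> j"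
      using that disj out by auto
    then show "?L i j = 0" "?L j i = 0" by (simp_all add: lap_mat_def nE square_def)
  qed
  have D: "?L r r - lap_mat E r r = 2" "?L a a - lap_mat EA a a = 2" "?L b b - lap_mat EB b b = 2" "?L c c - lap_mat EC c c = 2"
    using degr dega degb degc by (simp_all add: lap_mat_def)
  have L: "?L r a = -1" "?L a r = -1" "?L a b = -1" "?L b a = -1" "?L b c = -1" "?L c b = -1"
     "?L c r = -1" "?L r c = -1" "?L r b = 0" "?L b r = 0" "?L a c = 0" "?L c a = 0"
    using ne out sub by (auto simp: lap_mat_def square_def)
  have dgf: "root_minor us * 2 + form_poly us = cycle_diag us" for us by (simp add: form_poly_def cycle_diag_def algebra_simps)
  \<comment> \<open>\<open>R v us M\<close> contracts the form \<open>us\<close> at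
    \<open>v\<close>. The two square edges at \<open>v\<close> give the extra degree 2, which makes
    the diagonal entry \<open>cycle_diag us\<close>.\<close>
  define R where "R v us M = (\<lambda>i j. if i = v then if j = v then cycle_diag us else root_minor us * M v j else M i j)"
    for v us and M :: "'a \<Rightarrow> 'a \<Rightarrow> int poly"
  have contract: "ldet (W \<union> V) M = ldet W (R v us M)"
    if "finite W" "finite V" "W \<inter> V = {v}" "ldet V (lap_mat G) = form_poly us \<and> ldet (V - {v}) (lap_mat G) = root_minor us"
      "M v v - lap_mat G v v = 2"
      "\<And>i j. i \<in> W - {v} \<Longrightarrow> j \<in> V - {v} \<Longrightarrow> M i j = 0 \<and> M j i = 0"
      "\<And>i j. i \<in> V \<Longrightarrow> j \<in> V \<Longrightarrow> (i, j) \<noteq> (v, v) \<Longrightarrow> M i j = lap_mat G i j"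
    for W V M v G us
  proof -
    have e: "root_minor us * (M v v - lap_mat G v v) + form_poly us = cycle_diag us" using that(5) dgf by simp
    have "ldet (W \<union> V) M = ldet W (\<lambda>i j. if i = v
        then if j = v then root_minor us * (M v v - lap_mat G v v) + form_poly us else root_minor us * M v j else M i j)"
      by (rule ldet_contract) (use that(1-4,6,7) in auto)
    then show ?thesis unfolding R_def e .
  qed
  have R_other: "R v us M i j = M i j" if "i \<noteq> v" for v us M i j
    using that by (simp add: R_def)
  have R_zero: "R v us M i j = 0" if "M i j = 0" "i \<noteq> j" for v us M i j
    using that by (auto simp: R_def)
  \<comment> \<open>\<open>T\<close> will be \<open>{r}\<close> for the full determinant and empty
    for the minor without the root.\<close>
  have contract_abc: "ldet (A \<union> B \<union> C \<union> T) M = ldet ({a, b, c} \<union> T) (R c zs (R b ys (R a xs M)))"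
    if T: "finite T" "\<And>i. i \<in> T \<Longrightarrow> i = r" and M: "\<And>i j. i \<noteq> r \<Longrightarrow> M i j = ?L i j"
      and M0: "\<And>i j. ?L i j = 0 \<Longrightarrow> i \<noteq> j \<Longrightarrow> M i j = 0" for T M
  proof -
    have "ldet (A \<union> B \<union> C \<union> T) M = ldet ((B \<union> C \<union> {a} \<union> T) \<union> A) M"
      by (rule arg_cong[where f = "\<lambda>X. ldet X _"]) (use roots in auto)
    also have "\<dots> = ldet (B \<union> C \<union> {a} \<union> T) (R a xs M)"
    proof (rule contract[where G = EA])
      show "(B \<union> C \<union> {a} \<union> T) \<inter> A = {a}" using disj out roots T by auto
      show "finite (B \<union> C \<union> {a} \<union> T)" using T(1) wS(1) wA(1) wB(1) wC(1) by simp
      show "finite A" "ldet A (lap_mat EA) = form_poly xs \<and> ldet (A - {a}) (lap_mat EA) = root_minor xs" by fact+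
      show "M a a - lap_mat EA a a = 2" using D ne by (simp add: R_other M)
      fix i j
      show "M i j = 0 \<and> M j i = 0" if "i \<in> B \<union> C \<union> {a} \<union> T - {a}" "j \<in> A - {a}"
      proof -
        have "i \<noteq> j" "?L i j = 0" "?L j i = 0" using that ZA[of i j] disj roots out T(2) by auto
        then show ?thesis by (simp add: R_zero M0)
      qed
      show "M i j = lap_mat EA i j" if "i \<in> A" "j \<in> A" "(i, j) \<noteq> (a, a)"
      proof -
        have "i \<noteq> r"  using that out by auto
        then show ?thesis using NA[OF that] by (simp add: R_other M)
      qed
    qed
    also have "\<dots> = ldet ((C \<union> {a, b} \<union> T) \<union> B) (R a xs M)"
      by (rule arg_cong[where f = "\<lambda>X. ldet X _"]) (use roots in auto)
    also have "\<dots> = ldet (C \<union> {a, b} \<union> T) (R b ys (R a xs M))"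
    proof (rule contract[where G = EB])
      show "(C \<union> {a, b} \<union> T) \<inter> B = {b}" using disj out roots T by auto
      show "finite (C \<union> {a, b} \<union> T)" using T(1) wS(1) wA(1) wB(1) wC(1) by simp
      show "finite B" "ldet B (lap_mat EB) = form_poly ys \<and> ldet (B - {b}) (lap_mat EB) = root_minor ys" by fact+
      show "(R a xs M) b b - lap_mat EB b b = 2" using D ne by (simp add: R_other M)
      fix i j
      show "(R a xs M) i j = 0 \<and> (R a xs M) j i = 0" if "i \<in> C \<union> {a, b} \<union> T - {b}" "j \<in> B - {b}"
      proof -
        have "i \<noteq> j" "?L i j = 0" "?L j i = 0" using that ZB[of i j] disj roots out T(2) by auto
        then show ?thesis by (simp add: R_zero M0)
      qed
      show "(R a xs M) i j = lap_mat EB i j" if "i \<in> B" "j \<in> B" "(i, j) \<noteq> (b, b)"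
      proof -
        have "i \<noteq> r" "i \<noteq> a" using that out by auto
        then show ?thesis using NB[OF that] by (simp add: R_other M)
      qed
    qed
    also have "\<dots> = ldet (({a, b, c} \<union> T) \<union> C) (R b ys (R a xs M))"
      by (rule arg_cong[where f = "\<lambda>X. ldet X _"]) (use roots in auto)
    also have "\<dots> = ldet ({a, b, c} \<union> T) (R c zs (R b ys (R a xs M)))"
    proof (rule contract[where G = EC])
      show "({a, b, c} \<union> T) \<inter> C = {c}" using disj out roots T by auto
      show "finite ({a, b, c} \<union> T)" using T(1) wS(1) wA(1) wB(1) wC(1) by simp
      show "finite C" "ldet C (lap_mat EC) = form_poly zs \<and> ldet (C - {c}) (lap_mat EC) = root_minor zs" by fact+
      show "(R b ys (R a xs M)) c c - lap_mat EC c c = 2" using D ne by (simp add: R_other M)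
      fix i j
      show "(R b ys (R a xs M)) i j = 0 \<and> (R b ys (R a xs M)) j i = 0" if "i \<in> {a, b, c} \<union> T - {c}" "j \<in> C - {c}"
      proof -
        have "i \<noteq> j" "?L i j = 0" "?L j i = 0" using that ZC[of i j] disj roots out T(2) by auto
        then show ?thesis by (simp add: R_zero M0)
      qed
      show "(R b ys (R a xs M)) i j = lap_mat EC i j" if "i \<in> C" "j \<in> C" "(i, j) \<noteq> (c, c)"
      proof -
        have "i \<noteq> r" "i \<noteq> a" "i \<noteq> b" using that out by auto
        then show ?thesis using NC[OF that] by (simp add: R_other M)
      qed
    qed
    finally show ?thesis .
  qed
  have "ldet (S \<union> A \<union> B \<union> C) ?L = ldet ((A \<union> B \<union> C \<union> {r}) \<union> S) ?L"
    by (rule arg_cong[where f = "\<lambda>X. ldet X _"]) (use roots in auto)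
  also have "\<dots> = ldet (A \<union> B \<union> C \<union> {r}) (R r ts ?L)"
  proof (rule contract[where G = E])
    show "(A \<union> B \<union> C \<union> {r}) \<inter> S = {r}" using disj out roots by auto
    show "finite (A \<union> B \<union> C \<union> {r})" using wS(1) wA(1) wB(1) wC(1) by simp
    show "finite S" by fact
    show "ldet S (lap_mat E) = form_poly ts \<and> ldet (S - {r}) (lap_mat E) = root_minor ts" by fact
    show "?L r r - lap_mat E r r = 2" using D ne by (simp add: R_other)
    fix i j
    show "?L i j = 0 \<and> ?L j i = 0" if "i \<in> A \<union> B \<union> C \<union> {r} - {r}" "j \<in> S - {r}"
    proof -
      have "i \<noteq> j" "?L i j = 0" "?L j i = 0" using that ZS[of i j] disj roots out by auto
      then show ?thesis by (simp add: R_zero)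
    qed
    show "?L i j = lap_mat E i j" if "i \<in> S" "j \<in> S" "(i, j) \<noteq> (r, r)"
      using that by (rule NS)
  qed
  also have "\<dots> = ldet ({a, b, c} \<union> {r}) (R c zs (R b ys (R a xs (R r ts ?L))))"
    by (rule contract_abc) (simp_all add: R_other R_zero)
  also have "{a, b, c} \<union> {r} = {r, a, b, c}" by auto
  also have "ldet \<dots> (R c zs (R b ys (R a xs (R r ts ?L)))) = (cycle_diag ts * cycle_diag ys) * (cycle_diag xs * cycle_diag zs) -
      (root_minor ts * cycle_diag ys + root_minor ys * cycle_diag ts) * (root_minor xs * cycle_diag zs + root_minor zs * cycle_diag xs)"
    using ne L by (subst ldet_four_cycle[where p = "root_minor ts" and q = "root_minor xs" and s = "root_minor ys" and t = "root_minor zs"])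
      (simp_all add: R_def)
  also have "\<dots> = form_poly (Cy xs ys zs # ts)"
  proof -
    have "root_link ts = cycle_diag ts - (lam + 2) * root_minor ts" by (simp add: cycle_diag_def)
    then show ?thesis
      unfolding form_poly_def root_minor_Cons root_link_Cons branch_link_Cy branch_minor_Cy by (simp only:) (simp add: algebra_simps)
  qed
  finally have 1: "ldet (S \<union> A \<union> B \<union> C) ?L = form_poly (Cy xs ys zs # ts)" .
  have "ldet (A \<union> B \<union> C) ?L = ldet {a, b, c} (R c zs (R b ys (R a xs ?L)))"
    using contract_abc[of "{}" ?L] by simp
  also have "\<dots> = branch_minor (Cy xs ys zs)"
    using ne L by (subst ldet_three_path) (simp_all add: R_def branch_minor_Cy)
  finally have 2: "ldet (A \<union> B \<union> C) ?L = branch_minor (Cy xs ys zs)" .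
  have 3: "ldet (S - {r}) ?L = root_minor ts"
  proof -
    have "ldet (S - {r}) ?L = ldet (S - {r}) (lap_mat E)"
      by (rule ldet_cong) (use NS in auto)
    then show ?thesis using built_Cy.IH(1) by simp
  qed
  have 4: "S \<union> A \<union> B \<union> C - {r} = (S - {r}) \<union> (A \<union> B \<union> C)" using out by auto
  have 5: "ldet ((S - {r}) \<union> (A \<union> B \<union> C)) ?L = ldet (S - {r}) ?L * ldet (A \<union> B \<union> C) ?L"
  proof (rule ldet_block)
    show "?L i j = 0" if "i \<in> S - {r}" "j \<in> A \<union> B \<union> C" for i j
      using that by (intro ZS) auto
  qed (use wS(1) wA(1) wB(1) wC(1) disj in auto)
  have "ldet (S \<union> A \<union> B \<union> C - {r}) ?L = root_minor (Cy xs ys zs # ts)"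
    unfolding 4 5 3 2 root_minor_Cons by (rule mult.commute)
  from 1 this show ?case by (rule conjI)
qed

section \<open>Forms of one graph: splitting, reordering, changing the root\<close>

lemma built_Br_eq:
  assumes "built ts r S E" "built us w T F" "S \<inter> T = {}" "X = S \<union> T" "Y = E \<union> F \<union> {(r, w), (w, r)}"
  shows "built (Br us # ts) r X Y"
  using built_Br[OF assms(1-3)] assms(4,5) by simp

lemma built_Cy_eq:
  assumes "built ts r S E" "built xs a A EA" "built ys b B EB" "built zs c C EC"
    "S \<inter> A = {}" "S \<inter> B = {}" "S \<inter> C = {}" "A \<inter> B = {}" "A \<inter> C = {}" "B \<inter> C = {}"
    "X = S \<union> A \<union> B \<union> C" "Y = E \<union> EA \<union> EB \<union> EC \<union> square r a b c"
  shows "built (Cy xs ys zs # ts) r X Y"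
  using built_Cy[OF assms(1-10)] assms(11,12) by simp

inductive_cases built_NilE: "built [] r S E"
inductive_cases built_BrE: "built (Br us # ts) r S E"
inductive_cases built_CyE: "built (Cy xs ys zs # ts) r S E"

lemma built_append:
  assumes "built xs r S E" "built ys r T F" "S \<inter> T = {r}"
  shows "built (xs @ ys) r (S \<union> T) (E \<union> F)"
  using assms
proof induction
  case (built_Nil r)
  then show ?case using built_root[of ys r T F] by (simp add: insert_absorb)
next
  case (built_Br ts r S E us w S' E')
  have r: "r \<in> S" using built_Br.hyps(1) by (rule built_root)
  have "r \<in> T" using built_Br.prems(1) by (rule built_root)
  then have "S \<inter> T = {r}" "(S \<union> T) \<inter> S' = {}" using built_Br.prems(2) r built_Br.hyps(3) by blast+
  then show ?case
    using built_Br.IH(1)[OF built_Br.prems(1)] built_Br.hyps(2)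
    by (auto intro!: built_Br_eq[of _ _ "S \<union> T" "E \<union> F" us w S' E'])
next
  case (built_Cy ts r S E xs a A EA ys' b B EB zs c C EC)
  have r: "r \<in> S" using built_Cy.hyps(1) by (rule built_root)
  have "r \<in> T" using built_Cy.prems(1) by (rule built_root)
  then have 1: "S \<inter> T = {r}" "(S \<union> T) \<inter> A = {}" "(S \<union> T) \<inter> B = {}" "(S \<union> T) \<inter> C = {}"
    using built_Cy.prems(2) r built_Cy.hyps(5-7) by blast+
  show ?case unfolding append_Cons
    by (rule built_Cy_eq[OF built_Cy.IH(1)[OF built_Cy.prems(1) 1(1)] built_Cy.hyps(2-4) 1(2-4) built_Cy.hyps(8-10)])
      blast+
qed

lemma built_appendE:
  assumes "built (xs @ ys) r S E"
  obtains S1 E1 S2 E2 where "built xs r S1 E1" "built ys r S2 E2" "S1 \<inter> S2 = {r}" "S = S1 \<union> S2" "E = E1 \<union> E2"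
proof -
  have "\<exists>S1 E1 S2 E2. built xs r S1 E1 \<and> built ys r S2 E2 \<and> S1 \<inter> S2 = {r} \<and> S = S1 \<union> S2 \<and> E = E1 \<union> E2"
    using assms
  proof (induction xs arbitrary: S E)
    case Nil
    have "r \<in> S" using built_root[OF Nil] by simp
    then show ?case using Nil built_Nil[of r] by (intro exI[of _ "{r}"] exI[of _ "{}"] exI[of _ S] exI[of _ E]) auto
  next
    case (Cons x xs)
    show ?case
    proof (cases x)
      case (Br us)
      then obtain S' E' w T F where h: "built (xs @ ys) r S' E'" "built us w T F" "S' \<inter> T = {}"
        "S = S' \<union> T" "E = E' \<union> F \<union> {(r, w), (w, r)}"
        using Cons.prems by (auto elim: built_BrE)
      obtain S1 E1 S2 E2 where i: "built xs r S1 E1" "built ys r S2 E2" "S1 \<inter> S2 = {r}" "S' = S1 \<union> S2" "E' = E1 \<union> E2"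
        using Cons.IH[OF h(1)] by blast
      have "S1 \<inter> T = {}" "(S1 \<union> T) \<inter> S2 = {r}" using h(3) i(3,4) by blast+
      then show ?thesis
        using built_Br[OF i(1) h(2)] i(2) h(4,5) i(4,5) Br by blast
    next
      case (Cy xs' ys' zs')
      then obtain S' E' a A EA b B EB c C EC where h: "built (xs @ ys) r S' E'"
          "built xs' a A EA" "built ys' b B EB" "built zs' c C EC"
          "S' \<inter> A = {}" "S' \<inter> B = {}" "S' \<inter> C = {}" "A \<inter> B = {}" "A \<inter> C = {}" "B \<inter> C = {}"
          "S = S' \<union> A \<union> B \<union> C" "E = E' \<union> EA \<union> EB \<union> EC \<union> square r a b c"
        using Cons.prems by (auto elim: built_CyE)
      obtain S1 E1 S2 E2 where i: "built xs r S1 E1" "built ys r S2 E2" "S1 \<inter> S2 = {r}" "S' = S1 \<union> S2" "E' = E1 \<union> E2"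
        using Cons.IH[OF h(1)] by blast
      have d: "S1 \<inter> A = {}" "S1 \<inter> B = {}" "S1 \<inter> C = {}" "(S1 \<union> A \<union> B \<union> C) \<inter> S2 = {r}"
        using h(5-7) i(3,4) by blast+
      have "built (x # xs) r (S1 \<union> A \<union> B \<union> C) (E1 \<union> EA \<union> EB \<union> EC \<union> square r a b c)"
        unfolding Cy by (rule built_Cy[OF i(1) h(2-4) d(1-3) h(8-10)])
      moreover have "S = (S1 \<union> A \<union> B \<union> C) \<union> S2" "E = (E1 \<union> EA \<union> EB \<union> EC \<union> square r a b c) \<union> E2"
        using h(11,12) i(4,5) by blast+
      ultimately show ?thesis using i(2) d(4) by blast
    qed
  qed
  then show thesis using that by blast
qed

text \<open>A form stands for a multiset of branches, so any chosen branch can be brought to the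
  front.\<close>

lemma built_mset:
  assumes "built xs r S E" "mset xs = mset ys"
  shows "built ys r S E"
  using assms
proof (induction xs arbitrary: ys S E)
  case (Cons x xs)
  then have "x \<in> set ys" by (metis list.set_intros(1) mset_eq_setD)
  then obtain l1 l2 where ys: "ys = l1 @ x # l2" by (meson split_list)
  then have m: "mset xs = mset (l1 @ l2)" using Cons.prems(2) by simp
  obtain S1 E1 S2 E2 where 1: "built [x] r S1 E1" "built xs r S2 E2" "S1 \<inter> S2 = {r}" "S = S1 \<union> S2" "E = E1 \<union> E2"
    using Cons.prems(1) by (metis append_Cons append_Nil built_appendE)
  obtain S3 E3 S4 E4 where 2: "built l1 r S3 E3" "built l2 r S4 E4" "S3 \<inter> S4 = {r}" "S2 = S3 \<union> S4" "E2 = E3 \<union> E4"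
    using Cons.IH[OF 1(2) m] by (rule built_appendE)
  have d: "S1 \<inter> S4 = {r}" "S3 \<inter> (S1 \<union> S4) = {r}" using 1(3) 2(3,4) by blast+
  have "built (l1 @ ([x] @ l2)) r (S3 \<union> (S1 \<union> S4)) (E3 \<union> (E1 \<union> E4))"
    by (intro built_append 1(1) 2(1,2) d)
  moreover have "S3 \<union> (S1 \<union> S4) = S" "E3 \<union> (E1 \<union> E4) = E" using 1(4,5) 2(4,5) by blast+
  ultimately show ?case by (simp add: ys)
qed simp

text \<open>The edge between the root and a child is symmetric. Crossing such edges one by one
  exposes branching vertices deep inside a branch.\<close>

lemma built_reroot:
  assumes "built (Br us # ts) r S E"
  shows "\<exists>w. built (Br ts # us) w S E"
proof -
  obtain S' E' w T F where h: "built ts r S' E'" "built us w T F" "S' \<inter> T = {}"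
        "S = S' \<union> T" "E = E' \<union> F \<union> {(r, w), (w, r)}"
    using assms by (auto elim: built_BrE)
  have "built (Br ts # us) w S E"
    by (rule built_Br_eq[OF h(2) h(1)]) (use h in auto)
  then show ?thesis ..
qed

lemma built_rotate:
  assumes "built (Cy xs ys zs # ts) r S E"
  shows "\<exists>a. built (Cy ys zs ts # xs) a S E"
proof -
  obtain S' E' a A EA b B EB c C EC where h: "built ts r S' E'"
          "built xs a A EA" "built ys b B EB" "built zs c C EC"
          "S' \<inter> A = {}" "S' \<inter> B = {}" "S' \<inter> C = {}" "A \<inter> B = {}" "A \<inter> C = {}" "B \<inter> C = {}"
          "S = S' \<union> A \<union> B \<union> C" "E = E' \<union> EA \<union> EB \<union> EC \<union> square r a b c"
    using assms by (auto elim: built_CyE)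
  have d: "A \<inter> S' = {}" "B \<inter> S' = {}" "C \<inter> S' = {}" using h(5-7) by blast+
  have "built (Cy ys zs ts # xs) a S E"
    by (rule built_Cy_eq[OF h(2-4,1) h(8,9) d(1) h(10) d(2,3)])
      (unfold h(11,12) square_def, blast+)
  then show ?thesis ..
qed

section \<open>Order, leaves and squares of a form\<close>

primrec cyc :: "branch \<Rightarrow> nat" where
  "cyc (Br us) = sum_list (map cyc us)"
| "cyc (Cy xs ys zs) = 1 + sum_list (map cyc xs) + sum_list (map cyc ys) + sum_list (map cyc zs)"

primrec branch_size :: "branch \<Rightarrow> nat" where
  "branch_size (Br us) = 1 + sum_list (map branch_size us)"
| "branch_size (Cy xs ys zs) = 3 + sum_list (map branch_size xs) + sum_list (map branch_size ys) + sum_list (map branch_size zs)"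

text \<open>Only \<open>Br []\<close> is a leaf, since the corners of a square have degree at least
  2. The root is left out; whether it is a leaf is decided by \<open>root_deg\<close>.\<close>

primrec branch_leaves :: "branch \<Rightarrow> nat" where
  "branch_leaves (Br us) = (if us = [] then 1 else sum_list (map branch_leaves us))"
| "branch_leaves (Cy xs ys zs) =
     sum_list (map branch_leaves xs) + sum_list (map branch_leaves ys) + sum_list (map branch_leaves zs)"

abbreviation form_cycles :: "branch list \<Rightarrow> nat" where "form_cycles ts \<equiv> sum_list (map cyc ts)"
definition form_size :: "branch list \<Rightarrow> nat" where "form_size ts = 1 + sum_list (map branch_size ts)"
abbreviation form_leaves :: "branch list \<Rightarrow> nat" where "form_leaves ts \<equiv> sum_list (map branch_leaves ts)"

primrec root_deg :: "branch list \<Rightarrow> nat" where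
  "root_deg [] = 0"
| "root_deg (t # ts) = (case t of Br _ \<Rightarrow> 1 | Cy _ _ _ \<Rightarrow> 2) + root_deg ts"

lemma card_Un4:
  assumes "finite A" "finite B" "finite C" "finite D"
    and "A \<inter> B = {}" "A \<inter> C = {}" "A \<inter> D = {}" "B \<inter> C = {}" "B \<inter> D = {}" "C \<inter> D = {}"
  shows "card (A \<union> B \<union> C \<union> D) = card A + card B + card C + card D"
proof -
  have "(A \<union> B) \<inter> C = {}" "(A \<union> B \<union> C) \<inter> D = {}" using assms(5-10) by blast+
  then show ?thesis using assms(1-5) by (simp add: card_Un_disjoint)
qed

lemma card_Un4_subsets:
  assumes "finite A" "finite B" "finite C" "finite D"
    and "A \<inter> B = {}" "A \<inter> C = {}" "A \<inter> D = {}" "B \<inter> C = {}" "B \<inter> D = {}" "C \<inter> D = {}"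
    and "P \<subseteq> A" "Q \<subseteq> B" "R \<subseteq> C" "T \<subseteq> D"
  shows "card (P \<union> Q \<union> R \<union> T) = card P + card Q + card R + card T"
proof (rule card_Un4)
  show "finite P" "finite Q" "finite R" "finite T"
    using assms(1-4,11-14) by (auto intro: finite_subset)
  show "P \<inter> Q = {}" using assms(5,11,12) by blast
  show "P \<inter> R = {}" using assms(6,11,13) by blast
  show "P \<inter> T = {}" using assms(7,11,14) by blast
  show "Q \<inter> R = {}" using assms(8,12,13) by blast
  show "Q \<inter> T = {}" using assms(9,12,14) by blast
  show "R \<inter> T = {}" using assms(10,13,14) by blast
qed

lemma built_card: "built ts r S E \<Longrightarrow> card S = form_size ts"
proof (induction rule: built.induct)
  case (built_Br ts r S E us w T F)
  then show ?case
    using built_finite[OF built_Br.hyps(1)] built_finite[OF built_Br.hyps(2)]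
    by (simp add: card_Un_disjoint form_size_def)
next
  case (built_Cy ts r S E xs a A EA ys b B EB zs c C EC)
  have "card (S \<union> A \<union> B \<union> C) = card S + card A + card B + card C"
    using built_Cy.hyps by (intro card_Un4 built_finite)
  then show ?case using built_Cy.IH by (simp add: form_size_def)
qed (simp add: form_size_def)

text \<open>An improved form has to be turned into a graph on \<open>{..<n}\<close>. The offset
  \<open>m\<close> lets the parts occupy consecutive disjoint intervals.\<close>

lemma built_exists: "\<exists>r E. built ts r {m..<m + form_size ts} E"
proof (induction ts arbitrary: m rule: form_induct)
  case Nil
  have "{m..<m + form_size []} = {m}" by (auto simp: form_size_def)
  then show ?case using built_Nil[of m] by auto
next
  case (Br us ts)
  obtain r E where 1: "built ts r {m..<m + form_size ts} E" using Br.IH(2) by blast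
  obtain w F where 2: "built us w {m + form_size ts..<m + form_size ts + form_size us} F" using Br.IH(1) by blast
  have "built (Br us # ts) r {m..<m + form_size (Br us # ts)} (E \<union> F \<union> {(r, w), (w, r)})"
    by (rule built_Br_eq[OF 1 2]) (auto simp: form_size_def)
  then show ?case by blast
next
  case (Cy xs ys zs ts)
  define m1 where "m1 = m + form_size ts"
  define m2 where "m2 = m1 + form_size xs"
  define m3 where "m3 = m2 + form_size ys"
  define m4 where "m4 = m3 + form_size zs"
  have m: "m \<le> m1" "m1 \<le> m2" "m2 \<le> m3" "m3 \<le> m4" by (simp_all add: m1_def m2_def m3_def m4_def)
  obtain r E where 1: "built ts r {m..<m1} E" using Cy.IH(4) unfolding m1_def by blast
  obtain a EA where 2: "built xs a {m1..<m2} EA" using Cy.IH(1) unfolding m2_def by blast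
  obtain b EB where 3: "built ys b {m2..<m3} EB" using Cy.IH(2) unfolding m3_def by blast
  obtain c EC where 4: "built zs c {m3..<m4} EC" using Cy.IH(3) unfolding m4_def by blast
  have "m + form_size (Cy xs ys zs # ts) = m4"
    by (simp add: m1_def m2_def m3_def m4_def form_size_def)
  moreover have "built (Cy xs ys zs # ts) r {m..<m4} (E \<union> EA \<union> EB \<union> EC \<union> square r a b c)"
    by (rule built_Cy_eq[OF 1 2 3 4]) (use m in auto)
  ultimately show ?case by metis
qed

lemma root_deg_eq_0 [simp]: "root_deg ts = 0 \<longleftrightarrow> ts = []"
  by (cases ts) (auto split: branch.split)

lemma deg_insert:
  assumes "G `` {v} = insert w (F `` {v})" "w \<notin> F `` {v}" "F \<subseteq> T \<times> T" "finite T"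
  shows "deg G v = Suc (deg F v)"
proof -
  have "finite (F `` {v})" using assms(3,4) by (auto intro: finite_subset[of _ T])
  then show ?thesis using assms(1,2) by (simp add: deg_def)
qed

lemma deg_insert2:
  assumes "G `` {v} = insert u (insert w (F `` {v}))" "w \<notin> F `` {v}" "u \<notin> F `` {v}" "u \<noteq> w" "F \<subseteq> T \<times> T" "finite T"
  shows "deg G v = Suc (Suc (deg F v))"
proof -
  have "finite (F `` {v})" using assms(5,6) by (auto intro: finite_subset[of _ T])
  then show ?thesis using assms(1-4) by (simp add: deg_def)
qed

lemma built_degrees:
  assumes "built ts r S E"
  shows "deg E r = root_deg ts \<and> card {v \<in> S - {r}. deg E v = 1} = form_leaves ts"
  using assms
proof (induction rule: built.induct)
  case (built_Nil r)
  show ?case by (simp add: deg_def)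
next
  case (built_Br ts r S E us w T F)
  let ?E = "E \<union> F \<union> {(r, w), (w, r)}"
  note wS = built_wf[OF built_Br.hyps(1)] and wT = built_wf[OF built_Br.hyps(2)]
  note ES = wS(3) and FT = wT(3) and ST = built_Br.hyps(3)
  have out: "r \<noteq> w" "r \<notin> T" "w \<notin> S" using wS(2) wT(2) ST by auto
  have "?E `` {r} = insert w (E `` {r})" "w \<notin> E `` {r}" using out ES FT by auto
  then have r: "deg ?E r = Suc (deg E r)" using ES wS(1) by (rule deg_insert)
  have "?E `` {w} = insert r (F `` {w})" "r \<notin> F `` {w}" using out ES FT by auto
  then have w: "deg ?E w = Suc (deg F w)" using FT wT(1) by (rule deg_insert)
  have S: "deg ?E v = deg E v" if "v \<in> S - {r}" for v
  proof -
    have "?E `` {v} = E `` {v}" using that out FT ST by auto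
    then show ?thesis by (simp add: deg_def)
  qed
  have T: "deg ?E v = deg F v" if "v \<in> T - {w}" for v
  proof -
    have "v \<notin> S" using that ST by auto
    then have "?E `` {v} = F `` {v}" using that out ES by auto
    then show ?thesis by (simp add: deg_def)
  qed
  have "{v \<in> S \<union> T - {r}. deg ?E v = 1} =
      {v \<in> S - {r}. deg ?E v = 1} \<union> ({v \<in> {w}. deg ?E v = 1} \<union> {v \<in> T - {w}. deg ?E v = 1})"
    using out wT(2) by auto
  also have "\<dots> = {v \<in> S - {r}. deg E v = 1} \<union> ((if us = [] then {w} else {}) \<union> {v \<in> T - {w}. deg F v = 1})"
  proof -
    have "deg ?E w = 1 \<longleftrightarrow> us = []" using w built_Br.IH(2) by simp
    then have "{v \<in> {w}. deg ?E v = 1} = (if us = [] then {w} else {})" by auto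
    moreover have "{v \<in> S - {r}. deg ?E v = 1} = {v \<in> S - {r}. deg E v = 1}" using S by auto
    moreover have "{v \<in> T - {w}. deg ?E v = 1} = {v \<in> T - {w}. deg F v = 1}" using T by auto
    ultimately show ?thesis by simp
  qed
  also have "card \<dots> = card {v \<in> S - {r}. deg E v = 1} + (card (if us = [] then {w} else {}) + card {v \<in> T - {w}. deg F v = 1})"
    using wS(1) wT(1) ST out by (subst card_Un_disjoint, force, force, force, subst card_Un_disjoint) (auto split: if_splits)
  finally show ?case using built_Br.IH r by simp
next
  case (built_Cy ts r S E xs a A EA ys b B EB zs c C EC)
  let ?E = "E \<union> EA \<union> EB \<union> EC \<union> square r a b c"
  note wS = built_wf[OF built_Cy.hyps(1)] and wA = built_wf[OF built_Cy.hyps(2)]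
    and wB = built_wf[OF built_Cy.hyps(3)] and wC = built_wf[OF built_Cy.hyps(4)]
  note disj = built_Cy.hyps(5-10)
  note roots = wS(2) wA(2) wB(2) wC(2)
  have out: "r \<notin> A" "r \<notin> B" "r \<notin> C" "a \<notin> S" "a \<notin> B" "a \<notin> C"
     "b \<notin> S" "b \<notin> A" "b \<notin> C" "c \<notin> S" "c \<notin> A" "c \<notin> B"
    using roots disj by auto
  have ne: "r \<noteq> a" "r \<noteq> b" "r \<noteq> c" "a \<noteq> b" "a \<noteq> c" "b \<noteq> c"
    using roots out by auto
  have nE: "i \<notin> S \<Longrightarrow> (i, k) \<notin> E" "i \<notin> A \<Longrightarrow> (i, k) \<notin> EA" "i \<notin> B \<Longrightarrow> (i, k) \<notin> EB" "i \<notin> C \<Longrightarrow> (i, k) \<notin> EC"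
    "k \<notin> S \<Longrightarrow> (i, k) \<notin> E" "k \<notin> A \<Longrightarrow> (i, k) \<notin> EA" "k \<notin> B \<Longrightarrow> (i, k) \<notin> EB" "k \<notin> C \<Longrightarrow> (i, k) \<notin> EC" for i k
    using wS(3) wA(3) wB(3) wC(3) by blast+
  have r: "deg ?E r = Suc (Suc (deg E r))"
    by (rule deg_insert2[of _ _ a c, OF _ _ _ _ wS(3,1)]) (use out ne nE in \<open>auto simp: square_def\<close>)
  have a: "deg ?E a = Suc (Suc (deg EA a))"
    by (rule deg_insert2[of _ _ r b, OF _ _ _ _ wA(3,1)]) (use out ne nE in \<open>auto simp: square_def\<close>)
  have b: "deg ?E b = Suc (Suc (deg EB b))"
    by (rule deg_insert2[of _ _ a c, OF _ _ _ _ wB(3,1)]) (use out ne nE in \<open>auto simp: square_def\<close>)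
  have c: "deg ?E c = Suc (Suc (deg EC c))"
    by (rule deg_insert2[of _ _ r b, OF _ _ _ _ wC(3,1)]) (use out ne nE in \<open>auto simp: square_def\<close>)
  have eq: "deg ?E v = deg G v" if "\<And>k. (v, k) \<in> ?E \<longleftrightarrow> (v, k) \<in> G" for v G
  proof -
    have "?E `` {v} = G `` {v}" using that by blast
    then show ?thesis by (simp add: deg_def)
  qed
  have S: "deg ?E v = deg E v" if "v \<in> S - {r}" for v
  proof (rule eq)
    have "v \<notin> A" "v \<notin> B" "v \<notin> C" "v \<notin> {r, a, b, c}" using that disj out by auto
    then show "(v, k) \<in> ?E \<longleftrightarrow> (v, k) \<in> E" for k using nE by (simp add: square_def)
  qed
  have A: "deg ?E v = deg EA v" if "v \<in> A - {a}" for v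
  proof (rule eq)
    have "v \<notin> S" "v \<notin> B" "v \<notin> C" "v \<notin> {r, a, b, c}" using that disj out by auto
    then show "(v, k) \<in> ?E \<longleftrightarrow> (v, k) \<in> EA" for k using nE by (simp add: square_def)
  qed
  have B: "deg ?E v = deg EB v" if "v \<in> B - {b}" for v
  proof (rule eq)
    have "v \<notin> S" "v \<notin> A" "v \<notin> C" "v \<notin> {r, a, b, c}" using that disj out by auto
    then show "(v, k) \<in> ?E \<longleftrightarrow> (v, k) \<in> EB" for k using nE by (simp add: square_def)
  qed
  have C: "deg ?E v = deg EC v" if "v \<in> C - {c}" for v
  proof (rule eq)
    have "v \<notin> S" "v \<notin> A" "v \<notin> B" "v \<notin> {r, a, b, c}" using that disj out by auto
    then show "(v, k) \<in> ?E \<longleftrightarrow> (v, k) \<in> EC" for k using nE by (simp add: square_def)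
  qed
  have e1: "{v \<in> S \<union> A \<union> B \<union> C - {r}. deg ?E v = 1} =
      {v \<in> S - {r}. deg ?E v = 1} \<union> {v \<in> A - {a}. deg ?E v = 1} \<union> {v \<in> B - {b}. deg ?E v = 1} \<union> {v \<in> C - {c}. deg ?E v = 1}"
    using a b c out by auto
  have e2: "{v \<in> S - {r}. deg ?E v = 1} \<union> {v \<in> A - {a}. deg ?E v = 1} \<union> {v \<in> B - {b}. deg ?E v = 1} \<union> {v \<in> C - {c}. deg ?E v = 1} =
      {v \<in> S - {r}. deg E v = 1} \<union> {v \<in> A - {a}. deg EA v = 1} \<union> {v \<in> B - {b}. deg EB v = 1} \<union> {v \<in> C - {c}. deg EC v = 1}"
    using S A B C by (intro arg_cong2[where f = "(\<union>)"] Collect_cong) auto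
  have e3: "card ({v \<in> S - {r}. deg E v = 1} \<union> {v \<in> A - {a}. deg EA v = 1} \<union> {v \<in> B - {b}. deg EB v = 1} \<union> {v \<in> C - {c}. deg EC v = 1}) =
      card {v \<in> S - {r}. deg E v = 1} + card {v \<in> A - {a}. deg EA v = 1}
      + card {v \<in> B - {b}. deg EB v = 1} + card {v \<in> C - {c}. deg EC v = 1}"
    by (rule card_Un4_subsets[OF wS(1) wA(1) wB(1) wC(1) disj]) auto
  have "card {v \<in> S \<union> A \<union> B \<union> C - {r}. deg ?E v = 1} = form_leaves (Cy xs ys zs # ts)"
    unfolding e1 e2 e3 using built_Cy.IH by simp
  moreover have "deg ?E r = root_deg (Cy xs ys zs # ts)" using r built_Cy.IH(1) by simp
  ultimately show ?case by (rule conjI[rotated])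
qed

section \<open>Leaf attachment and forms with one square\<close>

lemma built_insert_leaf:
  assumes "built ts r S E" "form_cycles ts = 0" "u \<in> S" "v \<notin> S"
  shows "\<exists>ts'. built ts' r (insert v S) (E \<union> {(u, v), (v, u)}) \<and> form_cycles ts' = 0"
  using assms
proof (induction arbitrary: u rule: built.induct)
  case (built_Nil r)
  then have "built [Br []] r (insert v {r}) ({} \<union> {(u, v), (v, u)})"
    by (intro built_Br_eq[OF built.built_Nil built.built_Nil]) auto
  then show ?case by (intro exI[of _ "[Br []]"]) simp
next
  case (built_Br ts r S E us w T F)
  show ?case
  proof (cases "u \<in> S")
    case True
    have "form_cycles ts = 0" "v \<notin> S" using built_Br.prems by simp_all
    then obtain ts' where t: "built ts' r (insert v S) (E \<union> {(u, v), (v, u)})" "form_cycles ts' = 0"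
      using built_Br.IH(1)[OF _ True] by blast
    have "built (Br us # ts') r (insert v (S \<union> T)) (E \<union> F \<union> {(r, w), (w, r)} \<union> {(u, v), (v, u)})"
      by (rule built_Br_eq[OF t(1) built_Br.hyps(2)]) (use built_Br.hyps(3) built_Br.prems in auto)
    then show ?thesis using t(2) built_Br.prems(1) by (intro exI[of _ "Br us # ts'"]) simp
  next
    case False
    then have "u \<in> T" "form_cycles us = 0" "v \<notin> T" using built_Br.prems by simp_all
    then obtain us' where t: "built us' w (insert v T) (F \<union> {(u, v), (v, u)})" "form_cycles us' = 0"
      using built_Br.IH(2) by blast
    have "built (Br us' # ts) r (insert v (S \<union> T)) (E \<union> F \<union> {(r, w), (w, r)} \<union> {(u, v), (v, u)})"
      by (rule built_Br_eq[OF built_Br.hyps(1) t(1)]) (use built_Br.hyps(3) built_Br.prems in auto)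
    then show ?thesis using t(2) built_Br.prems(1) by (intro exI[of _ "Br us' # ts"]) simp
  qed
qed simp

text \<open>The graphs obtained from a square by successively attaching leaves.\<close>

inductive unic :: "'a set \<Rightarrow> 'a rel \<Rightarrow> bool" where
  unic_square: "distinct [a, b, c, d] \<Longrightarrow> unic {a, b, c, d} (square a b c d)"
| unic_leaf: "unic S E \<Longrightarrow> u \<in> S \<Longrightarrow> v \<notin> S \<Longrightarrow> unic (insert v S) (E \<union> {(u, v), (v, u)})"

text \<open>A tree is hung on a vertex by adding its vertices as leaves, each after its
  parent.\<close>

lemma unic_merge:
  assumes "built ts r T F" "form_cycles ts = 0" "unic S E" "S \<inter> T = {r}"
  shows "unic (S \<union> T) (E \<union> F)"
  using assms
proof (induction arbitrary: S E rule: built.induct)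
  case (built_Nil r)
  then show ?case by (metis Int_lower1 Un_empty_right insert_subset sup.absorb1)
next
  case (built_Br ts r T0 F0 us w T1 F1)
  note roots = built_root[OF built_Br.hyps(1)] built_root[OF built_Br.hyps(2)]
  have 0: "S \<inter> T0 = {r}" "w \<notin> S \<union> T0" "r \<in> S \<union> T0" using built_Br.prems(3) built_Br.hyps(3) roots by blast+
  have "unic (S \<union> T0) (E \<union> F0)" using built_Br.IH(1) built_Br.prems 0 by simp
  then have 1: "unic (insert w (S \<union> T0)) (E \<union> F0 \<union> {(r, w), (w, r)})"
    by (rule unic_leaf) (use 0 in auto)
  have 2: "insert w (S \<union> T0) \<inter> T1 = {w}" using built_Br.prems(3) built_Br.hyps(3) roots by blast
  have "unic (insert w (S \<union> T0) \<union> T1) (E \<union> F0 \<union> {(r, w), (w, r)} \<union> F1)"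
    using built_Br.IH(2)[OF _ 1 2] built_Br.prems(1) by simp
  moreover have "insert w (S \<union> T0) \<union> T1 = S \<union> (T0 \<union> T1)" using roots by blast
  moreover have "E \<union> F0 \<union> {(r, w), (w, r)} \<union> F1 = E \<union> (F0 \<union> F1 \<union> {(r, w), (w, r)})" by blast
  ultimately show ?case by simp
qed simp

text \<open>The square may lie anywhere in the form. The part containing it comes first, and the
  acyclic rest is attached by \<open>unic_merge\<close>; if the square lies in \<open>us\<close>,
  the old root is attached to \<open>w\<close> as a leaf.\<close>

lemma built_unic:
  assumes "built ts r S E" "form_cycles ts = 1"
  shows "unic S E"
  using assms
proof (induction rule: built.induct)
  case (built_Br ts r S E us w T F)
  note roots = built_root[OF built_Br.hyps(1)] built_root[OF built_Br.hyps(2)]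
  note h = built_Br.hyps
  consider "form_cycles ts = 1" "form_cycles us = 0" | "form_cycles ts = 0" "form_cycles us = 1" using built_Br.prems by fastforce
  then show ?case
  proof cases
    case 1
    have "unic (insert w S) (E \<union> {(r, w), (w, r)})"
      using built_Br.IH(1) 1 roots h(3) by (intro unic_leaf) auto
    then have "unic (insert w S \<union> T) (E \<union> {(r, w), (w, r)} \<union> F)"
      by (rule unic_merge[OF h(2) 1(2)]) (use roots h(3) in blast)
    moreover have "insert w S \<union> T = S \<union> T" "E \<union> {(r, w), (w, r)} \<union> F = E \<union> F \<union> {(r, w), (w, r)}"
      using roots by blast+
    ultimately show ?thesis by simp
  next
    case 2
    have "unic (insert r T) (F \<union> {(w, r), (r, w)})"
      using built_Br.IH(2) 2 roots h(3) by (intro unic_leaf) auto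
    then have "unic (insert r T \<union> S) (F \<union> {(w, r), (r, w)} \<union> E)"
      by (rule unic_merge[OF h(1) 2(1)]) (use roots h(3) in blast)
    moreover have "insert r T \<union> S = S \<union> T" "F \<union> {(w, r), (r, w)} \<union> E = E \<union> F \<union> {(r, w), (w, r)}"
      using roots by blast+
    ultimately show ?thesis by simp
  qed
next
  case (built_Cy ts r S E xs a A EA ys b B EB zs c C EC)
  note roots = built_root[OF built_Cy.hyps(1)] built_root[OF built_Cy.hyps(2)]
    built_root[OF built_Cy.hyps(3)] built_root[OF built_Cy.hyps(4)]
  note h = built_Cy.hyps
  have cy: "form_cycles ts = 0" "form_cycles xs = 0" "form_cycles ys = 0" "form_cycles zs = 0" using built_Cy.prems by simp_all
  have "distinct [r, a, b, c]" using roots h(5-10) by auto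
  then have "unic {r, a, b, c} (square r a b c)" by (rule unic_square)
  then have "unic ({r, a, b, c} \<union> S) (square r a b c \<union> E)"
    by (rule unic_merge[OF h(1) cy(1)]) (use roots h(5-10) in auto)
  then have "unic ({r, a, b, c} \<union> S \<union> A) (square r a b c \<union> E \<union> EA)"
    by (rule unic_merge[OF h(2) cy(2)]) (use roots h(5-10) in auto)
  then have "unic ({r, a, b, c} \<union> S \<union> A \<union> B) (square r a b c \<union> E \<union> EA \<union> EB)"
    by (rule unic_merge[OF h(3) cy(3)]) (use roots h(5-10) in auto)
  then have "unic ({r, a, b, c} \<union> S \<union> A \<union> B \<union> C) (square r a b c \<union> E \<union> EA \<union> EB \<union> EC)"
    by (rule unic_merge[OF h(4) cy(4)]) (use roots h(5-10) in auto)
  moreover have "{r, a, b, c} \<union> S \<union> A \<union> B \<union> C = S \<union> A \<union> B \<union> C" using roots by auto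
  moreover have "square r a b c \<union> E \<union> EA \<union> EB \<union> EC = E \<union> EA \<union> EB \<union> EC \<union> square r a b c" by blast
  ultimately show ?case by simp
qed simp

lemma built_Cy_insert_leaf:
  assumes b: "built (Cy xs ys zs # ts) r S E" and u: "u \<in> S" and v: "v \<notin> S"
    and cy: "form_cycles xs = 0" "form_cycles ys = 0" "form_cycles zs = 0" "form_cycles ts = 0"
  shows "\<exists>xs' ys' zs' ts'. built (Cy xs' ys' zs' # ts') r (insert v S) (E \<union> {(u, v), (v, u)}) \<and>
    form_cycles xs' = 0 \<and> form_cycles ys' = 0 \<and> form_cycles zs' = 0 \<and> form_cycles ts' = 0"
proof -
  obtain S' E' a A EA b B EB c C EC where h: "built ts r S' E'"
          "built xs a A EA" "built ys b B EB" "built zs c C EC"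
          "S' \<inter> A = {}" "S' \<inter> B = {}" "S' \<inter> C = {}" "A \<inter> B = {}" "A \<inter> C = {}" "B \<inter> C = {}"
          "S = S' \<union> A \<union> B \<union> C" "E = E' \<union> EA \<union> EB \<union> EC \<union> square r a b c"
    using b by (auto elim: built_CyE)
  have v': "v \<notin> S'" "v \<notin> A" "v \<notin> B" "v \<notin> C" using v h(11) by simp_all
  consider "u \<in> S'" | "u \<in> A" | "u \<in> B" | "u \<in> C" using u h(11) by blast
  then show ?thesis
  proof cases
    case 1
    obtain ts' where t: "built ts' r (insert v S') (E' \<union> {(u, v), (v, u)})" "form_cycles ts' = 0"
      using built_insert_leaf[OF h(1) cy(4) 1 v'(1)] by blast
    have "built (Cy xs ys zs # ts') r (insert v S) (E \<union> {(u, v), (v, u)})"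
      by (rule built_Cy_eq[OF t(1) h(2-4)]) (use h v' in auto)
    then show ?thesis using cy t(2) by blast
  next
    case 2
    obtain ts' where t: "built ts' a (insert v A) (EA \<union> {(u, v), (v, u)})" "form_cycles ts' = 0"
      using built_insert_leaf[OF h(2) cy(1) 2 v'(2)] by blast
    have "built (Cy ts' ys zs # ts) r (insert v S) (E \<union> {(u, v), (v, u)})"
      by (rule built_Cy_eq[OF h(1) t(1) h(3,4)]) (use h v' in auto)
    then show ?thesis using cy t(2) by blast
  next
    case 3
    obtain ts' where t: "built ts' b (insert v B) (EB \<union> {(u, v), (v, u)})" "form_cycles ts' = 0"
      using built_insert_leaf[OF h(3) cy(2) 3 v'(3)] by blast
    have "built (Cy xs ts' zs # ts) r (insert v S) (E \<union> {(u, v), (v, u)})"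
      by (rule built_Cy_eq[OF h(1,2) t(1) h(4)]) (use h v' in auto)
    then show ?thesis using cy t(2) by blast
  next
    case 4
    obtain ts' where t: "built ts' c (insert v C) (EC \<union> {(u, v), (v, u)})" "form_cycles ts' = 0"
      using built_insert_leaf[OF h(4) cy(3) 4 v'(4)] by blast
    have "built (Cy xs ys ts' # ts) r (insert v S) (E \<union> {(u, v), (v, u)})"
      by (rule built_Cy_eq[OF h(1-3) t(1)]) (use h v' in auto)
    then show ?thesis using cy t(2) by blast
  qed
qed

text \<open>The root can be kept on the square, because attaching a leaf alters only one of the four
  trees.\<close>

lemma unic_built:
  assumes "unic S E"
  shows "\<exists>xs ys zs ts r. built (Cy xs ys zs # ts) r S E \<and> form_cycles xs = 0 \<and> form_cycles ys = 0 \<and> form_cycles zs = 0 \<and> form_cycles ts = 0"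
  using assms
proof induction
  case (unic_square a b c d)
  have "built [Cy [] [] []] a {a, b, c, d} (square a b c d)"
    by (rule built_Cy_eq[OF built_Nil built_Nil built_Nil built_Nil]) (use unic_square in auto)
  then show ?case by (intro exI[of _ "[]"] exI[of _ a]) simp
next
  case (unic_leaf S E u v)
  then show ?case using built_Cy_insert_leaf[of _ _ _ _ _ S E u v] by metis
qed

section \<open>Isomorphisms between graphs with the same form\<close>

lemma glue:
  assumes f: "bij_betw f S S'" and g: "bij_betw g T T'" and ST: "S \<inter> T = {}" "S' \<inter> T' = {}"
    and E: "E \<subseteq> S \<times> S" and F: "F \<subseteq> T \<times> T"
  obtains h where "bij_betw h (S \<union> T) (S' \<union> T')" "\<And>x. x \<in> S \<Longrightarrow> h x = f x" "\<And>x. x \<in> T \<Longrightarrow> h x = g x"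
    "map_prod h h ` (E \<union> F) = map_prod f f ` E \<union> map_prod g g ` F" "E \<union> F \<subseteq> (S \<union> T) \<times> (S \<union> T)"
proof -
  define h where "h x = (if x \<in> S then f x else g x)" for x
  have hS: "h x = f x" if "x \<in> S" for x using that by (simp add: h_def)
  have hT: "h x = g x" if "x \<in> T" for x using that ST(1) by (auto simp: h_def)
  have "bij_betw h S S'" using f bij_betw_cong[of S h f] hS by blast
  moreover have "bij_betw h T T'" using g bij_betw_cong[of T h g] hT by blast
  ultimately have "bij_betw h (S \<union> T) (S' \<union> T')" using ST(2) by (rule bij_betw_combine)
  moreover have "map_prod h h ` E = map_prod f f ` E" using E hS by (intro image_cong) auto
  moreover have "map_prod h h ` F = map_prod g g ` F" using F hT by (intro image_cong) auto
  moreover have "E \<union> F \<subseteq> (S \<union> T) \<times> (S \<union> T)" using E F by blast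
  ultimately show thesis using that hS hT by (simp add: image_Un)
qed

lemma map_prod_square: "map_prod f f ` square a b c d = square (f a) (f b) (f c) (f d)"
  by (simp add: square_def)

lemma built_iso:
  assumes "built ts r S E" "built ts r' S' E'"
  shows "\<exists>f. bij_betw f S S' \<and> f r = r' \<and> E' = map_prod f f ` E"
  using assms
proof (induction arbitrary: r' S' E' rule: built.induct)
  case (built_Nil r)
  then have "S' = {r'}" "E' = {}" by (auto elim: built_NilE)
  then show ?case by (intro exI[of _ "\<lambda>_. r'"]) (simp add: bij_betw_def)
next
  case (built_Br ts r S E us w T F)
  obtain S1 E1 w1 T1 F1 where h: "built ts r' S1 E1" "built us w1 T1 F1" "S1 \<inter> T1 = {}"
        "S' = S1 \<union> T1" "E' = E1 \<union> F1 \<union> {(r', w1), (w1, r')}"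
    using built_Br.prems by (auto elim: built_BrE)
  obtain f where f: "bij_betw f S S1" "f r = r'" "E1 = map_prod f f ` E" using built_Br.IH(1)[OF h(1)] by blast
  obtain g where g: "bij_betw g T T1" "g w = w1" "F1 = map_prod g g ` F" using built_Br.IH(2)[OF h(2)] by blast
  obtain k where k: "bij_betw k (S \<union> T) (S1 \<union> T1)" "\<And>x. x \<in> S \<Longrightarrow> k x = f x" "\<And>x. x \<in> T \<Longrightarrow> k x = g x"
    "map_prod k k ` (E \<union> F) = map_prod f f ` E \<union> map_prod g g ` F"
    by (rule glue[OF f(1) g(1) built_Br.hyps(3) h(3) built_edges[OF built_Br.hyps(1)] built_edges[OF built_Br.hyps(2)]]) (rule that)
  have rw: "k r = r'" "k w = w1"
    using k(2,3) f(2) g(2) built_root[OF built_Br.hyps(1)] built_root[OF built_Br.hyps(2)] by auto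
  have "E' = map_prod k k ` (E \<union> F \<union> {(r, w), (w, r)})"
    unfolding image_Un[of _ "E \<union> F"] k(4) h(5) f(3) g(3) using rw by simp
  then show ?case using k(1) rw(1) h(4) by blast
next
  case (built_Cy ts r S E xs a A EA ys b B EB zs c C EC)
  obtain S1 E1 a1 A1 EA1 b1 B1 EB1 c1 C1 EC1 where h: "built ts r' S1 E1"
          "built xs a1 A1 EA1" "built ys b1 B1 EB1" "built zs c1 C1 EC1"
          "S1 \<inter> A1 = {}" "S1 \<inter> B1 = {}" "S1 \<inter> C1 = {}" "A1 \<inter> B1 = {}" "A1 \<inter> C1 = {}" "B1 \<inter> C1 = {}"
          "S' = S1 \<union> A1 \<union> B1 \<union> C1" "E' = E1 \<union> EA1 \<union> EB1 \<union> EC1 \<union> square r' a1 b1 c1"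
    using built_Cy.prems by (auto elim: built_CyE)
  note hyp = built_Cy.hyps
  note ed = built_edges[OF hyp(1)] built_edges[OF hyp(2)] built_edges[OF hyp(3)] built_edges[OF hyp(4)]
  note ro = built_root[OF hyp(1)] built_root[OF hyp(2)] built_root[OF hyp(3)] built_root[OF hyp(4)]
  obtain f where f: "bij_betw f S S1" "f r = r'" "E1 = map_prod f f ` E" using built_Cy.IH(1)[OF h(1)] by blast
  obtain fa where fa: "bij_betw fa A A1" "fa a = a1" "EA1 = map_prod fa fa ` EA" using built_Cy.IH(2)[OF h(2)] by blast
  obtain fb where fb: "bij_betw fb B B1" "fb b = b1" "EB1 = map_prod fb fb ` EB" using built_Cy.IH(3)[OF h(3)] by blast
  obtain fc where fc: "bij_betw fc C C1" "fc c = c1" "EC1 = map_prod fc fc ` EC" using built_Cy.IH(4)[OF h(4)] by blast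
  have d: "(S \<union> A) \<inter> B = {}" "(S \<union> A \<union> B) \<inter> C = {}" using hyp(5-10) by blast+
  have d1: "(S1 \<union> A1) \<inter> B1 = {}" "(S1 \<union> A1 \<union> B1) \<inter> C1 = {}" using h(5-10) by blast+
  obtain k where k: "bij_betw k (S \<union> A) (S1 \<union> A1)" "\<And>x. x \<in> S \<Longrightarrow> k x = f x" "\<And>x. x \<in> A \<Longrightarrow> k x = fa x"
    "map_prod k k ` (E \<union> EA) = map_prod f f ` E \<union> map_prod fa fa ` EA" "E \<union> EA \<subseteq> (S \<union> A) \<times> (S \<union> A)"
    by (rule glue[OF f(1) fa(1) hyp(5) h(5) ed(1,2)]) (rule that)
  obtain m where m: "bij_betw m (S \<union> A \<union> B) (S1 \<union> A1 \<union> B1)" "\<And>x. x \<in> S \<union> A \<Longrightarrow> m x = k x" "\<And>x. x \<in> B \<Longrightarrow> m x = fb x"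
    "map_prod m m ` (E \<union> EA \<union> EB) = map_prod k k ` (E \<union> EA) \<union> map_prod fb fb ` EB"
    "E \<union> EA \<union> EB \<subseteq> (S \<union> A \<union> B) \<times> (S \<union> A \<union> B)"
    by (rule glue[OF k(1) fb(1) d(1) d1(1) k(5) ed(3)]) (rule that)
  obtain q where q: "bij_betw q (S \<union> A \<union> B \<union> C) (S1 \<union> A1 \<union> B1 \<union> C1)" "\<And>x. x \<in> S \<union> A \<union> B \<Longrightarrow> q x = m x" "\<And>x. x \<in> C \<Longrightarrow> q x = fc x"
    "map_prod q q ` (E \<union> EA \<union> EB \<union> EC) = map_prod m m ` (E \<union> EA \<union> EB) \<union> map_prod fc fc ` EC"
    by (rule glue[OF m(1) fc(1) d(2) d1(2) m(5) ed(4)]) (rule that)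
  have qr: "q r = r'" "q a = a1" "q b = b1" "q c = c1"
    using q(2,3) m(2,3) k(2,3) ro f(2) fa(2) fb(2) fc(2) by auto
  have "E' = map_prod q q ` (E \<union> EA \<union> EB \<union> EC \<union> square r a b c)"
    unfolding image_Un[of _ "E \<union> EA \<union> EB \<union> EC"] q(4) m(4) k(4) map_prod_square qr h(12) f(3) fa(3) fb(3) fc(3) ..
  then show ?case using q(1) qr(1) h(11) by blast
qed

lemma built_image:
  assumes "built ts r S E" "inj_on f S"
  shows "built ts (f r) (f ` S) (map_prod f f ` E)"
  using assms
proof (induction rule: built.induct)
  case (built_Nil r)
  then show ?case by (simp add: built.built_Nil)
next
  case (built_Br ts r S E us w T F)
  then have "f ` S \<inter> f ` T = {}" using inj_on_image_Int[of f "S \<union> T" S T] by simp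
  moreover have "inj_on f S" "inj_on f T" using built_Br.prems by (auto simp: inj_on_Un)
  ultimately show ?case
    by (intro built_Br_eq[OF built_Br.IH]) (auto simp: image_Un)
next
  case (built_Cy ts r S E xs a A EA ys b B EB zs c C EC)
  have i: "inj_on f S" "inj_on f A" "inj_on f B" "inj_on f C" using built_Cy.prems by (auto simp: inj_on_Un)
  have d: "f ` X \<inter> f ` Y = {}" if "X \<inter> Y = {}" "X \<subseteq> S \<union> A \<union> B \<union> C" "Y \<subseteq> S \<union> A \<union> B \<union> C" for X Y
    using inj_on_image_Int[OF built_Cy.prems that(2,3)] that(1) by simp
  have d1: "f ` S \<inter> f ` A = {}" "f ` S \<inter> f ` B = {}" "f ` S \<inter> f ` C = {}"
    "f ` A \<inter> f ` B = {}" "f ` A \<inter> f ` C = {}" "f ` B \<inter> f ` C = {}"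
    using built_Cy.hyps(5-10) by (simp_all add: d le_supI1)
  show ?case
    by (rule built_Cy_eq[OF built_Cy.IH(1)[OF i(1)] built_Cy.IH(2)[OF i(2)] built_Cy.IH(3)[OF i(3)] built_Cy.IH(4)[OF i(4)] d1])
      (simp_all only: image_Un map_prod_square)
qed

subsection \<open>Unicyclic graphs of girth four\<close>

lemma out_degree_deg: "out_degree (with_proj G) v = deg (parcs G) v"
proof -
  have "out_arcs (with_proj G) v = Pair v ` (parcs G `` {v})" by (auto simp: out_arcs_def)
  then show ?thesis by (simp add: out_degree_def deg_def card_image inj_on_def)
qed

text \<open>Substituting \<open>- lam\<close> turns \<lambda> I - L into - (\<lambda> I + L). The
  sign \<open>(-1) ^ n\<close> of the determinant and the sign \<open>(-1) ^ (n - k)\<close> of the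
  substitution combine to the \<open>(-1) ^ k\<close> in \<open>lap_coeff\<close>.\<close>

lemma lap_coeff_eq:
  assumes G: "pair_graph G" "pverts G = {..<n}" and k: "k \<le> n"
  shows "lap_coeff G k = coeff (ldet {..<n} (lap_mat (parcs G))) (n - k)"
proof -
  interpret pair_graph G by fact
  let ?L = "laplacian G" and ?M = "lap_mat (parcs G)"
  have n: "order_of G = n" using G(2) by (simp add: order_of_def)
  have L: "?L \<in> carrier_mat n n" unfolding laplacian_def by (rule minus_carrier_mat) (simp add: adjacency_mat_def n)
  have entry: "pcompose (char_poly_matrix ?L $$ (i, j)) [:0, -1:] = - ?M i j" if "i < n" "j < n" for i j
    using that no_loops'[of i j] n
    by (auto simp: char_poly_matrix_def laplacian_def degree_mat_def adjacency_mat_def lap_mat_def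
        out_degree_deg pcompose_pCons lam_def of_nat_poly)
  have "char_poly ?L = (\<Sum>p | p permutes {0..<n}. signof p * (\<Prod>i = 0..<n. char_poly_matrix ?L $$ (i, p i)))"
    unfolding char_poly_def by (rule det_def') (use L in simp)
  then have "pcompose (char_poly ?L) [:0, -1:] =
      (\<Sum>p | p permutes {0..<n}. signof p * (\<Prod>i = 0..<n. pcompose (char_poly_matrix ?L $$ (i, p i)) [:0, -1:]))"
    by (simp add: pcompose_sum pcompose_mult pcompose_prod pcompose_smult of_int_poly)
  also have "\<dots> = (\<Sum>p | p permutes {0..<n}. signof p * ((-1) ^ n * (\<Prod>i = 0..<n. ?M i (p i))))"
  proof (intro sum.cong refl arg_cong2[where f = "(*)"])
    fix p assume "p \<in> {p. p permutes {0..<n}}"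
    then have "p i < n" if "i < n" for i using that permutes_in_image[of p "{0..<n}" i] by simp
    then have "(\<Prod>i = 0..<n. pcompose (char_poly_matrix ?L $$ (i, p i)) [:0, -1:]) = (\<Prod>i = 0..<n. - ?M i (p i))"
      by (intro prod.cong refl entry) auto
    then show "(\<Prod>i = 0..<n. pcompose (char_poly_matrix ?L $$ (i, p i)) [:0, -1:]) = (-1) ^ n * (\<Prod>i = 0..<n. ?M i (p i))"
      by (simp add: prod_uminus)
  qed
  also have "\<dots> = (-1) ^ n * ldet {..<n} ?M"
    by (simp add: ldet_def sum_distrib_left lessThan_atLeast0 algebra_simps)
  finally have P: "pcompose (char_poly ?L) [:0, -1:] = (-1) ^ n * ldet {..<n} ?M" .
  have "(-1) ^ (n - k) * coeff (char_poly ?L) (n - k) = coeff (pcompose (char_poly ?L) [:0, -1:]) (n - k)"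
    by (simp add: coeff_pcompose_linear)
  also have "\<dots> = (-1) ^ n * coeff (ldet {..<n} ?M) (n - k)"
    unfolding P by (cases "even n") simp_all
  finally have "(-1) ^ (n - k) * coeff (char_poly ?L) (n - k) = (-1) ^ n * coeff (ldet {..<n} ?M) (n - k)" .
  moreover have "even (n - k) \<longleftrightarrow> (even n \<longleftrightarrow> even k)" using k by simp
  ultimately show ?thesis unfolding lap_coeff_def n
    by (cases "even n"; cases "even k") simp_all
qed

text \<open>An isomorphism of digraphs also carries a map on arcs. Arcs here are pairs with
  \<open>fst\<close> and \<open>snd\<close> as their ends, so that map is forced by the one on
  vertices.\<close>

lemma digraph_iso_iff:
  assumes "pair_wf_digraph G"
  shows "digraph_iso (with_proj G) (with_proj H) \<longleftrightarrow>
    (\<exists>f. bij_betw f (pverts G) (pverts H) \<and> parcs H = map_prod f f ` parcs G)"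
proof
  interpret pair_wf_digraph G by fact
  assume "digraph_iso (with_proj G) (with_proj H)"
  then obtain h where h: "digraph_isomorphism h" "with_proj H = app_iso h (with_proj G)"
    by (auto simp: digraph_iso_def)
  define f where "f = iso_verts h"
  have H: "pverts H = f ` pverts G" "parcs H = iso_arcs h ` parcs G" "iso_tail h = fst" "iso_head h = snd"
    using arg_cong[OF h(2), of verts] arg_cong[OF h(2), of arcs] arg_cong[OF h(2), of tail] arg_cong[OF h(2), of head]
    by (simp_all add: f_def)
  have "iso_arcs h e = map_prod f f e" if "e \<in> parcs G" for e
    using h(1) that H(3,4) unfolding digraph_isomorphism_def f_def by (cases e) (auto simp: prod_eq_iff)
  then have "parcs H = map_prod f f ` parcs G" using H(2) by auto
  moreover have "bij_betw f (pverts G) (pverts H)"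
    using h(1) H(1) by (auto simp: bij_betw_def digraph_isomorphism_def f_def)
  ultimately show "\<exists>f. bij_betw f (pverts G) (pverts H) \<and> parcs H = map_prod f f ` parcs G" by blast
next
  interpret pair_wf_digraph G by fact
  assume "\<exists>f. bij_betw f (pverts G) (pverts H) \<and> parcs H = map_prod f f ` parcs G"
  then obtain f where f: "bij_betw f (pverts G) (pverts H)" "parcs H = map_prod f f ` parcs G" by blast
  let ?h = "\<lparr>iso_verts = f, iso_arcs = map_prod f f, iso_head = snd, iso_tail = fst\<rparr>"
  have "parcs G \<subseteq> pverts G \<times> pverts G" by (auto dest: in_arcsD1 in_arcsD2)
  moreover have "inj_on (map_prod f f) (pverts G \<times> pverts G)"
    using f(1) by (intro map_prod_inj_on) (auto simp: bij_betw_def)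
  ultimately have "inj_on (map_prod f f) (parcs G)" by (rule inj_on_subset[rotated])
  then have "digraph_isomorphism ?h"
    using f(1) wf_digraph_axioms by (simp add: digraph_isomorphism_def bij_betw_def)
  moreover have "with_proj H = app_iso ?h (with_proj G)"
    using f by (simp add: with_proj_def app_iso_def bij_betw_def)
  ultimately show "digraph_iso (with_proj G) (with_proj H)" unfolding digraph_iso_def by (intro exI conjI)
qed

text \<open>Cycles of length at least 3 without reference to a starting vertex.\<close>

definition is_cyc :: "'a rel \<Rightarrow> ('a \<times> 'a) list \<Rightarrow> bool" where
  "is_cyc E p \<longleftrightarrow> set p \<subseteq> E \<and> 3 \<le> length p \<and> distinct (map snd p) \<and>
    (\<forall>i<length p. fst (p ! (Suc i mod length p)) = snd (p ! i))"

section \<open>Cycles as closed lists of arcs\<close>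

lemma pcas_nth: "pcas u p v \<Longrightarrow> p \<noteq> [] \<Longrightarrow> fst (p ! 0) = u \<and> snd (last p) = v \<and>
    (\<forall>i. Suc i < length p \<longrightarrow> fst (p ! Suc i) = snd (p ! i))"
proof (induction p arbitrary: u)
  case (Cons e p)
  show ?case
  proof (cases "p = []")
    case False
    then have IH: "fst (p ! 0) = snd e" "snd (last p) = v" "\<And>i. Suc i < length p \<Longrightarrow> fst (p ! Suc i) = snd (p ! i)"
      using Cons by auto
    have "fst ((e # p) ! Suc i) = snd ((e # p) ! i)" if "Suc i < length (e # p)" for i
      using that IH by (cases i) auto
    then show ?thesis using Cons.prems IH False by auto
  qed (use Cons.prems in auto)
qed simp

lemma nth_pcas:
  assumes "p \<noteq> []" "\<And>i. Suc i < length p \<Longrightarrow> fst (p ! Suc i) = snd (p ! i)"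
  shows "pcas (fst (p ! 0)) p (snd (last p))"
  using assms
proof (induction p)
  case (Cons e p)
  show ?case
  proof (cases "p = []")
    case False
    have "fst (p ! Suc i) = snd (p ! i)" if "Suc i < length p" for i
      using Cons.prems(2)[of "Suc i"] that by simp
    then have "pcas (fst (p ! 0)) p (snd (last p))" using Cons.IH False by blast
    moreover have "fst (p ! 0) = snd e" using Cons.prems(2)[of 0] False by simp
    ultimately show ?thesis using False by simp
  qed simp
qed simp

lemma graph_cycles_iff:
  assumes "pair_wf_digraph G"
  shows "p \<in> graph_cycles G \<longleftrightarrow> is_cyc (parcs G) p"
proof -
  interpret pair_wf_digraph G by fact
  have tl: "tl (pawalk_verts u p) = map snd p" if "pcas u p v" for u v
    using awalk_verts_conv'[OF that] by simp
  show ?thesis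
  proof
    assume "p \<in> graph_cycles G"
    then obtain u where u: "set p \<subseteq> parcs G" "pcas u p u" "distinct (tl (pawalk_verts u p))" "3 \<le> length p"
      by (auto simp: graph_cycles_def cycle_def awalk_def)
    then have ne: "p \<noteq> []" by auto
    note nth = pcas_nth[OF u(2) ne]
    have "fst (p ! (Suc i mod length p)) = snd (p ! i)" if "i < length p" for i
    proof (cases "Suc i < length p")
      case False
      then have "i = length p - 1" using that by simp
      then show ?thesis using nth ne by (simp add: last_conv_nth)
    qed (use nth in simp)
    then show "is_cyc (parcs G) p" using u tl[OF u(2)] by (simp add: is_cyc_def)
  next
    assume c: "is_cyc (parcs G) p"
    then have ne: "p \<noteq> []" by (auto simp: is_cyc_def)
    have step: "fst (p ! Suc i) = snd (p ! i)" if "Suc i < length p" for i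
    proof -
      have "i < length p" using that by simp
      then have "fst (p ! (Suc i mod length p)) = snd (p ! i)" using c unfolding is_cyc_def by blast
      then show ?thesis using that by simp
    qed
    have "length p - 1 < length p" using ne by simp
    then have "fst (p ! (Suc (length p - 1) mod length p)) = snd (p ! (length p - 1))"
      using c unfolding is_cyc_def by blast
    then have "snd (last p) = fst (p ! 0)" using ne by (simp add: last_conv_nth)
    then have pc: "pcas (fst (p ! 0)) p (fst (p ! 0))" using nth_pcas[OF ne step] by simp
    have "p ! 0 \<in> parcs G" using c ne by (auto simp: is_cyc_def)
    then have "fst (p ! 0) \<in> pverts G" by (rule arc_fst_in_verts)
    then have "awalk (fst (p ! 0)) p (fst (p ! 0))" using c pc by (simp add: awalk_def is_cyc_def)
    moreover have "distinct (tl (pawalk_verts (fst (p ! 0)) p))" using c tl[OF pc] by (simp add: is_cyc_def)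
    ultimately show "p \<in> graph_cycles G" using c ne by (auto simp: graph_cycles_def cycle_def is_cyc_def)
  qed
qed

text \<open>With at least three arcs and distinct heads, a cycle never turns back along the edge
  just used. This keeps leaves off cycles and forces the way round a square.\<close>

lemma is_cyc_next:
  assumes "is_cyc E p" "(x, y) \<in> set p"
  shows "\<exists>z. (y, z) \<in> set p \<and> z \<noteq> x" and "\<exists>z. (z, x) \<in> set p \<and> z \<noteq> y"
proof -
  let ?k = "length p"
  have k: "3 \<le> ?k" and d: "distinct (map snd p)" using assms(1) by (auto simp: is_cyc_def)
  have suc: "fst (p ! (Suc i mod ?k)) = snd (p ! i)" if "i < ?k" for i using assms(1) that by (simp add: is_cyc_def)
  have inj: "i = j" if "snd (p ! i) = snd (p ! j)" "i < ?k" "j < ?k" for i j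
    using d that by (metis distinct_conv_nth length_map nth_map)
  define pr where "pr i = (if i = 0 then ?k - 1 else i - 1)" for i
  have pr: "pr i < ?k" "Suc (pr i) mod ?k = i" if "i < ?k" for i
    using that k by (auto simp: pr_def)
  have prev: "snd (p ! pr i) = fst (p ! i)" if "i < ?k" for i
    using suc[OF pr(1)[OF that]] pr(2)[OF that] by simp
  obtain i where i: "i < ?k" "p ! i = (x, y)" using assms(2) by (metis in_set_conv_nth)
  define j where "j = Suc i mod ?k"
  have j: "j < ?k" "j \<noteq> pr i" using k i(1) by (auto simp: j_def pr_def mod_Suc)
  have "p ! j = (y, snd (p ! j))" using suc[OF i(1)] i(2) by (simp add: j_def prod_eq_iff)
  moreover have "snd (p ! j) \<noteq> x" using inj[of j "pr i"] prev[OF i(1)] i j pr(1) by auto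
  ultimately show "\<exists>z. (y, z) \<in> set p \<and> z \<noteq> x" using j(1) by (metis nth_mem)
  have "p ! pr i = (fst (p ! pr i), x)" using prev[OF i(1)] i(2) by (simp add: prod_eq_iff)
  moreover have "pr (pr i) \<noteq> i" using k i(1) by (auto simp: pr_def split: if_splits)
  then have "fst (p ! pr i) \<noteq> y" using inj[of "pr (pr i)" i] prev[OF pr(1)[OF i(1)]] i pr(1) by auto
  ultimately show "\<exists>z. (z, x) \<in> set p \<and> z \<noteq> y" using pr(1)[OF i(1)] by (metis nth_mem)
qed

lemma is_cyc_mono: "is_cyc E p \<Longrightarrow> E \<subseteq> F \<Longrightarrow> is_cyc F p"
  unfolding is_cyc_def by blast

lemma unic_wf:
  assumes "unic S E"
  shows "finite S \<and> S \<noteq> {} \<and> E \<subseteq> S \<times> S \<and> sym E \<and> irrefl E"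
proof -
  obtain ts r where "built ts r S E" using unic_built[OF assms] by blast
  from built_wf[OF this] show ?thesis by blast
qed

lemma unic_connected:
  assumes "unic S E"
  shows "\<exists>r\<in>S. \<forall>v\<in>S. (r, v) \<in> E\<^sup>*"
  using assms
proof induction
  case (unic_square a b c d)
  have "(a, b) \<in> square a b c d" "(b, c) \<in> square a b c d" "(a, d) \<in> square a b c d"
    by (simp_all add: square_def)
  then have "\<forall>v\<in>{a, b, c, d}. (a, v) \<in> (square a b c d)\<^sup>*"
    by (auto intro: rtrancl_into_rtrancl)
  then show ?case by blast
next
  case (unic_leaf S E u v)
  then obtain r where r: "r \<in> S" "\<And>x. x \<in> S \<Longrightarrow> (r, x) \<in> E\<^sup>*" by blast
  have mono: "E\<^sup>* \<subseteq> (E \<union> {(u, v), (v, u)})\<^sup>*" by (rule rtrancl_mono) blast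
  have "(r, v) \<in> (E \<union> {(u, v), (v, u)})\<^sup>*"
    using r(2)[OF unic_leaf.hyps(2)] mono by (meson UnCI insertCI rtrancl.rtrancl_into_rtrancl subsetD)
  then have "\<forall>x\<in>insert v S. (r, x) \<in> (E \<union> {(u, v), (v, u)})\<^sup>*" using r(2) mono by blast
  then show ?case using r(1) by blast
qed

text \<open>Every corner has two neighbours, so one arc determines all that follow; distinct heads
  exclude the arcs of the other orientation.\<close>

lemma is_cyc_square:
  assumes d: "distinct [a, b, c, d]" and p: "is_cyc (square a b c d) p"
  shows "set p \<union> (set p)\<inverse> = square a b c d \<and> length p = 4"
proof -
  have sub: "set p \<subseteq> square a b c d" and len: "3 \<le> length p" and dist: "distinct (map snd p)"
    using p by (auto simp: is_cyc_def)
  have ne: "a \<noteq> b" "a \<noteq> c" "a \<noteq> d" "b \<noteq> c" "b \<noteq> d" "c \<noteq> d" using d by auto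
  note ne = ne ne[symmetric]
  have nxt: "(y, z) \<in> set p" if "(x, y) \<in> set p" "\<And>w. (y, w) \<in> square a b c d \<Longrightarrow> w \<noteq> x \<Longrightarrow> w = z" for x y z
    using is_cyc_next(1)[OF p that(1)] sub that(2) by blast
  have f: "(a, b) \<in> set p \<Longrightarrow> (b, c) \<in> set p" "(b, c) \<in> set p \<Longrightarrow> (c, d) \<in> set p"
    "(c, d) \<in> set p \<Longrightarrow> (d, a) \<in> set p" "(d, a) \<in> set p \<Longrightarrow> (a, b) \<in> set p"
    "(b, a) \<in> set p \<Longrightarrow> (a, d) \<in> set p" "(a, d) \<in> set p \<Longrightarrow> (d, c) \<in> set p"
    "(d, c) \<in> set p \<Longrightarrow> (c, b) \<in> set p" "(c, b) \<in> set p \<Longrightarrow> (b, a) \<in> set p"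
    using ne by (auto simp: square_def elim!: nxt)
  have head: "x = x'" if "(x, y) \<in> set p" "(x', y) \<in> set p" for x x' y
    using dist that by (metis distinct_map inj_onD prod.inject snd_conv)
  obtain e where "e \<in> set p" using len by (cases p) auto
  then have "(a, b) \<in> set p \<or> (b, a) \<in> set p" using sub f by (auto simp: square_def)
  then have "set p = {(a,b),(b,c),(c,d),(d,a)} \<or> set p = {(b,a),(a,d),(d,c),(c,b)}"
  proof
    assume "(a, b) \<in> set p"
    then have all: "{(a,b),(b,c),(c,d),(d,a)} \<subseteq> set p" using f by auto
    have "(b, a) \<notin> set p" using head[of b a d] all ne by auto
    then have "(b, a) \<notin> set p" "(a, d) \<notin> set p" "(d, c) \<notin> set p" "(c, b) \<notin> set p" using f by auto
    then have "set p \<subseteq> {(a,b),(b,c),(c,d),(d,a)}" using sub unfolding square_def by blast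
    then show ?thesis using all by blast
  next
    assume "(b, a) \<in> set p"
    then have all: "{(b,a),(a,d),(d,c),(c,b)} \<subseteq> set p" using f by auto
    have "(a, b) \<notin> set p" using head[of a b c] all ne by auto
    then have "(a, b) \<notin> set p" "(b, c) \<notin> set p" "(c, d) \<notin> set p" "(d, a) \<notin> set p" using f by auto
    then have "set p \<subseteq> {(b,a),(a,d),(d,c),(c,b)}" using sub unfolding square_def by blast
    then show ?thesis using all by blast
  qed
  moreover have "length p = card (set p)" using dist by (simp add: distinct_card distinct_map)
  ultimately show ?thesis using ne by (elim disjE) (auto simp: square_def)
qed

text \<open>A cycle through a new leaf would enter and leave it by the same edge, so attaching
  leaves creates no cycle.\<close>

lemma unic_cycles:
  assumes "unic S E"
  shows "\<exists>Q. (\<forall>p. is_cyc E p \<longrightarrow> set p \<union> (set p)\<inverse> = Q \<and> length p = 4) \<and> (\<exists>p. is_cyc E p)"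
  using assms
proof induction
  case (unic_square a b c d)
  let ?p = "[(a,b),(b,c),(c,d),(d,a)]"
  have "fst (?p ! (Suc i mod 4)) = snd (?p ! i)" if i: "i < 4" for i
  proof -
    consider "i = 0" | "i = 1" | "i = 2" | "i = 3" using i by linarith
    then show ?thesis by cases simp_all
  qed
  moreover have "set ?p \<subseteq> square a b c d" by (simp add: square_def)
  moreover have "distinct (map snd ?p)" using unic_square by auto
  ultimately have "is_cyc (square a b c d) ?p" by (simp add: is_cyc_def)
  then show ?case using is_cyc_square[OF unic_square] by blast
next
  case (unic_leaf S E u v)
  let ?E = "E \<union> {(u, v), (v, u)}"
  have E: "E \<subseteq> S \<times> S" using unic_wf[OF unic_leaf.hyps(1)] by blast
  have "is_cyc E p" if p: "is_cyc ?E p" for p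
  proof -
    have sub: "set p \<subseteq> ?E" using p by (simp add: is_cyc_def)
    have "(u, v) \<notin> set p"
    proof
      assume "(u, v) \<in> set p"
      then obtain z where "(v, z) \<in> set p" "z \<noteq> u" using is_cyc_next(1)[OF p] by blast
      then show False using sub E unic_leaf.hyps by blast
    qed
    moreover have "(v, u) \<notin> set p"
    proof
      assume "(v, u) \<in> set p"
      then obtain z where "(z, v) \<in> set p" "z \<noteq> u" using is_cyc_next(2)[OF p] by blast
      then show False using sub E unic_leaf.hyps by blast
    qed
    ultimately have "set p \<subseteq> E" using sub by blast
    then show ?thesis using p by (simp add: is_cyc_def)
  qed
  moreover have "is_cyc ?E p" if "is_cyc E p" for p using is_cyc_mono[OF that] by blast
  ultimately have "is_cyc ?E = is_cyc E" by (intro ext iffI)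
  then show ?case using unic_leaf.IH by simp
qed

lemma unic_pair_graph:
  assumes "unic S E"
  shows "pair_graph \<lparr>pverts = S, parcs = E\<rparr>"
proof -
  have wf: "finite S" "E \<subseteq> S \<times> S" "sym E" "irrefl E" using unic_wf[OF assms] by blast+
  show ?thesis
  proof
    show "finite (parcs \<lparr>pverts = S, parcs = E\<rparr>)" using wf by (auto intro: finite_subset)
    show "symmetric (with_proj \<lparr>pverts = S, parcs = E\<rparr>)" using wf by (simp add: symmetric_def)
  qed (use wf in \<open>auto simp: irrefl_def\<close>)
qed

lemma unic_graph_properties:
  assumes u: "unic S E"
  shows "Digraph_Component.connected (with_proj \<lparr>pverts = S, parcs = E\<rparr>)"
    and "unicyclic \<lparr>pverts = S, parcs = E\<rparr>" and "girth \<lparr>pverts = S, parcs = E\<rparr> = enat 4"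
proof -
  let ?G = "\<lparr>pverts = S, parcs = E\<rparr>"
  interpret pair_graph ?G by (rule unic_pair_graph) fact
  have wf: "S \<noteq> {}" "E \<subseteq> S \<times> S" "sym E" using unic_wf[OF u] by blast+
  have on: "(x, y) \<in> rtrancl_on S E" if "(x, y) \<in> E\<^sup>*" "x \<in> S" for x y
    using that
  proof (induction rule: rtrancl_induct)
    case (step y z)
    then show ?case using wf(2) by (auto intro: rtrancl_on_into_rtrancl_on)
  qed simp
  obtain r where r: "r \<in> S" "\<And>v. v \<in> S \<Longrightarrow> (r, v) \<in> E\<^sup>*" using unic_connected[OF u] by blast
  have "(x, y) \<in> E\<^sup>*" if "x \<in> S" "y \<in> S" for x y
    using r(2)[OF that(1)] r(2)[OF that(2)] sym_rtrancl[OF wf(3)] by (meson rtrancl_trans symD)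
  moreover have "E\<^sup>s = E" using wf(3) by (auto simp: symcl_def sym_def)
  ultimately show "Digraph_Component.connected (with_proj ?G)"
    using wf(1) on by (auto simp: connected_conv)
  obtain Q where Q: "\<And>p. is_cyc E p \<Longrightarrow> set p \<union> (set p)\<inverse> = Q" "\<And>p. is_cyc E p \<Longrightarrow> length p = 4"
    and ex: "\<exists>p. is_cyc E p"
    using unic_cycles[OF u] by blast
  have cyc: "graph_cycles ?G = {p. is_cyc E p}"
    using graph_cycles_iff[of ?G] pair_wf_digraph_axioms by auto
  show "unicyclic ?G" unfolding unicyclic_def cyc using Q(1) ex by blast
  have "girth ?G = (INF p\<in>{p. is_cyc E p}. enat 4)"
    unfolding girth_def cyc using Q(2) by (intro INF_cong refl) simp
  then show "girth ?G = enat 4" using ex by simp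
qed

text \<open>A cycle of length 4 is a square in \<open>G\<close>. A largest leaf extension of it
  inside \<open>G\<close> covers all vertices by connectedness, and any edge outside it would close
  a second cycle.\<close>

lemma unicI:
  assumes G: "pair_graph G" "Digraph_Component.connected (with_proj G)" "unicyclic G" "girth G = enat 4"
  shows "unic (pverts G) (parcs G)"
proof -
  interpret pair_graph G by fact
  have symE: "(y, x) \<in> parcs G" if "(x, y) \<in> parcs G" for x y using arcs_symmetric[OF that] .
  have cyc: "p \<in> graph_cycles G \<longleftrightarrow> is_cyc (parcs G) p" for p
    using graph_cycles_iff pair_wf_digraph_axioms by blast
  have uniq: "set p \<union> (set p)\<inverse> = set q \<union> (set q)\<inverse>" if "p \<in> graph_cycles G" "q \<in> graph_cycles G" for p q
    using G(3) that unfolding unicyclic_def by blast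
  obtain p0 where "p0 \<in> graph_cycles G" using G(3) unfolding unicyclic_def by blast
  \<comment> \<open>The girth is the infimum of a nonempty set of extended naturals and hence
    attained.\<close>
  then have "enat 4 \<in> (\<lambda>p. enat (length p)) ` graph_cycles G"
    using G(4) unfolding girth_def Inf_enat_def by (auto split: if_splits) (metis (mono_tags, lifting) LeastI imageI image_iff)
  then obtain p where p: "is_cyc (parcs G) p" "length p = 4" using cyc by auto
  have c: "fst (p ! (Suc i mod 4)) = snd (p ! i)" if "i < 4" for i
    using p that unfolding is_cyc_def by simp
  have p4: "p = [p ! 0, p ! 1, p ! 2, p ! 3]"
    using p(2) by (cases p; cases "tl p"; cases "tl (tl p)"; cases "tl (tl (tl p))") (auto simp: numeral_eq_Suc)
  define a b c' d where "a = snd (p ! 3)" and "b = snd (p ! 0)" and "c' = snd (p ! 1)" and "d = snd (p ! 2)"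
  have "fst (p ! 1) = snd (p ! 0)" "fst (p ! 3) = snd (p ! 2)" "fst (p ! 0) = snd (p ! 3)"
    using c[of 0] c[of 2] c[of 3] by simp_all
  moreover have "fst (p ! 2) = snd (p ! 1)" using c[of 1] by (simp add: numeral_2_eq_2)
  ultimately have arcs: "p ! 0 = (a, b)" "p ! 1 = (b, c')" "p ! 2 = (c', d)" "p ! 3 = (d, a)"
    unfolding a_def b_def c'_def d_def by (metis prod.collapse)+
  have "distinct (map snd p)" using p(1) by (simp add: is_cyc_def)
  moreover have "p = [(a, b), (b, c'), (c', d), (d, a)]" using p4 unfolding arcs .
  ultimately have dist: "distinct [a, b, c', d]" and setp: "set p = {(a, b), (b, c'), (c', d), (d, a)}" by auto
  have "set p \<subseteq> parcs G" using p(1) by (simp add: is_cyc_def)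
  then have "{(a, b), (b, c'), (c', d), (d, a)} \<subseteq> parcs G" unfolding setp .
  then have sq: "square a b c' d \<subseteq> parcs G" using symE unfolding square_def by blast
  then have sqv: "{a, b, c', d} \<subseteq> pverts G" using in_arcsD1 unfolding square_def by blast
  define P where "P T \<longleftrightarrow> T \<subseteq> pverts G \<and> (\<exists>F. unic T F \<and> F \<subseteq> parcs G)" for T
  have "P {a, b, c', d}" unfolding P_def using unic_square[OF dist] sq sqv by blast
  moreover have bd: "card T \<le> card (pverts G)" if "P T" for T
    using that pair_finite_verts by (auto simp: P_def intro: card_mono)
  ultimately obtain T where T: "P T" "\<And>T'. P T' \<Longrightarrow> card T' \<le> card T"
    using ex_has_greatest_nat[of P _ card "Suc (card (pverts G))"] by (metis less_Suc_eq_le)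
  then obtain F where F: "unic T F" "F \<subseteq> parcs G" and TS: "T \<subseteq> pverts G" by (auto simp: P_def)
  note wfF = unic_wf[OF F(1)]
  have closed: "parcs G `` T \<subseteq> T"
  proof
    fix y assume "y \<in> parcs G `` T"
    then obtain x where x: "(x, y) \<in> parcs G" "x \<in> T" by blast
    show "y \<in> T"
    proof (rule ccontr)
      assume y: "y \<notin> T"
      have "unic (insert y T) (F \<union> {(x, y), (y, x)})" using F(1) x(2) y by (rule unic_leaf)
      then have "P (insert y T)" unfolding P_def using F(2) x(1) symE[OF x(1)] TS in_arcsD2[OF x(1)] by blast
      then show False using T(2)[of "insert y T"] y wfF by simp
    qed
  qed
  have TV: "T = pverts G"
  proof (rule ccontr)
    assume "T \<noteq> pverts G"
    then obtain y where y: "y \<in> pverts G" "y \<notin> T" using TS by blast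
    obtain x where x: "x \<in> T" using wfF by blast
    have "strongly_connected (with_proj G)"
      using G(2) pair_sym_arcs symmetric_connected_imp_strongly_connected by blast
    then have "\<forall>x\<in>pverts G. \<forall>y\<in>pverts G. x \<rightarrow>\<^sup>*\<^bsub>with_proj G\<^esub> y"
      unfolding strongly_connected_def with_proj_simps by (rule conjunct2)
    from this[THEN bspec, OF subsetD[OF TS x], THEN bspec, OF y(1)]
    have "(x, y) \<in> rtrancl_on (pverts G) (parcs G)" by (simp only: reachable_def with_proj_simps)
    then have "(x, y) \<in> (parcs G)\<^sup>*" by (rule rtrancl_on_rtranclI)
    then have "y \<in> T" using x closed by (metis Image_closed_trancl ImageI)
    then show False using y by blast
  qed
  have "F = parcs G"
  proof (rule ccontr)
    assume "F \<noteq> parcs G"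
    \<comment> \<open>The arc \<open>(u, v)\<close> and a path from \<open>v\<close> to
      \<open>u\<close> in \<open>F\<close> form a cycle containing the edge \<open>uv\<close>,
      whereas \<open>F\<close> already contains a cycle avoiding it.\<close>
    then obtain u v where uv: "(u, v) \<in> parcs G" "(u, v) \<notin> F" using F(2) by auto
    have ne: "u \<noteq> v" using no_loops'[OF uv(1)] .
    have vu: "(v, u) \<notin> F" using uv(2) wfF by (auto simp: sym_def)
    have uvT: "u \<in> T" "v \<in> T" using in_arcsD1[OF uv(1)] in_arcsD2[OF uv(1)] TV by auto
    interpret H: pair_graph "\<lparr>pverts = T, parcs = F\<rparr>" using unic_pair_graph[OF F(1)] .
    have "strongly_connected (with_proj \<lparr>pverts = T, parcs = F\<rparr>)"
      using unic_graph_properties(1)[OF F(1)] H.pair_sym_arcs H.symmetric_connected_imp_strongly_connected by blast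
    then have "\<forall>x\<in>T. \<forall>y\<in>T. x \<rightarrow>\<^sup>*\<^bsub>with_proj \<lparr>pverts = T, parcs = F\<rparr>\<^esub> y"
      unfolding strongly_connected_def with_proj_simps pair_pre_digraph.select_convs by (rule conjunct2)
    from this[THEN bspec, OF uvT(2), THEN bspec, OF uvT(1)]
    obtain q where q: "H.apath v q u" unfolding H.reachable_apath by blast
    then have q': "set q \<subseteq> F" "pcas v q u" "distinct (pawalk_verts v q)"
      by (auto simp: H.apath_def H.awalk_def)
    have "q \<noteq> []" using q'(2) ne by auto
    moreover have "q \<noteq> [e]" for e using q'(1,2) vu by (cases e) auto
    ultimately have "2 \<le> length q" by (cases q; cases "tl q") auto
    moreover have "awalk u ((u, v) # q) u"
      using q' uv(1) F(2) in_arcsD1[OF uv(1)] by (auto simp: awalk_def)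
    ultimately have "(u, v) # q \<in> graph_cycles G"
      using q'(3) by (auto simp: graph_cycles_def cycle_def)
    moreover obtain p1 where p1: "is_cyc F p1" using unic_cycles[OF F(1)] by blast
    then have "p1 \<in> graph_cycles G" using cyc is_cyc_mono[OF p1 F(2)] by blast
    ultimately have "set ((u, v) # q) \<union> (set ((u, v) # q))\<inverse> = set p1 \<union> (set p1)\<inverse>"
      by (rule uniq)
    then have 1: "(u, v) \<in> set p1 \<union> (set p1)\<inverse>" by (metis UnI1 list.set_intros(1))
    have 2: "set p1 \<subseteq> F" using p1 by (simp add: is_cyc_def)
    have "(v, u) \<notin> set p1" "(u, v) \<notin> set p1" using 2 vu uv(2) by (meson subsetD)+
    then show False using 1 by simp
  qed
  with F(1) TV show ?thesis by (simp only:)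
qed

section \<open>Comparing graphs through the polynomials of their forms\<close>

lemma degree_ldet:
  assumes "finite S" "\<And>i j. i \<in> S \<Longrightarrow> j \<in> S \<Longrightarrow> degree (M i j) \<le> 1"
  shows "degree (ldet S M) \<le> card S"
  unfolding ldet_def
proof (rule degree_sum_le)
  show "finite {p. p permutes S}" using assms(1) by (rule finite_permutations)
  fix p assume "p \<in> {p. p permutes S}"
  then have p: "p permutes S" by simp
  have "degree (\<Prod>i\<in>S. M i (p i)) \<le> (\<Sum>i\<in>S. degree (M i (p i)))"
    using degree_prod_sum_le[OF assms(1), of "\<lambda>i. M i (p i)"] by (simp add: comp_def)
  also have "\<dots> \<le> (\<Sum>i\<in>S. 1)"
    using assms(2) permutes_in_image[OF p] by (intro sum_mono) blast
  also have "\<dots> = card S" by simp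
  finally have "degree (\<Prod>i\<in>S. M i (p i)) \<le> card S" .
  then show "degree (of_int (sign p) * (\<Prod>i\<in>S. M i (p i))) \<le> card S"
    by (simp add: sign_def)
qed

lemma degree_lap_mat: "degree (lap_mat E i j) \<le> 1"
proof -
  have "degree (lam + of_nat (deg E i)) \<le> 1"
    by (rule degree_add_le) (simp add: lam_def, simp)
  then show ?thesis by (auto simp: lap_mat_def)
qed

text \<open>\<open>lap_less\<close> sees only indices up to \<open>n\<close>; the degree bound
  ensures that two different polynomials differ there.\<close>

lemma degree_form_poly:
  assumes "built ts r S E"
  shows "degree (form_poly ts) \<le> card S"
proof -
  have "degree (ldet S (lap_mat E)) \<le> card S"
    by (rule degree_ldet[OF built_finite[OF assms]]) (rule degree_lap_mat)
  then show ?thesis by (simp only: conjunct1[OF built_ldet[OF assms]])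
qed

lemma lap_coeff_built:
  assumes "G \<in> unicyclic_graphs n l g" "built ts r {..<n} (parcs G)" "k \<le> n"
  shows "lap_coeff G k = coeff (form_poly ts) (n - k)"
  using assms built_ldet[OF assms(2)] lap_coeff_eq[of G n k] by (simp add: unicyclic_graphs_def)

lemma lap_le_built:
  assumes G: "G \<in> unicyclic_graphs n l g" "built ts r {..<n} (parcs G)"
    and H: "H \<in> unicyclic_graphs n l g" "built us w {..<n} (parcs H)"
  shows "lap_le G H \<longleftrightarrow> (\<forall>i\<le>n. coeff (form_poly ts) i \<le> coeff (form_poly us) i)"
    and "lap_less G H \<longleftrightarrow> lap_le G H \<and> (\<exists>i\<le>n. coeff (form_poly ts) i < coeff (form_poly us) i)"
proof -
  have n: "order_of G = n" "order_of H = n" using G(1) H(1) by (simp_all add: unicyclic_graphs_def order_of_def)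
  have flip: "(\<forall>k\<le>n. P (n - k)) \<longleftrightarrow> (\<forall>i\<le>n. P i)" for P
    by (metis diff_diff_cancel diff_le_self)
  have flip2: "(\<exists>k\<le>n. P (n - k)) \<longleftrightarrow> (\<exists>i\<le>n. P i)" for P
    by (metis diff_diff_cancel diff_le_self)
  show "lap_le G H \<longleftrightarrow> (\<forall>i\<le>n. coeff (form_poly ts) i \<le> coeff (form_poly us) i)"
    unfolding lap_le_def n using flip[of "\<lambda>i. coeff (form_poly ts) i \<le> coeff (form_poly us) i"]
    by (simp add: lap_coeff_built[OF G] lap_coeff_built[OF H])
  show "lap_less G H \<longleftrightarrow> lap_le G H \<and> (\<exists>i\<le>n. coeff (form_poly ts) i < coeff (form_poly us) i)"
    unfolding lap_less_def n using flip2[of "\<lambda>i. coeff (form_poly ts) i < coeff (form_poly us) i"]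
    by (simp add: lap_coeff_built[OF G] lap_coeff_built[OF H] cong: conj_cong)
qed

lemma leaves_built:
  assumes "pverts G = S" "built ts r S (parcs G)" "root_deg ts \<noteq> 1"
  shows "card (leaves G) = form_leaves ts"
proof -
  have "deg (parcs G) r \<noteq> 1" using built_degrees[OF assms(2)] assms(3) by simp
  then have "leaves G = {v \<in> S - {r}. deg (parcs G) v = 1}"
    using assms(1) by (auto simp: leaves_def out_degree_deg)
  then show ?thesis using built_degrees[OF assms(2)] by simp
qed

lemma built_in_unicyclic_graphs:
  assumes b: "built ts r {..<n} E" and "form_cycles ts = 1" "root_deg ts \<noteq> 1" "form_leaves ts = l"
  shows "\<lparr>pverts = {..<n}, parcs = E\<rparr> \<in> unicyclic_graphs n l 4"
proof -
  have u: "unic {..<n} E" using b assms(2) by (rule built_unic)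
  have "card (leaves \<lparr>pverts = {..<n}, parcs = E\<rparr>) = l"
    using leaves_built[of "\<lparr>pverts = {..<n}, parcs = E\<rparr>" "{..<n}" ts r] b assms(3,4) by simp
  then show ?thesis
    using unic_pair_graph[OF u] unic_graph_properties[OF u] by (simp add: unicyclic_graphs_def)
qed

text \<open>Non-minimality is reduced to exhibiting a form. The condition on
  \<open>root_deg us\<close> prevents the root from being a leaf that \<open>form_leaves\<close>
  overlooks.\<close>

lemma smaller_graph:
  assumes G: "G \<in> unicyclic_graphs n l 4" "built ts r {..<n} (parcs G)"
    and us: "form_size us = form_size ts" "form_cycles us = 1" "root_deg us \<noteq> 1" "form_leaves us = l"
    and pos: "pos_poly (form_poly ts - form_poly us)"
  shows "\<exists>H\<in>unicyclic_graphs n l 4. lap_less H G"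
proof -
  have n: "form_size ts = n" using built_card[OF G(2)] by simp
  obtain w F where "built us w {0..<0 + form_size us} F" using built_exists by blast
  then have F: "built us w {..<n} F" using us(1) n by (simp add: lessThan_atLeast0)
  let ?H = "\<lparr>pverts = {..<n}, parcs = F\<rparr>"
  have H: "?H \<in> unicyclic_graphs n l 4" using F us(2-4) by (rule built_in_unicyclic_graphs)
  have F': "built us w {..<n} (parcs ?H)" using F by simp
  have le: "coeff (form_poly us) i \<le> coeff (form_poly ts) i" for i
    using pos by (simp add: pos_poly_def nonneg_poly_def)
  have "form_poly us \<noteq> form_poly ts" using pos by (auto simp: pos_poly_def)
  then obtain i where i: "coeff (form_poly us) i \<noteq> coeff (form_poly ts) i"
    by (meson poly_eqI)
  have "i \<le> n"
  proof (rule ccontr)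
    assume "\<not> i \<le> n"
    then show False using i degree_form_poly[OF F] degree_form_poly[OF G(2)] by (simp add: coeff_eq_0)
  qed
  then have "lap_less ?H G"
    unfolding lap_le_built(2)[OF H F' G] lap_le_built(1)[OF H F' G] using le i by (metis order_le_imp_less_or_eq)
  then show ?thesis using H by blast
qed

subsection \<open>Minimal graphs are spiders\<close>

text \<open>A square carries branches only at the vertex through which it is attached, as is the
  case once all trees have been merged at one corner.\<close>

primrec simple :: "branch \<Rightarrow> bool" where
  "simple (Br us) \<longleftrightarrow> list_all id (map simple us)"
| "simple (Cy xs ys zs) \<longleftrightarrow> xs = [] \<and> ys = [] \<and> zs = []"

lemma simple_Br [simp]: "simple (Br us) \<longleftrightarrow> list_all simple us"
  by (simp add: list.pred_map comp_def)

declare simple.simps(1) [simp del]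

lemma acyclic_simple: "form_cycles ts = 0 \<Longrightarrow> list_all simple ts"
  by (induction ts rule: form_induct) auto

definition shape :: "'a set \<Rightarrow> 'a rel \<Rightarrow> branch list \<Rightarrow> bool" where
  "shape S E ts \<longleftrightarrow> (\<exists>r. built ts r S E) \<and> form_cycles ts = 1 \<and> list_all simple ts"

lemma shape_mset:
  assumes "shape S E xs" "mset xs = mset ys"
  shows "shape S E ys"
proof -
  have "form_cycles xs = form_cycles ys" using arg_cong[OF assms(2), of "\<lambda>m. sum_mset (image_mset cyc m)"]
    by (simp flip: mset_map sum_mset_sum_list)
  moreover have "set xs = set ys" using assms(2) by (rule mset_eq_setD)
  ultimately show ?thesis using assms built_mset[OF _ assms(2)] unfolding shape_def list_all_iff by metis
qed

lemma shape_reroot: "shape S E (Br us # ts) \<Longrightarrow> shape S E (Br ts # us)"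
  unfolding shape_def using built_reroot by fastforce

definition chain :: "branch \<Rightarrow> bool" where
  "chain W \<longleftrightarrow> (\<exists>b. W = Br (ray b)) \<or> (\<exists>q. W = cycle_ray q)"

lemma cyc_chain [simp]: "form_cycles (ray b) = 0" "cyc (cycle_ray q) = 1"
  by (induction b, simp_all, induction q, simp_all)

lemma leaves_chain [simp]: "form_leaves (ray (Suc b)) = 1" "branch_leaves (cycle_ray q) = 0"
  by (induction b, simp_all, induction q, simp_all)

lemma branch_leaves_ray [simp]: "branch_leaves (Br (ray b)) = 1"
  using leaves_chain(1)[of b] by simp

lemma size_chain [simp]: "sum_list (map branch_size (ray b)) = b" "branch_size (cycle_ray q) = q + 3"
  by (induction b, simp_all, induction q, simp_all)

lemma ray_inject [simp]: "ray b = ray c \<longleftrightarrow> b = c"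
  by (metis size_chain(1))

lemma simple_chain [simp]: "list_all simple (ray b)" "simple (cycle_ray q)"
  by (induction b, simp_all, induction q, simp_all)

text \<open>
  A branch that is neither a path nor a path to the square contains a deepest branching vertex, from
  which a path with \<open>c + 1\<close> vertices hangs; rerooting there exposes it.
\<close>

lemma shape_descent:
  assumes "shape S E (W # os)" "\<not> chain W"
  shows "\<exists>ws d c L. W = Br ws \<and> leaf_depth ws d \<and> c < d \<and> shape S E (Br (ray c) # L) \<and> 2 \<le> length L"
  using assms
proof (induction W arbitrary: os)
  case (Cy xs ys zs)
  then have "Cy xs ys zs = cycle_ray 0" by (simp add: shape_def)
  then show ?case using Cy.prems(2) unfolding chain_def by blast
next
  case (Br ws)
  have rr: "shape S E (Br os # ws)" using Br.prems(1) by (rule shape_reroot)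
  show ?case
  proof (cases "\<exists>W\<in>set ws. \<not> chain W")
    case True
    then obtain W where W: "W \<in> set ws" "\<not> chain W" by blast
    then obtain l1 l2 where l: "ws = l1 @ W # l2" by (meson split_list)
    have "shape S E (W # (Br os # l1 @ l2))" using rr by (rule shape_mset) (simp add: l)
    from Br.IH[OF W(1) this W(2)]
    obtain us d c L where h: "W = Br us" "leaf_depth us d" "c < d" "shape S E (Br (ray c) # L)" "2 \<le> length L"
      by blast
    have "leaf_depth ws (Suc d)" using leaf_depth_Br[OF h(2)] W(1) h(1) by blast
    then show ?thesis using h(3-5) less_SucI by blast
  next
    case False
    have cy: "form_cycles ws \<le> 1" using rr by (simp add: shape_def)
    have "2 \<le> length ws"
    proof (rule ccontr)
      assume "\<not> 2 \<le> length ws"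
      then consider "ws = []" | W where "ws = [W]" by (cases ws; cases "tl ws") auto
      then have "chain (Br ws)"
      proof cases
        case 1
        then have "Br ws = Br (ray 0)" by simp
        then show ?thesis unfolding chain_def by blast
      next
        case 2
        then have "chain W" using False by simp
        then have "(\<exists>b. Br ws = Br (ray (Suc b))) \<or> (\<exists>q. Br ws = cycle_ray (Suc q))" using 2 by (auto simp: chain_def)
        then show ?thesis unfolding chain_def by blast
      qed
      then show False using Br.prems(2) by blast
    qed
    then obtain x y zs where ws: "ws = x # y # zs" by (cases ws; cases "tl ws") auto
    have "chain x" "chain y" using False ws by auto
    \<comment> \<open>At most one of the two branches \<open>x\<close> and \<open>y\<close> contains
      the square, so the other is a pendant path.\<close>
    then obtain c where c: "Br (ray c) \<in> set ws"
      using cy ws by (auto simp: chain_def)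
    then obtain l1 l2 where l: "ws = l1 @ Br (ray c) # l2" by (meson split_list)
    have "shape S E (Br (ray c) # (Br os # l1 @ l2))" using rr by (rule shape_mset) (simp add: l)
    moreover have "2 \<le> length (Br os # l1 @ l2)" using \<open>2 \<le> length ws\<close> l by simp
    moreover have "leaf_depth ws (Suc c)" using leaf_depth_Br[OF leaf_depth_ray c] .
    ultimately show ?thesis by blast
  qed
qed

text \<open>If \<open>ws\<close> were empty, the leaf \<open>w\<close> would be lost; if
  \<open>os\<close> were empty, nothing would move. The pendant path has \<open>b + 1\<close>
  vertices, hence \<open>Suc b\<close> in the gain.\<close>

lemma shape_slide:
  assumes G: "G \<in> unicyclic_graphs n l 4" and s: "shape {..<n} (parcs G) (Br (ray b) # Br ws # os)"
    and os: "os \<noteq> []" and ws: "ws \<noteq> []" and pos: "pos_poly (slide_gain ws (Suc b))"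
  shows "\<exists>H\<in>unicyclic_graphs n l 4. lap_less H G"
proof -
  let ?ts = "ray (Suc b) @ Br ws # os" and ?us = "ray (Suc (Suc b)) @ ws @ os"
  have rd: "root_deg (xs @ ys) = root_deg xs + root_deg ys" for xs ys by (induction xs) auto
  have rp: "0 < root_deg xs" if "xs \<noteq> []" for xs using that root_deg_eq_0[of xs] by linarith
  obtain r where r: "built ?ts r {..<n} (parcs G)" using s by (auto simp: shape_def)
  have "root_deg ?ts \<noteq> 1" using rp[OF os] by simp
  then have lv: "form_leaves ?ts = l" using leaves_built[OF _ r] G by (simp add: unicyclic_graphs_def)
  show ?thesis
  proof (rule smaller_graph[OF G r])
    show "form_size ?us = form_size ?ts" by (simp add: form_size_def)
    show "form_cycles ?us = 1" using s by (simp add: shape_def)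
    show "root_deg ?us \<noteq> 1" using rp[OF os] rp[OF ws] rd os ws by simp
    show "form_leaves ?us = l" using lv ws by (simp del: ray.simps add: leaves_chain)
    show "pos_poly (form_poly ?ts - form_poly ?us)"
      unfolding form_poly_slide using pos os by (simp add: pos_poly_mult root_link_pos)
  qed
qed

lemma minimal_single_branching:
  assumes G: "G \<in> unicyclic_graphs n l 4" and min: "\<not> (\<exists>H\<in>unicyclic_graphs n l 4. lap_less H G)"
  shows "\<exists>ts. shape {..<n} (parcs G) (cycle_ray 0 # ts) \<and> form_cycles ts = 0"
proof -
  have u: "unic {..<n} (parcs G)"
    using unicI[of G] G by (simp add: unicyclic_graphs_def)
  define C where "C xs ys zs ts \<longleftrightarrow> (\<exists>r. built (Cy xs ys zs # ts) r {..<n} (parcs G)) \<and>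
    form_cycles xs = 0 \<and> form_cycles ys = 0 \<and> form_cycles zs = 0 \<and> form_cycles ts = 0" for xs ys zs ts
  have rot: "C ys zs ts xs" if "C xs ys zs ts" for xs ys zs ts
    using that built_rotate[of xs ys zs ts _ "{..<n}" "parcs G"] unfolding C_def by metis
  have lv: "form_leaves (Cy xs ys zs # ts) = l" if "built (Cy xs ys zs # ts) r {..<n} (parcs G)" for xs ys zs ts r
  proof -
    have "root_deg (Cy xs ys zs # ts) \<noteq> 1" by simp
    then show ?thesis using leaves_built[OF _ that] G by (simp add: unicyclic_graphs_def)
  qed
  have opp: "ys = [] \<or> ts = []" if c: "C xs ys zs ts" for xs ys zs ts
  proof (rule ccontr)
    assume ne: "\<not> (ys = [] \<or> ts = [])"
    obtain r where r: "built (Cy xs ys zs # ts) r {..<n} (parcs G)" using c by (auto simp: C_def)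
    have "\<exists>H\<in>unicyclic_graphs n l 4. lap_less H G"
    proof (rule smaller_graph[OF G r])
      show "form_size (Cy xs [] zs # ys @ ts) = form_size (Cy xs ys zs # ts)" by (simp add: form_size_def)
      show "form_cycles (Cy xs [] zs # ys @ ts) = 1" using c unfolding C_def by simp
      show "root_deg (Cy xs [] zs # ys @ ts) \<noteq> 1" by simp
      show "form_leaves (Cy xs [] zs # ys @ ts) = l" using lv[OF r] by simp
      show "pos_poly (form_poly (Cy xs ys zs # ts) - form_poly (Cy xs [] zs # ys @ ts))"
        unfolding form_poly_merge_opposite using ne by (simp add: pos_poly_mult root_link_pos cycle_diag_def pos_poly_linear root_minor_pos root_link_nonneg_poly)
    qed
    then show False using min by blast
  qed
  obtain xs ys zs ts where c0: "C xs ys zs ts" using unic_built[OF u] unfolding C_def by blast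
  note c1 = rot[OF c0] and c2 = rot[OF rot[OF c0]] and c3 = rot[OF rot[OF rot[OF c0]]]
  \<comment> \<open>Each pair of opposite corners has an empty member, so two neighbouring corners
    are empty and a rotation puts them in the middle.\<close>
  have "\<exists>xs ts. C xs [] [] ts"
    using c0 c1 c2 c3 opp[OF c0] opp[OF c1] by metis
  then obtain xs ts where c: "C xs [] [] ts" by blast
  have "\<exists>ts. C [] [] [] ts"
  proof (cases "xs = [] \<or> ts = []")
    case True
    then show ?thesis using c rot[OF c] by metis
  next
    case False
    obtain r where r: "built (Cy xs [] [] # ts) r {..<n} (parcs G)" using c by (auto simp: C_def)
    have k: "lam ^ 2 + 4 * lam + 3 = lam * lam + (4 * lam + 3)" by (simp add: power2_eq_square)
    have "\<exists>H\<in>unicyclic_graphs n l 4. lap_less H G"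
    proof (rule smaller_graph[OF G r])
      show "form_size (Cy [] [] [] # xs @ ts) = form_size (Cy xs [] [] # ts)" by (simp add: form_size_def)
      show "form_cycles (Cy [] [] [] # xs @ ts) = 1" using c unfolding C_def by simp
      show "root_deg (Cy [] [] [] # xs @ ts) \<noteq> 1" by simp
      show "form_leaves (Cy [] [] [] # xs @ ts) = l" using lv[OF r] by simp
      show "pos_poly (form_poly (Cy xs [] [] # ts) - form_poly (Cy [] [] [] # xs @ ts))"
        unfolding form_poly_merge_adjacent k using False
        by (intro pos_poly_mult pos_poly_add_nonneg_poly pos_poly_nonneg_poly root_link_pos) (simp_all add: pos_poly_mult pos_poly_add_nonneg_poly pos_poly_nonneg_poly)
    qed
    then show ?thesis using min by blast
  qed
  then obtain ts where t: "C [] [] [] ts" by blast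
  then have "shape {..<n} (parcs G) (cycle_ray 0 # ts)" "form_cycles ts = 0"
    unfolding C_def shape_def by (auto simp: acyclic_simple)
  then show ?thesis by blast
qed

definition spider :: "nat \<Rightarrow> nat list \<Rightarrow> branch list" where
  "spider q bs = cycle_ray q # map (\<lambda>b. Br (ray b)) bs"

lemma minimal_spider:
  assumes G: "G \<in> unicyclic_graphs n l 4" and min: "\<not> (\<exists>H\<in>unicyclic_graphs n l 4. lap_less H G)"
    and l: "2 \<le> l"
  shows "\<exists>q b bs. shape {..<n} (parcs G) (spider q (b # bs)) \<and> set bs \<subseteq> {b, Suc b} \<and> length (b # bs) = l \<and>
    (q = 0 \<or> q + 2 \<le> b)"
proof -
  let ?S = "shape {..<n} (parcs G)"
  have lv: "form_leaves ts = l" if "?S ts" "root_deg ts \<noteq> 1" for ts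
    using that leaves_built[of G "{..<n}" ts] G by (auto simp: unicyclic_graphs_def shape_def)
  \<comment> \<open>Some vertex carries a pendant path with \<open>b + 1\<close> vertices and at
    least two further branches, the square counting as one.\<close>
  define R where "R b \<longleftrightarrow> (\<exists>L. ?S (Br (ray b) # L) \<and> 2 \<le> length L)" for b
  obtain ts where ts: "?S (cycle_ray 0 # ts)" "form_cycles ts = 0" using minimal_single_branching[OF G min] by blast
  have "\<exists>b. R b"
  proof (cases "\<exists>W\<in>set ts. \<not> chain W")
    case True
    then obtain W where W: "W \<in> set ts" "\<not> chain W" by blast
    then obtain l1 l2 where k: "ts = l1 @ W # l2" by (meson split_list)
    have "?S (W # (cycle_ray 0 # l1 @ l2))" using ts(1) by (rule shape_mset) (simp add: k)
    from shape_descent[OF this W(2)] show ?thesis unfolding R_def by blast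
  next
    case False
    have p: "\<exists>b. t = Br (ray b)" if "t \<in> set ts" for t
    proof -
      have "cyc t = 0" using ts(2) that by simp
      moreover have "chain t" using False that by blast
      ultimately show ?thesis unfolding chain_def using cyc_chain(2) by force
    qed
    have "form_leaves ts = length ts"
    proof -
      have "map branch_leaves ts = map (\<lambda>_. 1) ts"
        using p branch_leaves_ray by (intro map_cong refl) metis
      then show ?thesis by (simp only: sum_list_triv) simp
    qed
    moreover have "form_leaves ts = l" using lv[OF ts(1)] by simp
    \<comment> \<open>Since the square is a single entry of the form, its corner needs two pendant
      paths to satisfy \<open>R\<close>; \<open>2 \<le> l\<close> provides them.\<close>
    ultimately obtain x y zs where ts': "ts = x # y # zs" using l by (cases ts; cases "tl ts") auto
    obtain b where b: "x = Br (ray b)" using p[of x] ts' by auto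
    have "?S (Br (ray b) # (cycle_ray 0 # y # zs))" using ts(1) by (rule shape_mset) (simp add: ts' b)
    then show ?thesis unfolding R_def by (intro exI[of _ b] exI[of _ "cycle_ray 0 # y # zs"]) simp
  qed
  \<comment> \<open>The minimum is taken over all branching vertices of the graph, so every pendant
    path exposed later by rerooting is at least as long.\<close>
  define b where "b = (LEAST b. R b)"
  have Rb: "R b" unfolding b_def using \<open>\<exists>b. R b\<close> by (rule LeastI_ex)
  have least: "b \<le> c" if "R c" for c unfolding b_def using that by (rule Least_le)
  obtain L where L: "?S (Br (ray b) # L)" "2 \<le> length L" using Rb by (auto simp: R_def)
  have split_off: "\<exists>os. ?S (Br (ray b) # W # os) \<and> os \<noteq> [] \<and> mset L = mset (W # os)" if W: "W \<in> set L" for W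
  proof -
    obtain l1 l2 where k: "L = l1 @ W # l2" using W by (meson split_list)
    have "?S (Br (ray b) # W # l1 @ l2)" using L(1) by (rule shape_mset) (simp add: k)
    moreover have "l1 @ l2 \<noteq> []" using L(2) k by auto
    ultimately show ?thesis using k by (intro exI[of _ "l1 @ l2"]) simp
  qed
  have slide: False if "Br ws \<in> set L" "ws \<noteq> []" "pos_poly (slide_gain ws (Suc b))" for ws
    using split_off[OF that(1)] shape_slide[OF G _ _ that(2,3)] min by blast
  \<comment> \<open>A branch that is no chain hides a branching vertex with a pendant path, which
    has at least \<open>b + 1\<close> vertices by the choice of \<open>b\<close>. The leaf at its
    end is deep enough for the slide into this branch to decrease the polynomial.\<close>
  have chains: "chain W" if W: "W \<in> set L" for W
  proof (rule ccontr)
    assume nc: "\<not> chain W"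
    obtain os where os: "?S (Br (ray b) # W # os)" using split_off[OF W] by blast
    then have "?S (W # Br (ray b) # os)" by (rule shape_mset) simp
    from shape_descent[OF this nc] obtain ws d c L' where
      h: "W = Br ws" "leaf_depth ws d" "c < d" "?S (Br (ray c) # L')" "2 \<le> length L'" by blast
    have "b \<le> c" using h(4,5) by (intro least) (auto simp: R_def)
    moreover have "ws \<noteq> ray (Suc b)" using nc h(1) unfolding chain_def by blast
    ultimately have "pos_poly (slide_gain ws (Suc b))" using h(3) by (intro slide_gain_pos[OF h(2)]) auto
    moreover have "ws \<noteq> []" using nc h(1) unfolding chain_def by (metis ray.simps(1))
    ultimately show False using slide W h(1) by blast
  qed
  have "form_cycles L = 1" using L(1) by (simp add: shape_def)
  then obtain W where W: "W \<in> set L" "cyc W \<noteq> 0"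
    by (metis (no_types, lifting) in_set_conv_nth length_map nth_map sum_list_eq_0_iff zero_neq_one)
  obtain q where q: "W = cycle_ray q" using chains[OF W(1)] W(2) by (auto simp: chain_def)
  obtain os where os: "?S (Br (ray b) # W # os)" "os \<noteq> []" "mset L = mset (W # os)" using split_off[OF W(1)] by blast
  have "form_cycles os = 0" using os(1) q by (simp add: shape_def)
  have sub: "set os \<subseteq> set L" using mset_eq_setD[OF os(3)] by auto
  have "\<forall>t\<in>set os. \<exists>b. t = Br (ray b)"
  proof
    fix t assume t: "t \<in> set os"
    then have "cyc t = 0" using \<open>form_cycles os = 0\<close> by simp
    moreover have "chain t" using chains sub t by blast
    ultimately show "\<exists>b. t = Br (ray b)" unfolding chain_def using cyc_chain(2) by force
  qed
  then obtain bs where bs: "os = map (\<lambda>b. Br (ray b)) bs"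
    by (metis (mono_tags, lifting) ex_map_conv)
  have sp: "?S (spider q (b # bs))"
    using os(1) by (rule shape_mset) (simp add: spider_def q bs)
  have "set bs \<subseteq> {b, Suc b}"
  proof
    fix c assume c: "c \<in> set bs"
    have inL: "Br (ray c) \<in> set L" using sub c bs by auto
    obtain l1 l2 where k: "bs = l1 @ c # l2" using c by (meson split_list)
    have "?S (Br (ray c) # (cycle_ray q # Br (ray b) # map (\<lambda>b. Br (ray b)) (l1 @ l2)))"
      using sp by (rule shape_mset) (simp add: spider_def k)
    then have "R c" unfolding R_def by (rule_tac exI) auto
    then have "b \<le> c" by (rule least)
    moreover have "\<not> Suc (Suc b) \<le> c"
    proof
      assume a: "Suc (Suc b) \<le> c"
      then have ne: "ray c \<noteq> ray (Suc b)" unfolding ray_inject by simp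
      have "pos_poly (slide_gain (ray c) (Suc b))" by (rule slide_gain_pos[OF leaf_depth_ray _ ne]) (use a in simp)
      moreover have "ray c \<noteq> []" using a by (cases c) auto
      ultimately show False using slide inL by blast
    qed
    ultimately show "c \<in> {b, Suc b}" by auto
  qed
  moreover have "length (b # bs) = l"
  proof -
    have "root_deg (spider q (b # bs)) \<noteq> 1"
      using root_deg_eq_0[of "spider q (b # bs)"] by (auto simp: spider_def split: branch.splits)
    then have "form_leaves (spider q (b # bs)) = l" using lv[OF sp] by blast
    then show ?thesis by (simp add: spider_def comp_def sum_list_triv del: branch_leaves.simps)
  qed
  \<comment> \<open>The part \<open>[cycle_ray q']\<close> behind the first path vertex has
    \<open>q' + 3 = q + 2\<close> vertices, so the slide decreases as long as
    \<open>b + 1 \<le> q + 2\<close>.\<close>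
  moreover have "q = 0 \<or> q + 2 \<le> b"
  proof (rule ccontr)
    assume a: "\<not> (q = 0 \<or> q + 2 \<le> b)"
    then obtain q' where q': "q = Suc q'" by (cases q) auto
    have "pos_poly (slide_gain [cycle_ray q'] (Suc b))" using a q' by (intro slide_gain_cycle_ray_pos) auto
    moreover have "Br [cycle_ray q'] \<in> set L" using W(1) q q' by simp
    ultimately show False using slide by blast
  qed
  ultimately show ?thesis using sp by blast
qed

subsection \<open>Spiders are incomparable\<close>

lemma form_poly_mset:
  assumes "mset xs = mset ys"
  shows "form_poly xs = form_poly ys"
proof -
  have "root_minor xs = root_minor ys \<and> root_link xs = root_link ys"
    using assms
  proof (induction xs arbitrary: ys)
    case (Cons x xs)
    then have "x \<in> set ys" by (metis list.set_intros(1) mset_eq_setD)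
    then obtain l1 l2 where ys: "ys = l1 @ x # l2" by (meson split_list)
    then have "mset xs = mset (l1 @ l2)" using Cons.prems by simp
    from Cons.IH[OF this] show ?case
      by (simp add: ys root_minor_Cons root_link_Cons root_minor_append root_link_append algebra_simps)
  qed simp
  then show ?thesis by (simp add: form_poly_def)
qed

text \<open>The value \<open>c\<close> may be 0, so that sums and products can be handled without
  knowing whether leading terms cancel.\<close>

definition top_coeff :: "int poly \<Rightarrow> nat \<Rightarrow> int \<Rightarrow> bool" where
  "top_coeff p d c \<longleftrightarrow> degree p \<le> d \<and> coeff p d = c"

lemma top_coeff_add: "top_coeff p d a \<Longrightarrow> top_coeff q d b \<Longrightarrow> top_coeff (p + q) d (a + b)"
  by (simp add: top_coeff_def degree_add_le)

lemma top_coeff_diff: "top_coeff p d a \<Longrightarrow> top_coeff q d b \<Longrightarrow> top_coeff (p - q) d (a - b)"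
  by (simp add: top_coeff_def degree_diff_le)

lemma top_coeff_higher: "top_coeff p d a \<Longrightarrow> d < e \<Longrightarrow> top_coeff p e 0"
  by (auto simp: top_coeff_def coeff_eq_0)

lemma top_coeff_mult:
  assumes "top_coeff p d a" "top_coeff q e b"
  shows "top_coeff (p * q) (d + e) (a * b)"
proof -
  have deg: "degree p \<le> d" "degree q \<le> e" and c: "coeff p d = a" "coeff q e = b"
    using assms by (simp_all add: top_coeff_def)
  have le: "degree (p * q) \<le> degree p + degree q" by (rule degree_mult_le)
  have "coeff (p * q) (d + e) = a * b"
  proof (cases "degree p = d \<and> degree q = e")
    case True
    then show ?thesis using coeff_mult_degree_sum[of p q] c by auto
  next
    case False
    then have "degree p < d \<or> degree q < e" using deg by auto
    then have "a * b = 0" using c by (auto simp: coeff_eq_0)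
    moreover have "degree (p * q) < d + e" using le deg False by linarith
    ultimately show ?thesis by (simp add: coeff_eq_0)
  qed
  then show ?thesis using le deg by (simp add: top_coeff_def)
qed

lemma top_coeff_lam: "top_coeff (lam + 1) 1 1" "top_coeff (lam + 2) 1 1" "top_coeff lam 1 1"
    "top_coeff (6 * lam + 2 * lam ^ 2) 2 2" "top_coeff (lam ^ 2 + 4 * lam + 2) 2 1"
  by (simp_all add: top_coeff_def lam_def one_pCons numeral_poly power2_eq_square numeral_2_eq_2)

lemma coeff_mult_low:
  "coeff (p * q) 0 = coeff p 0 * coeff q 0"
  "coeff (p * q) (Suc 0) = coeff p 0 * coeff q (Suc 0) + coeff p (Suc 0) * coeff q 0"
  for p q :: "int poly"
  by (simp_all add: coeff_mult)

lemma coeff_numeral_0: "coeff (numeral w :: int poly) 0 = numeral w"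
  by (simp add: numeral_poly)

lemma coeff_lam [simp]: "coeff lam 0 = 0" "coeff lam (Suc 0) = 1"
  by (simp_all add: lam_def)

lemma top_coeff_ray: "top_coeff (root_minor (ray b)) b 1 \<and> top_coeff (root_link (ray b)) b (if b = 0 then 0 else 1)"
proof (induction b)
  case 0
  then show ?case by (simp add: top_coeff_def)
next
  case (Suc b)
  then have P: "top_coeff (root_minor (ray b)) b 1" and S: "top_coeff (root_link (ray b)) (Suc b) 0" by (auto intro: top_coeff_higher)
  have "top_coeff (root_minor (ray (Suc b))) (Suc b) 1" "top_coeff (root_link (ray (Suc b))) (Suc b) 1"
    unfolding root_minor_ray_Suc root_link_ray_Suc
    using top_coeff_add[OF top_coeff_mult[OF top_coeff_lam(1) P], of _ 0] top_coeff_add[OF top_coeff_mult[OF top_coeff_lam(3) P], of _ 0] S by simp_all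
  then show ?case by simp
qed

lemma low_ray: "coeff (root_minor (ray b)) 0 = 1 \<and> coeff (root_link (ray b)) 0 = 0 \<and> coeff (root_link (ray b)) (Suc 0) = int b"
proof (induction b)
  case (Suc b)
  then show ?case unfolding root_minor_ray_Suc root_link_ray_Suc by (simp add: coeff_mult_low)
qed simp

definition legs :: "nat list \<Rightarrow> branch list" where
  "legs bs = map (\<lambda>b. Br (ray b)) bs"

lemma legs_simps [simp]: "legs [] = []" "legs (b # bs) = Br (ray b) # legs bs"
  by (simp_all add: legs_def)

lemma spider_legs: "spider q bs = cycle_ray q # legs bs"
  by (simp add: spider_def legs_def)

lemma root_minor_legs_Cons: "root_minor (legs (b # bs)) = root_minor (ray (Suc b)) * root_minor (legs bs)"
  and root_link_legs_Cons: "root_link (legs (b # bs)) = root_link (ray (Suc b)) * root_minor (legs bs) + root_minor (ray (Suc b)) * root_link (legs bs)"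
  by (simp_all add: root_minor_Cons root_link_Cons branch_minor_Br branch_link_Br)

lemma top_coeff_legs: "top_coeff (root_minor (legs bs)) (sum_list bs + length bs) 1 \<and>
    top_coeff (root_link (legs bs)) (sum_list bs + length bs) (int (length bs))"
proof (induction bs)
  case (Cons b bs)
  have e: "sum_list (b # bs) + length (b # bs) = Suc b + (sum_list bs + length bs)" by simp
  have P: "top_coeff (root_minor (ray (Suc b))) (Suc b) 1" and S: "top_coeff (root_link (ray (Suc b))) (Suc b) 1"
    using top_coeff_ray[of "Suc b"] by simp_all
  show ?case
    unfolding root_minor_legs_Cons root_link_legs_Cons e
    using top_coeff_mult[OF P conjunct1[OF Cons.IH]]
      top_coeff_add[OF top_coeff_mult[OF S conjunct1[OF Cons.IH]] top_coeff_mult[OF P conjunct2[OF Cons.IH]]]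
    by (simp add: add.commute)
qed (simp add: top_coeff_def)

lemma low_legs: "coeff (root_minor (legs bs)) 0 = 1 \<and> coeff (root_link (legs bs)) 0 = 0 \<and>
    coeff (root_link (legs bs)) (Suc 0) = int (sum_list bs + length bs)"
proof (induction bs)
  case (Cons b bs)
  then show ?case
    unfolding root_minor_legs_Cons root_link_legs_Cons using low_ray[of "Suc b"] by (simp add: coeff_mult_low del: ray.simps)
qed simp

lemma slide_gain_cycle_ray_shift: "slide_gain [cycle_ray q] (q + t) = slide_gain [cycle_ray 0] t"
  by (induction q) (simp_all del: cycle_ray.simps)

text \<open>The linear coefficient is 4 * (3 - t): the square has four spanning trees, and its three
  vertices besides the root are compared with the \<open>t\<close> vertices of the path.\<close>

lemma slide_gain_cycle_ray_coeffs:
  assumes "0 < t"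
  shows "coeff (slide_gain [cycle_ray 0] t) 0 = 0" "coeff (slide_gain [cycle_ray 0] t) (Suc 0) = 12 - 4 * int t"
    and "top_coeff (slide_gain [cycle_ray 0] t) (t + 3) 1"
proof -
  show "coeff (slide_gain [cycle_ray 0] t) 0 = 0" "coeff (slide_gain [cycle_ray 0] t) (Suc 0) = 12 - 4 * int t"
    unfolding slide_gain_cycle_ray_0 using low_ray[of t]
    by (simp_all add: coeff_mult_low power2_eq_square coeff_numeral_0)
  have P: "top_coeff (root_minor (ray t)) t 1" and S: "top_coeff (root_link (ray t)) t 1" using top_coeff_ray[of t] assms by simp_all
  have "top_coeff (slide_gain [cycle_ray 0] t) (1 + (2 + t)) (1 * (2 * 1 - 1 * 1))"
    unfolding slide_gain_cycle_ray_0 by (intro top_coeff_mult top_coeff_diff top_coeff_lam P S)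
  moreover have "1 + (2 + t) = t + 3" "1 * (2 * 1 - 1 * 1) = (1::int)" by simp_all
  ultimately show "top_coeff (slide_gain [cycle_ray 0] t) (t + 3) 1" by (simp only:)
qed

text \<open>Sliding \<open>rest\<close> along the first edge towards the square turns the first
  spider into the second: the path loses a vertex and the leg gains it. From \<open>t = 4\<close> on
  the linear coefficient of the gain is negative.\<close>

lemma spider_step:
  assumes t: "Suc b = q + t" "4 \<le> t" and rest: "rest \<noteq> []"
  defines "D \<equiv> form_poly (spider (Suc q) (b # rest)) - form_poly (spider q (Suc b # rest))"
  shows "coeff D 2 < 0" and "top_coeff D (sum_list rest + length rest + t + 3) (int (length rest))"
proof -
  have "form_poly (spider (Suc q) (b # rest)) = form_poly (ray (Suc b) @ Br [cycle_ray q] # legs rest)"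
    by (rule form_poly_mset) (simp add: spider_legs)
  moreover have "form_poly (spider q (Suc b # rest)) = form_poly (ray (Suc (Suc b)) @ [cycle_ray q] @ legs rest)"
    by (rule form_poly_mset) (simp add: spider_legs)
  ultimately have "D = root_link (legs rest) * slide_gain [cycle_ray q] (Suc b)"
    unfolding D_def by (simp only: form_poly_slide)
  then have D: "D = root_link (legs rest) * slide_gain [cycle_ray 0] t" by (simp only: t(1) slide_gain_cycle_ray_shift)
  have t0: "0 < t" using t(2) by simp
  have "coeff D 2 = coeff (root_link (legs rest)) (Suc 0) * coeff (slide_gain [cycle_ray 0] t) (Suc 0)"
    unfolding D using low_legs[of rest] slide_gain_cycle_ray_coeffs(1)[OF t0]
    by (simp add: coeff_mult numeral_2_eq_2)
  also have "\<dots> = int (sum_list rest + length rest) * (12 - 4 * int t)"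
    using low_legs[of rest] slide_gain_cycle_ray_coeffs(2)[OF t0] by simp
  also have "\<dots> < 0" using rest t(2) by (intro mult_pos_neg) (cases rest, auto)
  finally show "coeff D 2 < 0" .
  show "top_coeff D (sum_list rest + length rest + t + 3) (int (length rest))"
    unfolding D using top_coeff_mult[OF conjunct2[OF top_coeff_legs[of rest]] slide_gain_cycle_ray_coeffs(3)[OF t0]]
    by (simp add: add.assoc)
qed

lemma form_size_spider: "form_size (spider q bs) = q + 4 + sum_list bs + length bs"
proof -
  have "sum_list (map branch_size (legs bs)) = sum_list bs + length bs"
    by (induction bs) simp_all
  then show ?thesis by (simp add: form_size_def spider_legs)
qed

section \<open>Balanced leg lengths\<close>

definition balanced :: "nat list \<Rightarrow> bool" where
  "balanced bs \<longleftrightarrow> (\<exists>f. set bs \<subseteq> {f, Suc f})"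

lemma two_valued_mset:
  assumes "set xs \<subseteq> {f, Suc f}"
  shows "\<exists>c\<le>length xs. mset xs = replicate_mset (length xs - c) f + replicate_mset c (Suc f) \<and>
    sum_list xs = f * length xs + c"
  using assms
proof (induction xs)
  case (Cons x xs)
  then obtain c where c: "c \<le> length xs" "mset xs = replicate_mset (length xs - c) f + replicate_mset c (Suc f)"
    "sum_list xs = f * length xs + c" by auto
  show ?case
  proof (cases "x = f")
    case True
    then show ?thesis using c by (intro exI[of _ c]) (simp add: Suc_diff_le)
  next
    case False
    then have "x = Suc f" using Cons.prems by simp
    then show ?thesis using c by (intro exI[of _ "Suc c"]) simp
  qed
qed simp

text \<open>Division of the sum by the length determines quotient and remainder, that is, the
  smaller value and the number of larger entries; a constant list merely fits two choices of
  \<open>f\<close>.\<close>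

lemma balanced_unique:
  assumes "balanced xs" "balanced ys" "length xs = length ys" "sum_list xs = sum_list ys"
  shows "mset xs = mset ys"
proof -
  have wlog: "mset xs = mset ys"
    if f: "set xs \<subseteq> {f, Suc f}" and g: "set ys \<subseteq> {g, Suc g}" and fg: "f \<le> g"
      and eq: "length xs = length ys" "sum_list xs = sum_list ys" for xs ys f g
  proof -
    obtain c where c: "c \<le> length xs" "mset xs = replicate_mset (length xs - c) f + replicate_mset c (Suc f)"
      "sum_list xs = f * length xs + c" using two_valued_mset[OF f] by blast
    obtain d where d: "d \<le> length ys" "mset ys = replicate_mset (length ys - d) g + replicate_mset d (Suc g)"
      "sum_list ys = g * length ys + d" using two_valued_mset[OF g] by blast
    show ?thesis
    proof (cases "f = g \<or> xs = []")
      case True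
      then show ?thesis using c d eq by auto
    next
      case False
      then have len: "0 < length xs" and lt: "f < g" using fg by auto
      obtain k where k: "g = Suc f + k" using lt less_iff_Suc_add by auto
      \<comment> \<open>The ambiguous case: all entries of \<open>xs\<close> equal
        \<open>Suc f\<close>, all entries of \<open>ys\<close> equal \<open>g\<close>, and
        \<open>g = Suc f\<close>.\<close>
      have "c = length xs + k * length xs + d" using c(3) d(3) eq k by (simp add: algebra_simps)
      then have "c = length xs" "k * length xs = 0" "d = 0" using c(1) by linarith+
      then show ?thesis using c(2) d(2) eq(1) k len by simp
    qed
  qed
  obtain f g where "set xs \<subseteq> {f, Suc f}" "set ys \<subseteq> {g, Suc g}"
    using assms(1,2) by (auto simp: balanced_def)
  then show ?thesis using wlog[of xs f ys g] wlog[of ys g xs f] assms(3,4) by (cases "f \<le> g") auto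
qed

text \<open>Lengthening a shortest leg of \<open>cs\<close> keeps the legs balanced and thus yields
  \<open>bs\<close>, so the two spiders differ by one \<open>spider_step\<close>. The bound on
  \<open>n\<close> makes that leg long enough for \<open>4 \<le> t\<close>.\<close>

lemma spider_consecutive:
  assumes l: "2 \<le> l" and n: "4 + 3 * l + Suc q * (l + 1) \<le> n"
    and bs: "balanced bs" "length bs = l" "form_size (spider q bs) = n"
    and cs: "balanced cs" "length cs = l" "form_size (spider (Suc q) cs) = n"
  defines "D \<equiv> form_poly (spider (Suc q) cs) - form_poly (spider q bs)"
  shows "coeff D 2 < 0" and "top_coeff D (n - 2 - 2 * q) (int l - 1)"
proof -
  have sums: "q + 4 + sum_list bs + l = n" "Suc q + 4 + sum_list cs + l = n"
    using bs cs by (simp_all add: form_size_spider)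
  have ne: "cs \<noteq> []" using cs(2) l by auto
  define b where "b = Min (set cs)"
  have b: "b \<in> set cs" "\<And>c. c \<in> set cs \<Longrightarrow> b \<le> c" using ne by (simp_all add: b_def)
  obtain f where f: "set cs \<subseteq> {f, Suc f}" using cs(1) by (auto simp: balanced_def)
  have two: "set cs \<subseteq> {b, Suc b}"
  proof
    fix c assume c: "c \<in> set cs"
    then show "c \<in> {b, Suc b}" using b(2)[OF c] subsetD[OF f c] subsetD[OF f b(1)] by auto
  qed
  obtain l1 l2 where k: "cs = l1 @ b # l2" using b(1) by (meson split_list)
  define rest where "rest = l1 @ l2"
  have m: "mset cs = mset (b # rest)" by (simp add: k rest_def)
  have len: "length rest = l - 1" using cs(2) by (simp add: k rest_def)
  have sumr: "sum_list cs = b + sum_list rest" by (simp add: k rest_def)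
  have "set (Suc b # rest) \<subseteq> {b, Suc b}" using two by (auto simp: k rest_def)
  then have "balanced (Suc b # rest)" unfolding balanced_def by blast
  then have m2: "mset bs = mset (Suc b # rest)"
    by (rule balanced_unique[OF bs(1)]) (use bs(2) len l sums sumr in auto)
  have "sum_list rest \<le> (l - 1) * Suc b"
  proof -
    have "sum_list xs \<le> length xs * Suc b" if "set xs \<subseteq> {b, Suc b}" for xs
      using that by (induction xs) auto
    then show ?thesis using two len by (metis \<open>set (Suc b # rest) \<subseteq> {b, Suc b}\<close> dual_order.trans set_subset_Cons)
  qed
  \<comment> \<open>No entry exceeds \<open>Suc b\<close> and one equals \<open>b\<close>. This
    strictness is what improves \<open>q + 3\<close> to \<open>q + 4\<close> below.\<close>
  then have "sum_list cs < l * Suc b" using sumr l by (cases l) auto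
  then have "n < Suc q + 4 + l + l * Suc b" using sums(2) by linarith
  then have "3 * l + Suc q * (l + 1) < Suc q + l + l * Suc b" using n by linarith
  then have "l * (q + 3) < l * Suc b" by (simp add: algebra_simps)
  then have "q + 4 \<le> Suc b" by (simp del: mult_Suc_right)
  then obtain t where t: "Suc b = q + t" "4 \<le> t" using that[of "Suc b - q"] by simp
  have mm: "form_poly (spider (Suc q) cs) = form_poly (spider (Suc q) (b # rest))"
     "form_poly (spider q bs) = form_poly (spider q (Suc b # rest))"
    using m m2 by (auto intro!: form_poly_mset simp: spider_def)
  have r: "rest \<noteq> []" using len l by auto
  show "coeff D 2 < 0" unfolding D_def mm using spider_step(1)[OF t r] .
  have "sum_list rest + length rest + t + 3 = n - 2 - 2 * q"
    using sums(2) sumr len l t by linarith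
  then show "top_coeff D (n - 2 - 2 * q) (int l - 1)"
    unfolding D_def mm using spider_step(2)[OF t r] len l by (simp add: of_nat_diff)
qed

text \<open>Both inequalities are sums over consecutive steps. The step from \<open>j\<close> to
  \<open>Suc j\<close> has degree at most \<open>n - 2 - 2 * j\<close>, so the coefficient at
  \<open>n - 2 - 2 * q\<close> is raised by the step at \<open>q\<close> and untouched by all later
  ones.\<close>

lemma spiders_incomparable:
  assumes l: "2 \<le> l" and n: "4 + 3 * l + p * (l + 1) \<le> n"
    and bs: "\<And>q. q \<le> p \<Longrightarrow> balanced (bs q) \<and> length (bs q) = l \<and> form_size (spider q (bs q)) = n"
    and q: "q < q'" "q' \<le> p"
  defines "f \<equiv> \<lambda>q. form_poly (spider q (bs q))"
  shows "coeff (f q') 2 < coeff (f q) 2" and "coeff (f q) (n - 2 - 2 * q) < coeff (f q') (n - 2 - 2 * q)"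
proof -
  have down: "coeff (f (Suc j)) 2 < coeff (f j) 2" and diff: "top_coeff (f (Suc j) - f j) (n - 2 - 2 * j) (int l - 1)" if "Suc j \<le> p" for j
  proof -
    have "Suc j * (l + 1) \<le> p * (l + 1)" using that by (rule mult_le_mono1)
    then have "4 + 3 * l + Suc j * (l + 1) \<le> n" using n by linarith
    from spider_consecutive[OF l this, of "bs j" "bs (Suc j)"] bs[of j] bs[of "Suc j"] that
    show "coeff (f (Suc j)) 2 < coeff (f j) 2" "top_coeff (f (Suc j) - f j) (n - 2 - 2 * j) (int l - 1)"
      unfolding f_def by simp_all
  qed
  \<comment> \<open>This keeps the subtractions in \<open>n - 2 - 2 * j\<close> from truncating, so
    the degree bounds strictly decrease with \<open>j\<close>.\<close>
  have "p * 3 \<le> p * (l + 1)" using l by (intro mult_le_mono2) simp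
  then have np: "3 * p + 10 \<le> n" using n l by linarith
  have "Suc q \<le> q'" using q(1) by simp
  then have "q' \<le> p \<longrightarrow> coeff (f q') 2 < coeff (f q) 2 \<and> coeff (f q) (n - 2 - 2 * q) < coeff (f q') (n - 2 - 2 * q)"
  proof (induction rule: dec_induct)
    case base
    show ?case using down[of q] diff[of q] l by (auto simp: top_coeff_def)
  next
    case (step j)
    show ?case
    proof
      assume j: "Suc j \<le> p"
      have "n - 2 - 2 * j < n - 2 - 2 * q" using step.hyps j np by linarith
      then have "coeff (f (Suc j) - f j) (n - 2 - 2 * q) = 0"
        using diff[OF j] unfolding top_coeff_def by (intro coeff_eq_0) linarith
      then show "coeff (f (Suc j)) 2 < coeff (f q) 2 \<and> coeff (f q) (n - 2 - 2 * q) < coeff (f (Suc j)) (n - 2 - 2 * q)"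
        using step.IH down[OF j] j by simp
    qed
  qed
  then show "coeff (f q') 2 < coeff (f q) 2" "coeff (f q) (n - 2 - 2 * q) < coeff (f q') (n - 2 - 2 * q)"
    using q(2) by blast+
qed

subsection \<open>The graphs $U_{n,l}^{4,q}$ are spiders\<close>

lemma built_path:
  assumes "inj_on v {..k}"
  shows "built (ray k) (v 0) (v ` {..k}) ({(v i, v (Suc i)) |i. i < k} \<union> {(v i, v (Suc i)) |i. i < k}\<inverse>)"
  using assms
proof (induction k arbitrary: v)
  case 0
  have "{(v i, v (Suc i)) |i. i < (0::nat)} = {}" by simp
  then show ?case using built_Nil[of "v 0"] by simp
next
  case (Suc k)
  define w where "w i = v (Suc i)" for i
  have "inj_on w {..k}" using Suc.prems by (auto simp: w_def inj_on_def)
  note IH = Suc.IH[OF this]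
  have E: "{(v i, v (Suc i)) |i. i < Suc k} = insert (v 0, v (Suc 0)) {(w i, w (Suc i)) |i. i < k}"
    unfolding w_def setcompr_eq_image lessThan_def[symmetric] lessThan_Suc_eq_insert_0
    by (simp add: image_image)
  have V: "v ` {..Suc k} = insert (v 0) (w ` {..k})"
    unfolding w_def by (simp add: atMost_Suc_eq_insert_0 image_image)
  have "v 0 \<notin> w ` {..k}" using Suc.prems by (auto simp: w_def inj_on_def)
  then have "built [Br (ray k)] (v 0) (insert (v 0) (w ` {..k}))
     (insert (v 0, v (Suc 0)) {(w i, w (Suc i)) |i. i < k} \<union> (insert (v 0, v (Suc 0)) {(w i, w (Suc i)) |i. i < k})\<inverse>)"
    by (intro built_Br_eq[OF built_Nil IH]) (auto simp: w_def)
  then show ?case unfolding E V by simp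
qed

text \<open>The legs are the residue classes of \<open>j - 1\<close> modulo \<open>l\<close>,
  attached one class at a time. Leg \<open>i\<close> has \<open>(m - i) div l\<close> vertices after
  its first one; the list is reversed because each new leg goes to the front.\<close>

lemma built_star:
  assumes l: "1 \<le> l" "l \<le> m" and s: "s \<le> l"
  defines "par \<equiv> \<lambda>j. if j \<le> l then 0 else j - l"
  defines "V \<equiv> \<lambda>P. {j \<in> {1..m}. P ((j - 1) mod l)}"
  defines "es \<equiv> \<lambda>P. (\<lambda>j. (par j, j)) ` V P"
  shows "built (legs (map (\<lambda>i. (m - i) div l) (rev [1..<Suc s]))) 0 ({0} \<union> V (\<lambda>k. k < s))
    (es (\<lambda>k. k < s) \<union> (es (\<lambda>k. k < s))\<inverse>)"
  using s
proof (induction s)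
  case 0
  have "V (\<lambda>k. k < 0) = {}" by (simp add: V_def)
  then show ?case using built_Nil[of 0] by (simp add: es_def)
next
  case (Suc s)
  define K where "K = (m - Suc s) div l"
  define v where "v k = (if k = 0 then 0 else Suc s + (k - 1) * l)" for k
  have v0: "v 0 = 0" by (simp add: v_def)
  have vS: "v (Suc k) = Suc s + k * l" for k by (simp add: v_def)
  have bound: "k \<le> K \<longleftrightarrow> Suc s + k * l \<le> m" for k
  proof -
    have "k \<le> K \<longleftrightarrow> k * l \<le> m - Suc s" unfolding K_def using l by (simp add: less_eq_div_iff_mult_less_eq)
    then show ?thesis using Suc.prems l by linarith
  qed
  have cls: "V (\<lambda>k. k = s) = (\<lambda>k. v (Suc k)) ` {..K}"
  proof (intro equalityI subsetI)
    fix j assume "j \<in> V (\<lambda>k. k = s)"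
    then have j: "1 \<le> j" "j \<le> m" "(j - 1) mod l = s" by (auto simp: V_def)
    have "j - 1 = s + (j - 1) div l * l" using j(3) by (metis mod_div_mult_eq)
    then have e: "j = Suc s + (j - 1) div l * l" using j(1) by linarith
    then have "(j - 1) div l \<le> K" using bound j(2) by simp
    then show "j \<in> (\<lambda>k. v (Suc k)) ` {..K}" using e vS by auto
  next
    fix j assume "j \<in> (\<lambda>k. v (Suc k)) ` {..K}"
    then obtain k where k: "k \<le> K" "j = Suc s + k * l" using vS by auto
    then have "j \<le> m" using bound by simp
    moreover have "(j - 1) mod l = s" using k(2) Suc.prems by simp
    ultimately show "j \<in> V (\<lambda>k. k = s)" using k(2) by (simp add: V_def)
  qed
  have Vs: "v ` {..Suc K} = {0} \<union> V (\<lambda>k. k = s)"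
    unfolding cls atMost_Suc_eq_insert_0 image_insert image_image v0 by simp
  have par: "par (v (Suc k)) = v k" for k
    using Suc.prems by (cases k) (auto simp: par_def v_def)
  have Es: "{(v i, v (Suc i)) |i. i < Suc K} = es (\<lambda>k. k = s)"
    unfolding es_def cls setcompr_eq_image image_image par by (simp add: lessThan_def[symmetric] lessThan_Suc_atMost)
  have "inj_on v {..Suc K}"
    using l by (auto simp: inj_on_def v_def)
  from built_path[OF this] have 1: "built [Br (ray K)] 0 ({0} \<union> V (\<lambda>k. k = s)) (es (\<lambda>k. k = s) \<union> (es (\<lambda>k. k = s))\<inverse>)"
    unfolding Vs Es by (simp add: v_def)
  have 2: "built (legs (map (\<lambda>i. (m - i) div l) (rev [1..<Suc s]))) 0 ({0} \<union> V (\<lambda>k. k < s))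
    (es (\<lambda>k. k < s) \<union> (es (\<lambda>k. k < s))\<inverse>)" using Suc by simp
  have "({0} \<union> V (\<lambda>k. k = s)) \<inter> ({0} \<union> V (\<lambda>k. k < s)) = {0}" by (auto simp: V_def)
  from built_append[OF 1 2 this]
  have 3: "built (Br (ray K) # legs (map (\<lambda>i. (m - i) div l) (rev [1..<Suc s]))) 0
     (({0} \<union> V (\<lambda>k. k = s)) \<union> ({0} \<union> V (\<lambda>k. k < s)))
     ((es (\<lambda>k. k = s) \<union> (es (\<lambda>k. k = s))\<inverse>) \<union> (es (\<lambda>k. k < s) \<union> (es (\<lambda>k. k < s))\<inverse>))" by simp
  have V1: "V (\<lambda>k. k < Suc s) = V (\<lambda>k. k = s) \<union> V (\<lambda>k. k < s)" by (auto simp: V_def)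
  have e1: "es (\<lambda>k. k < Suc s) = es (\<lambda>k. k = s) \<union> es (\<lambda>k. k < s)" unfolding es_def V1 by (rule image_Un)
  have "legs (map (\<lambda>i. (m - i) div l) (rev [1..<Suc (Suc s)])) =
     Br (ray K) # legs (map (\<lambda>i. (m - i) div l) (rev [1..<Suc s]))" by (simp add: K_def)
  moreover have "({0} \<union> V (\<lambda>k. k = s)) \<union> ({0} \<union> V (\<lambda>k. k < s)) = {0} \<union> V (\<lambda>k. k < Suc s)"
    unfolding V1 by blast
  moreover have "(es (\<lambda>k. k = s) \<union> (es (\<lambda>k. k = s))\<inverse>) \<union> (es (\<lambda>k. k < s) \<union> (es (\<lambda>k. k < s))\<inverse>) =
     es (\<lambda>k. k < Suc s) \<union> (es (\<lambda>k. k < Suc s))\<inverse>" unfolding e1 by blast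
  ultimately show ?case using 3 by (simp only:)
qed

lemma built_BST:
  assumes l: "1 \<le> l" "l \<le> m"
  shows "built (legs (map (\<lambda>i. (m - i) div l) (rev [1..<Suc l]))) 0 {..m}
    (BST_edges (Suc m) l \<union> (BST_edges (Suc m) l)\<inverse>)"
proof -
  have V: "{j \<in> {1..m}. (j - 1) mod l < l} = {1..m}" using l by auto
  have "(\<lambda>j. (if j \<le> l then 0 else j - l, j)) ` {1..m} = BST_edges (Suc m) l"
    by (auto simp: BST_edges_def)
  moreover have "{0} \<union> {1..m} = {..m}" by auto
  ultimately show ?thesis using built_star[OF l order_refl] unfolding V by (simp only:)
qed

text \<open>The root is the far end of the path, where the starlike tree is glued on next.\<close>

lemma built_cycle_path:
  defines "P \<equiv> \<lambda>q. cycle_edges 4 \<union> {(U_path_vertex 4 i, U_path_vertex 4 (Suc i)) |i. i < q}"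
  shows "built [cycle_ray q] (U_path_vertex 4 q) {..<4 + q} (P q \<union> (P q)\<inverse>)"
proof (induction q)
  case 0
  have four: "{..<4::nat} = {0, 1, 2, 3}" by auto
  have "Suc 0 mod 4 = 1" "Suc 1 mod 4 = 2" "Suc 2 mod 4 = 3" "Suc 3 mod 4 = 0" by simp_all
  then have "cycle_edges 4 = {(0, 1), (1, 2), (2, 3), (3, 0)}"
    unfolding cycle_edges_def setcompr_eq_image lessThan_def[symmetric] four by (simp only: image_insert image_empty)
  then have "P 0 \<union> (P 0)\<inverse> = square 0 1 2 3" by (auto simp: P_def square_def)
  moreover have "built [Cy [] [] []] (0::nat) {..<4} (square 0 1 2 3)"
    by (rule built_Cy_eq[OF built_Nil built_Nil[of 1] built_Nil[of 2] built_Nil[of 3]]) (use four in auto)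
  ultimately show ?case by (simp add: U_path_vertex_def)
next
  case (Suc q)
  have P: "P (Suc q) = insert (U_path_vertex 4 q, U_path_vertex 4 (Suc q)) (P q)"
    unfolding P_def by (auto simp: less_Suc_eq)
  have r: "U_path_vertex 4 (Suc q) = 4 + q" by (simp add: U_path_vertex_def)
  have "built [Br [cycle_ray q]] (4 + q) {..<4 + Suc q} (P (Suc q) \<union> (P (Suc q))\<inverse>)"
    unfolding P r by (rule built_Br_eq[OF built_Nil Suc.IH]) auto
  then show ?case by (simp add: r)
qed

lemma built_U_graph:
  assumes l: "1 \<le> l" and n: "q + 4 + l \<le> n"
  shows "\<exists>bs r. built (spider q bs) r {..<n} (parcs (U_graph n l 4 q)) \<and> balanced bs \<and> length bs = l"
proof -
  define m where "m = n - q - 4"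
  have m: "l \<le> m" "n = 4 + q + m" using n by (simp_all add: m_def)
  let ?f = "U_BST_vertex 4 q" and ?bs = "map (\<lambda>i. (m - i) div l) (rev [1..<Suc l])"
  define P where "P = cycle_edges 4 \<union> {(U_path_vertex 4 i, U_path_vertex 4 (Suc i)) |i. i < q}"
  define B where "B = BST_edges (Suc m) l"
  have w: "U_path_vertex 4 q < 4 + q" by (simp add: U_path_vertex_def)
  have f0: "?f 0 = U_path_vertex 4 q" and fS: "?f (Suc j) = 4 + q + j" for j
    by (simp_all add: U_BST_vertex_def)
  have img: "?f ` {..m} = insert (U_path_vertex 4 q) {4 + q..<n}"
  proof -
    have "{..m} = insert 0 (Suc ` {..<m})" by (auto simp: image_iff) (metis Suc_pred' bot_nat_0.not_eq_extremum Suc_le_lessD lessThan_iff)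
    moreover have "(\<lambda>j. 4 + q + j) ` {..<m} = {4 + q..<n}" using m(2) by (simp add: lessThan_atLeast0 image_add_atLeastLessThan add.commute)
    ultimately show ?thesis by (simp add: image_image f0 fS)
  qed
  have inj: "inj_on ?f {..m}"
  proof (rule inj_onI)
    fix i j assume "?f i = ?f j"
    then show "i = j" using w f0 fS by (cases i; cases j) auto
  qed
  have 1: "built [cycle_ray q] (U_path_vertex 4 q) {..<4 + q} (P \<union> P\<inverse>)"
    unfolding P_def by (rule built_cycle_path)
  have 2: "built (legs ?bs) (U_path_vertex 4 q) (?f ` {..m}) (map_prod ?f ?f ` (B \<union> B\<inverse>))"
    using built_image[OF built_BST[OF l m(1)] inj] unfolding f0 B_def .
  have "{..<4 + q} \<inter> ?f ` {..m} = {U_path_vertex 4 q}" unfolding img using w by auto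
  from built_append[OF 1 2 this]
  have "built (spider q ?bs) (U_path_vertex 4 q) ({..<4 + q} \<union> ?f ` {..m}) (P \<union> P\<inverse> \<union> map_prod ?f ?f ` (B \<union> B\<inverse>))"
    by (simp add: spider_legs)
  moreover have "{..<4 + q} \<union> ?f ` {..m} = {..<n}" unfolding img using w m(2) by auto
  moreover have "P \<union> P\<inverse> \<union> map_prod ?f ?f ` (B \<union> B\<inverse>) = parcs (U_graph n l 4 q)"
  proof -
    have "n - q - 4 + 1 = Suc m" by (simp add: m_def)
    then have "U_edges n l 4 q = P \<union> map_prod ?f ?f ` B" by (simp add: U_edges_def P_def B_def)
    moreover have "map_prod ?f ?f ` (B\<inverse>) = (map_prod ?f ?f ` B)\<inverse>" by force
    ultimately show ?thesis unfolding U_graph_def image_Un by auto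
  qed
  moreover have "balanced ?bs"
  proof -
    \<comment> \<open>Adding \<open>l\<close> to the numerator raises the quotient by one, so as
      \<open>i\<close> runs from 1 to \<open>l\<close> at most two values occur.\<close>
    have two: "(m - i) div l \<in> {(m - l) div l, Suc ((m - l) div l)}" if "1 \<le> i" "i \<le> l" for i
    proof -
      have "(m - l) div l \<le> (m - i) div l" using that by (intro div_le_mono) simp
      moreover have "(m - i) div l \<le> (m - l + l) div l" using m(1) by (intro div_le_mono) simp
      moreover have "(m - l + l) div l = Suc ((m - l) div l)" using l by (simp only: div_add_self2)
      ultimately show ?thesis by auto
    qed
    have "set ?bs \<subseteq> {(m - l) div l, Suc ((m - l) div l)}"
    proof
      fix x assume "x \<in> set ?bs"
      then obtain i where "1 \<le> i" "i \<le> l" "x = (m - i) div l" by auto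
      then show "x \<in> {(m - l) div l, Suc ((m - l) div l)}" using two by simp
    qed
    then show ?thesis unfolding balanced_def by blast
  qed
  moreover have "length ?bs = l" by simp
  ultimately show ?thesis by metis
qed

subsection \<open>The minimal elements\<close>

lemma iso_rel_built:
  assumes "(x, y) \<in> iso_rel (unicyclic_graphs n l g)" "built ts r {..<n} (parcs x)"
  shows "\<exists>w. built ts w {..<n} (parcs y)"
proof -
  have x: "x \<in> unicyclic_graphs n l g" and y: "y \<in> unicyclic_graphs n l g"
    and iso: "digraph_iso (with_proj x) (with_proj y)"
    using assms(1) by (simp_all add: iso_rel_def)
  interpret pair_graph x using x by (simp add: unicyclic_graphs_def)
  from iso digraph_iso_iff[OF pair_wf_digraph_axioms]
  have "\<exists>f. bij_betw f (pverts x) (pverts y) \<and> parcs y = map_prod f f ` parcs x" by (rule iffD1[rotated])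
  then obtain f where f: "bij_betw f (pverts x) (pverts y)" "parcs y = map_prod f f ` parcs x" by (elim exE conjE)
  have v: "pverts x = {..<n}" "pverts y = {..<n}" using x y by (simp_all add: unicyclic_graphs_def)
  have "inj_on f {..<n}" and im: "f ` {..<n} = {..<n}" using f(1) unfolding v bij_betw_def by simp_all
  then have "built ts (f r) (f ` {..<n}) (map_prod f f ` parcs x)" by (intro built_image assms(2))
  then show ?thesis unfolding im f(2)[symmetric] by (rule exI)
qed

lemma built_iso_rel:
  assumes "x \<in> unicyclic_graphs n l g" "y \<in> unicyclic_graphs n l g"
    and "built ts r {..<n} (parcs x)" "built ts w {..<n} (parcs y)"
  shows "(x, y) \<in> iso_rel (unicyclic_graphs n l g)"
proof -
  interpret pair_graph x using assms(1) by (simp add: unicyclic_graphs_def)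
  have v: "pverts x = {..<n}" "pverts y = {..<n}" using assms(1,2) by (simp_all add: unicyclic_graphs_def)
  obtain f where "bij_betw f {..<n} {..<n}" "parcs y = map_prod f f ` parcs x"
    using built_iso[OF assms(3,4)] by (elim exE conjE)
  then have "digraph_iso (with_proj x) (with_proj y)"
    unfolding digraph_iso_iff[OF pair_wf_digraph_axioms] v by (intro exI conjI)
  then show ?thesis using assms(1,2) by (simp add: iso_rel_def)
qed

lemma unicyclic_graph_built:
  assumes "G \<in> unicyclic_graphs n l 4"
  shows "\<exists>ts r. built ts r {..<n} (parcs G)"
proof -
  have "unic {..<n} (parcs G)" using unicI[of G] assms by (simp add: unicyclic_graphs_def)
  from unic_built[OF this] show ?thesis by blast
qed

text \<open>Two graphs isomorphic to a third inherit its form, and graphs with a common form are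
  isomorphic. Stated for two pairs leaving one graph, this gives symmetry together with
  transitivity.\<close>

lemma iso_rel_class_eq:
  assumes xy: "(x, y) \<in> iso_rel (unicyclic_graphs n l 4)"
  shows "iso_rel (unicyclic_graphs n l 4) `` {x} = iso_rel (unicyclic_graphs n l 4) `` {y}"
proof -
  let ?I = "iso_rel (unicyclic_graphs n l 4)"
  have mem: "x \<in> unicyclic_graphs n l 4" "y \<in> unicyclic_graphs n l 4" using xy by (simp_all add: iso_rel_def)
  have tr: "(a, c) \<in> ?I" if ab: "(b, a) \<in> ?I" and bc: "(b, c) \<in> ?I" for a b c
  proof -
    have m: "a \<in> unicyclic_graphs n l 4" "b \<in> unicyclic_graphs n l 4" "c \<in> unicyclic_graphs n l 4"
      using ab bc by (simp_all add: iso_rel_def)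
    obtain ts r where "built ts r {..<n} (parcs b)" using unicyclic_graph_built[OF m(2)] by blast
    then show ?thesis using iso_rel_built[OF ab] iso_rel_built[OF bc] built_iso_rel[OF m(1,3)] by blast
  qed
  have refl: "(a, a) \<in> ?I" if "a \<in> unicyclic_graphs n l 4" for a
    using unicyclic_graph_built[OF that] built_iso_rel[OF that that] by blast
  have "(y, x) \<in> ?I" using tr[OF xy refl[OF mem(1)]] .
  then show ?thesis using tr xy by blast
qed

lemma lap_le_trans: "lap_le A B \<Longrightarrow> lap_le B C \<Longrightarrow> lap_le A C"
  unfolding lap_le_def by (metis order_trans)

lemma lap_coeff_nonneg:
  assumes "G \<in> unicyclic_graphs n l 4" "k \<le> n"
  shows "0 \<le> lap_coeff G k"
proof -
  obtain ts r where b: "built ts r {..<n} (parcs G)" using unicyclic_graph_built[OF assms(1)] by blast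
  have "pos_poly (form_poly ts)" unfolding form_poly_def by (simp add: pos_poly_linear root_minor_pos root_link_nonneg_poly)
  then show ?thesis using lap_coeff_built[OF assms(1) b assms(2)] by (simp add: pos_poly_def nonneg_poly_def)
qed

text \<open>The sum of the coefficients is a natural number that strictly decreases along
  \<open>lap_less\<close>, so a graph below \<open>H\<close> with least sum is minimal.\<close>

lemma minimal_below:
  assumes H: "H \<in> unicyclic_graphs n l 4"
  shows "\<exists>M\<in>minimal_elements (unicyclic_graphs n l 4). lap_le M H"
proof -
  let ?U = "unicyclic_graphs n l 4"
  define \<mu> where "\<mu> G = nat (\<Sum>k\<le>n. lap_coeff G k)" for G
  have "H \<in> ?U \<and> lap_le H H" using H by (simp add: lap_le_def)
  from exists_least_iff[THEN iffD1, OF exI, of "\<lambda>m. \<exists>M. (M \<in> ?U \<and> lap_le M H) \<and> \<mu> M = m" "\<mu> H"] this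
  obtain M where M: "M \<in> ?U" "lap_le M H" and least: "\<And>M'. M' \<in> ?U \<Longrightarrow> lap_le M' H \<Longrightarrow> \<not> \<mu> M' < \<mu> M"
    by blast
  have "\<not> lap_less M' M" if M': "M' \<in> ?U" for M'
  proof
    assume less: "lap_less M' M"
    have n: "order_of M' = n" using M' by (simp add: unicyclic_graphs_def order_of_def)
    have "lap_le M' H" using less M(2) lap_le_trans by (auto simp: lap_less_def)
    moreover have "(\<Sum>k\<le>n. lap_coeff M' k) < (\<Sum>k\<le>n. lap_coeff M k)"
      using less n by (intro sum_strict_mono_ex1) (auto simp: lap_less_def lap_le_def)
    moreover have "0 \<le> (\<Sum>k\<le>n. lap_coeff M' k)"
      by (intro sum_nonneg lap_coeff_nonneg[OF M']) simp
    ultimately show False using least[OF M'] by (simp add: \<mu>_def)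
  qed
  then show ?thesis using M by (auto simp: minimal_elements_def)
qed

theorem theorem4p6:
  fixes n l p :: nat
  assumes "2 \<le> l"
    and "int p = \<lfloor>(real n - 4 - 3 * real l) / (real l + 1)\<rfloor>"
  shows "card (minimal_elements (unicyclic_graphs n l 4) // iso_rel (unicyclic_graphs n l 4)) = p + 1
    \<and> minimal_elements (unicyclic_graphs n l 4) // iso_rel (unicyclic_graphs n l 4)
        = {iso_rel (unicyclic_graphs n l 4) `` {U_graph n l 4 q} |q. q \<le> p}"
proof -
  let ?U = "unicyclic_graphs n l 4"
  let ?I = "iso_rel ?U" and ?M = "minimal_elements ?U" and ?u = "U_graph n l 4"
  \<comment> \<open>The floor becomes two subtraction-free bounds on \<open>n\<close>: the lower one
    makes room for every \<open>q \<le> p\<close>, the upper one limits \<open>q\<close> for a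
    minimal graph.\<close>
  have "real_of_int (int p) \<le> (real n - 4 - 3 * real l) / (real l + 1)"
    and "(real n - 4 - 3 * real l) / (real l + 1) < real_of_int (int p) + 1"
    unfolding assms(2) by linarith+
  then have "real p * (real l + 1) \<le> real n - 4 - 3 * real l"
    and "real n - 4 - 3 * real l < (real p + 1) * (real l + 1)"
    by (simp_all add: pos_le_divide_eq pos_divide_less_eq)
  then have "real (4 + 3 * l + p * (l + 1)) \<le> real n" "real n < real (4 + 3 * l + Suc p * (l + 1))"
    by (simp_all add: algebra_simps)
  then have n: "4 + 3 * l + p * (l + 1) \<le> n" "n < 4 + 3 * l + Suc p * (l + 1)"
    by (simp_all only: of_nat_le_iff of_nat_less_iff)
  have "\<exists>bs. (\<exists>r. built (spider q bs) r {..<n} (parcs (?u q))) \<and> balanced bs \<and> length bs = l" if "q \<le> p" for q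
  proof -
    have "q * 1 \<le> p * (l + 1)" using that by (intro mult_le_mono) simp_all
    then have "q + 4 + l \<le> n" using n(1) by simp
    then show ?thesis using built_U_graph[of l q n] assms(1) by auto
  qed
  then obtain bs where bs: "\<And>q. q \<le> p \<Longrightarrow>
      (\<exists>r. built (spider q (bs q)) r {..<n} (parcs (?u q))) \<and> balanced (bs q) \<and> length (bs q) = l"
    by metis
  have size: "form_size (spider q (bs q)) = n" if q: "q \<le> p" for q
    using bs[OF q] built_card by fastforce
  have uU: "?u q \<in> ?U" if q: "q \<le> p" for q
  proof -
    obtain r where r: "built (spider q (bs q)) r {..<n} (parcs (?u q))" using bs[OF q] by blast
    have "form_cycles (legs xs) = 0 \<and> form_leaves (legs xs) = length xs \<and> root_deg (legs xs) = length xs" for xs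
      by (induction xs) (simp_all del: branch_leaves.simps)
    moreover have "root_deg [cycle_ray q] \<noteq> 0" by (simp del: root_deg.simps)
    ultimately have "form_cycles (spider q (bs q)) = 1" "form_leaves (spider q (bs q)) = l" "root_deg (spider q (bs q)) \<noteq> 1"
      using bs[OF q] assms(1) by (simp_all add: spider_legs del: cycle_ray.simps)
    from built_in_unicyclic_graphs[OF r this(1,3,2)] show ?thesis by (simp add: U_graph_def)
  qed
  define f where "f q = form_poly (spider q (bs q))" for q
  have incomp: "coeff (f q') 2 < coeff (f q) 2" "coeff (f q) (n - 2 - 2 * q) < coeff (f q') (n - 2 - 2 * q)"
    if "q < q'" "q' \<le> p" for q q'
    unfolding f_def using spiders_incomparable[OF assms(1) n(1) _ that, of bs] bs size by blast+
  have n2: "2 \<le> n" using n(1) by simp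
  have minimal_iso: "\<exists>q\<le>p. (x, ?u q) \<in> ?I" if x: "x \<in> ?M" for x
  proof -
    have xU: "x \<in> ?U" and min: "\<not> (\<exists>H\<in>?U. lap_less H x)" using x by (auto simp: minimal_elements_def)
    obtain q b cs where s: "shape {..<n} (parcs x) (spider q (b # cs))" "set cs \<subseteq> {b, Suc b}" "length (b # cs) = l"
      "q = 0 \<or> q + 2 \<le> b" using minimal_spider[OF xU min assms(1)] by blast
    obtain r where r: "built (spider q (b # cs)) r {..<n} (parcs x)" using s(1) by (auto simp: shape_def)
    have sz: "form_size (spider q (b # cs)) = n" using built_card[OF r] by simp
    then have sz': "q + 4 + sum_list (b # cs) + l = n" using s(3) by (simp only: form_size_spider)
    \<comment> \<open>For \<open>q > 0\<close> each of the \<open>l\<close> legs has at least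
      \<open>q + 3\<close> vertices, and legs, path and square must fit into
      \<open>n\<close>.\<close>
    have q: "q \<le> p"
    proof (cases "q = 0")
      case False
      then have qb: "q + 2 \<le> b" using s(4) by simp
      have "length xs * (q + 2) \<le> sum_list xs" if "set xs \<subseteq> {b, Suc b}" for xs
        using that qb by (induction xs) auto
      moreover have "set (b # cs) \<subseteq> {b, Suc b}" using s(2) by simp
      ultimately have "length (b # cs) * (q + 2) \<le> sum_list (b # cs)" by blast
      then have "l * (q + 2) \<le> sum_list (b # cs)" unfolding s(3) .
      then have "4 + 3 * l + q * (l + 1) \<le> n" using sz' by (simp add: algebra_simps)
      then have "q * (l + 1) < Suc p * (l + 1)" using n(2) by linarith
      then show ?thesis by (simp del: mult_Suc mult_Suc_right)
    qed simp
    have "balanced (b # cs)" using s(2) unfolding balanced_def by (intro exI[of _ b]) auto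
    moreover have "sum_list (b # cs) = sum_list (bs q)"
      using sz' size[OF q] bs[OF q] by (simp add: form_size_spider)
    ultimately have "mset (b # cs) = mset (bs q)" using bs[OF q] s(3) by (intro balanced_unique) auto
    then have "mset (spider q (b # cs)) = mset (spider q (bs q))" by (simp only: spider_def mset.simps mset_map)
    from built_mset[OF r this] have "built (spider q (bs q)) r {..<n} (parcs x)" .
    then have "(x, ?u q) \<in> ?I" using bs[OF q] built_iso_rel[OF xU uU[OF q]] by blast
    then show ?thesis using q by blast
  qed
  have uM: "?u q \<in> ?M" if q: "q \<le> p" for q
  proof -
    have "\<not> lap_less H (?u q)" if H: "H \<in> ?U" for H
    proof
      assume less: "lap_less H (?u q)"
      \<comment> \<open>\<open>H\<close> itself may be any graph. A minimal graph below it is a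
        listed spider and can be compared with \<open>?u q\<close> by \<open>incomp\<close>.\<close>
      obtain N where N: "N \<in> ?M" "lap_le N H" using minimal_below[OF H] by blast
      then have NU: "N \<in> ?U" by (simp add: minimal_elements_def)
      obtain q' where q': "q' \<le> p" "(N, ?u q') \<in> ?I" using minimal_iso[OF N(1)] by blast
      then have "(?u q', N) \<in> ?I"
        using iso_rel_class_eq[OF q'(2)] unicyclic_graph_built[OF NU] built_iso_rel[OF NU NU] by blast
      then obtain w where w: "built (spider q' (bs q')) w {..<n} (parcs N)"
        using iso_rel_built bs[OF q'(1)] by blast
      obtain r where r: "built (spider q (bs q)) r {..<n} (parcs (?u q))" using bs[OF q] by blast
      have less': "lap_less N (?u q)"
      proof -
        have "order_of N = order_of H" using N(2) by (simp add: lap_le_def)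
        moreover have "lap_le N (?u q)" using N(2) less lap_le_trans by (auto simp: lap_less_def)
        ultimately show ?thesis using N(2) less unfolding lap_less_def lap_le_def by (metis order_le_less_trans)
      qed
      then have le: "coeff (f q') i \<le> coeff (f q) i" if "i \<le> n" for i
        using that lap_le_built[OF NU w uU[OF q] r] unfolding f_def by blast
      have strict: "\<exists>i\<le>n. coeff (f q') i < coeff (f q) i"
        using less' lap_le_built[OF NU w uU[OF q] r] unfolding f_def by blast
      consider "q' < q" | "q' = q" | "q < q'" by linarith
      then show False
      proof cases
        case 1
        show False using incomp(1)[OF 1 q] le[OF n2] by simp
      next
        case 2
        then show False using strict by simp
      next
        case 3
        show False using incomp(2)[OF 3 q'(1)] le[of "n - 2 - 2 * q"] by simp
      qed
    qed
    then show ?thesis using uU[OF q] by (auto simp: minimal_elements_def)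
  qed
  have quot: "?M // ?I = {?I `` {?u q} |q. q \<le> p}"
  proof
    show "?M // ?I \<subseteq> {?I `` {?u q} |q. q \<le> p}"
    proof
      fix X assume "X \<in> ?M // ?I"
      then obtain x where x: "x \<in> ?M" "X = ?I `` {x}" by (auto simp: quotient_def)
      obtain q where q: "q \<le> p" "(x, ?u q) \<in> ?I" using minimal_iso[OF x(1)] by blast
      then show "X \<in> {?I `` {?u q} |q. q \<le> p}" using x(2) iso_rel_class_eq[OF q(2)] by auto
    qed
    show "{?I `` {?u q} |q. q \<le> p} \<subseteq> ?M // ?I"
      using uM by (auto simp: quotient_def)
  qed
  \<comment> \<open>Isomorphic graphs have equal determinants, and the coefficient of \<lambda>^2
    already separates the listed graphs.\<close>
  have "inj_on (\<lambda>q. ?I `` {?u q}) {..p}"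
  proof (rule linorder_inj_onI)
    fix q q' assume less: "q < q'" and le: "q \<in> {..p}" "q' \<in> {..p}"
    then have q: "q \<le> p" "q' \<le> p" by simp_all
    show "?I `` {?u q} \<noteq> ?I `` {?u q'}"
    proof
      assume "?I `` {?u q} = ?I `` {?u q'}"
      moreover have "(?u q', ?u q') \<in> ?I"
        using bs[OF q(2)] built_iso_rel[OF uU[OF q(2)] uU[OF q(2)]] by blast
      ultimately have "(?u q, ?u q') \<in> ?I" by blast
      then obtain w where w: "built (spider q (bs q)) w {..<n} (parcs (?u q'))"
        using iso_rel_built bs[OF q(1)] by blast
      obtain r where r: "built (spider q' (bs q')) r {..<n} (parcs (?u q'))" using bs[OF q(2)] by blast
      have "f q = f q'"
        using built_ldet[OF w] built_ldet[OF r] by (simp add: f_def)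
      then show False using incomp(1)[OF less q(2)] by simp
    qed
  qed auto
  then have "card ((\<lambda>q. ?I `` {?u q}) ` {..p}) = p + 1" by (simp add: card_image)
  moreover have "(\<lambda>q. ?I `` {?u q}) ` {..p} = {?I `` {?u q} |q. q \<le> p}" by auto
  ultimately show ?thesis using quot by simp
qed

end
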